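(* Let $G$ be a locally compact Hausdorff ample étale groupoid. Assume that $G$ is effective and expansive. Then the Weyl group $$\mathfrak{W}_G=\mathrm{Aut}(C^*_r(G); C_0(G^{(0)}))/\mathrm{Aut}_{C_0(G^{(0)})}(C^*_r(G))$$ is a countable discrete group.
   Context: For a groupoid $G$, $G^{(0)}$ is the unit space, and $d,r\colon G\to G^{(0)}$ are the domain and range maps. A topological groupoid is étale if $d$ is a local homeomorphism; a locally compact Hausdorff étale groupoid is ample if it is totally disconnected. $G$ is effective if $G^{(0)}$ equals the interior of $\mathrm{Iso}(G)=\{\alpha\in G: d(\alpha)=r(\alpha)\}$. A subset $U\subset G$ is a bisection if $d|_U$ and $r|_U$ are injective. $\mathrm{Bis}^c(G)$ denotes the set of compact open bisections of $G$, an inverse semigroup under $UV=\{\alpha\beta: \alpha\in U,\beta\in V, d(\alpha)=r(\beta)\}$ with generalized inverse $U^*=U^{-1}=\{\alpha^{-1}:\alpha\in U\}$. An ample $G$ is expansive if there is a finite set $F\subset\mathrm{Bis}^c(G)$ such that the inverse subsemigroup of $\mathrm{Bis}^c(G)$ generated by $F$ (closure under products and generalized inverses) is an open basis of the topology of $G$. $C^*_r(G)$ is the reduced groupoid C*-algebra and $C_0(G^{(0)})\subset C^*_r(G)$ the canonical C*-subalgebra. For C*-algebras $B\subset A$, $\mathrm{Aut}(A;B)=\{\varphi\in\mathrm{Aut}(A): \varphi(B)=B\}$ and $\mathrm{Aut}_B(A)=\{\varphi\in\mathrm{Aut}(A):\varphi(b)=b\text{ for all }b\in B\}$ (a normal subgroup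 of $\mathrm{Aut}(A;B)$), with the relative topologies of the strong (point-norm) topology of $\mathrm{Aut}(A)$, i.e. the weakest topology making $\varphi\mapsto\varphi(a)$ norm-continuous for all $a\in A$. The Weyl group carries the quotient topology. *)

theory Defs
  imports "HOL-Analysis.Analysis" "HOL-Algebra.Coset" "HOL-Algebra.Bij"
begin

section \<open>Topological groupoids\<close>

text \<open>A groupoid is given by its arrows; a unit is identified with its identity arrow.
  The set of arrows is the underlying set of the topology, so the empty groupoid is allowed.
  The operations are only relevant on arrows, and \<open>mul\<close> only on composable pairs.\<close>

record 'g groupoid =
  gtop :: "'g topology"
  dom :: "'g \<Rightarrow> 'g"
  rng :: "'g \<Rightarrow> 'g"
  mul :: "'g \<Rightarrow> 'g \<Rightarrow> 'g"
  ginv :: "'g \<Rightarrow> 'g"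

definition arrows :: "'g groupoid \<Rightarrow> 'g set" where
  "arrows G = topspace (gtop G)"

definition units :: "'g groupoid \<Rightarrow> 'g set" where
  "units G = dom G ` arrows G"

definition unit_top :: "'g groupoid \<Rightarrow> 'g topology" where
  "unit_top G = subtopology (gtop G) (units G)"

definition composable :: "'g groupoid \<Rightarrow> ('g \<times> 'g) set" where
  "composable G = {(\<alpha>, \<beta>). \<alpha> \<in> arrows G \<and> \<beta> \<in> arrows G \<and> dom G \<alpha> = rng G \<beta>}"

locale groupoid =
  fixes G :: "'g groupoid"
  assumes dom_arrow: "\<alpha> \<in> arrows G \<Longrightarrow> dom G \<alpha> \<in> arrows G"
    and rng_unit: "\<alpha> \<in> arrows G \<Longrightarrow> rng G \<alpha> \<in> units G"
    and dom_of_unit: "x \<in> units G \<Longrightarrow> dom G x = x"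
    and rng_of_unit: "x \<in> units G \<Longrightarrow> rng G x = x"
    and mul_arrow: "(\<alpha>, \<beta>) \<in> composable G \<Longrightarrow> mul G \<alpha> \<beta> \<in> arrows G"
    and dom_mul: "(\<alpha>, \<beta>) \<in> composable G \<Longrightarrow> dom G (mul G \<alpha> \<beta>) = dom G \<beta>"
    and rng_mul: "(\<alpha>, \<beta>) \<in> composable G \<Longrightarrow> rng G (mul G \<alpha> \<beta>) = rng G \<alpha>"
    and mul_assoc: "(\<alpha>, \<beta>) \<in> composable G \<Longrightarrow> (\<beta>, \<gamma>) \<in> composable G \<Longrightarrow>
           mul G (mul G \<alpha> \<beta>) \<gamma> = mul G \<alpha> (mul G \<beta> \<gamma>)"
    and mul_dom: "\<alpha> \<in> arrows G \<Longrightarrow> mul G \<alpha> (dom G \<alpha>) = \<alpha>"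
    and rng_mul_self: "\<alpha> \<in> arrows G \<Longrightarrow> mul G (rng G \<alpha>) \<alpha> = \<alpha>"
    and ginv_arrow: "\<alpha> \<in> arrows G \<Longrightarrow> ginv G \<alpha> \<in> arrows G"
    and dom_ginv: "\<alpha> \<in> arrows G \<Longrightarrow> dom G (ginv G \<alpha>) = rng G \<alpha>"
    and rng_ginv: "\<alpha> \<in> arrows G \<Longrightarrow> rng G (ginv G \<alpha>) = dom G \<alpha>"
    and ginv_mul: "\<alpha> \<in> arrows G \<Longrightarrow> mul G (ginv G \<alpha>) \<alpha> = dom G \<alpha>"
    and mul_ginv: "\<alpha> \<in> arrows G \<Longrightarrow> mul G \<alpha> (ginv G \<alpha>) = rng G \<alpha>"

text \<open>Continuity of \<open>dom\<close> and \<open>rng\<close> follows from the identities \<open>ginv_mul\<close> and \<open>mul_ginv\<close>.\<close>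

locale topological_groupoid = groupoid +
  assumes continuous_mul:
      "continuous_map (subtopology (prod_topology (gtop G) (gtop G)) (composable G)) (gtop G)
         (\<lambda>(\<alpha>, \<beta>). mul G \<alpha> \<beta>)"
    and continuous_ginv: "continuous_map (gtop G) (gtop G) (ginv G)"

definition local_homeomorphism :: "'a topology \<Rightarrow> 'b topology \<Rightarrow> ('a \<Rightarrow> 'b) \<Rightarrow> bool" where
  "local_homeomorphism X Y f \<longleftrightarrow>
     (\<forall>x\<in>topspace X. \<exists>U. openin X U \<and> x \<in> U \<and> openin Y (f ` U) \<and>
        homeomorphic_map (subtopology X U) (subtopology Y (f ` U)) f)"

definition totally_disconnected_space :: "'a topology \<Rightarrow> bool" where
  "totally_disconnected_space X \<longleftrightarrow> (\<forall>S. connectedin X S \<longrightarrow> (\<exists>a. S \<subseteq> {a}))"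

locale etale_groupoid = topological_groupoid +
  assumes dom_local_homeomorphism: "local_homeomorphism (gtop G) (unit_top G) (dom G)"

locale ample_groupoid = etale_groupoid +
  assumes locally_compact: "locally_compact_space (gtop G)"
    and Hausdorff: "Hausdorff_space (gtop G)"
    and totally_disconnected: "totally_disconnected_space (gtop G)"

definition isotropy :: "'g groupoid \<Rightarrow> 'g set" where
  "isotropy G = {\<alpha> \<in> arrows G. dom G \<alpha> = rng G \<alpha>}"

definition effective :: "'g groupoid \<Rightarrow> bool" where
  "effective G \<longleftrightarrow> units G = gtop G interior_of isotropy G"

definition bisection :: "'g groupoid \<Rightarrow> 'g set \<Rightarrow> bool" where
  "bisection G U \<longleftrightarrow> U \<subseteq> arrows G \<and> inj_on (dom G) U \<and> inj_on (rng G) U"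

definition compact_open_bisections :: "'g groupoid \<Rightarrow> 'g set set" where
  "compact_open_bisections G = {U. compactin (gtop G) U \<and> openin (gtop G) U \<and> bisection G U}"

definition set_mul :: "'g groupoid \<Rightarrow> 'g set \<Rightarrow> 'g set \<Rightarrow> 'g set" where
  "set_mul G U V = {mul G \<alpha> \<beta> | \<alpha> \<beta>. \<alpha> \<in> U \<and> \<beta> \<in> V \<and> dom G \<alpha> = rng G \<beta>}"

inductive_set generated_inverse_semigroup :: "'g groupoid \<Rightarrow> 'g set set \<Rightarrow> 'g set set"
  for G F where
    generator: "U \<in> F \<Longrightarrow> U \<in> generated_inverse_semigroup G F"
  | product: "U \<in> generated_inverse_semigroup G F \<Longrightarrow> V \<in> generated_inverse_semigroup G F \<Longrightarrow>
      set_mul G U V \<in> generated_inverse_semigroup G F"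
  | inverse: "U \<in> generated_inverse_semigroup G F \<Longrightarrow>
      ginv G ` U \<in> generated_inverse_semigroup G F"

definition open_basis :: "'a topology \<Rightarrow> 'a set set \<Rightarrow> bool" where
  "open_basis X \<B> \<longleftrightarrow> (\<forall>U\<in>\<B>. openin X U) \<and> (\<forall>V. openin X V \<longrightarrow> (\<exists>\<S>\<subseteq>\<B>. V = \<Union>\<S>))"

definition expansive :: "'g groupoid \<Rightarrow> bool" where
  "expansive G \<longleftrightarrow>
     (\<exists>F. finite F \<and> F \<subseteq> compact_open_bisections G \<and>
        open_basis (gtop G) (generated_inverse_semigroup G F))"


section \<open>The complex Hilbert space of square-summable functions\<close>

typedef 'g ell2 = "{\<xi> :: 'g \<Rightarrow> complex. (\<lambda>x. (cmod (\<xi> x))\<^sup>2) summable_on UNIV}"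
  morphisms coord Abs_ell2
  by (rule exI[of _ "\<lambda>_. 0"]) simp

setup_lifting type_definition_ell2

lemma summable_coord_sq: "(\<lambda>x. (cmod (coord \<xi> x))\<^sup>2) summable_on UNIV"
  using coord[of \<xi>] by simp

lemma square_summable_add:
  fixes f g :: "'g \<Rightarrow> complex"
  assumes "(\<lambda>x. (cmod (f x))\<^sup>2) summable_on UNIV" and "(\<lambda>x. (cmod (g x))\<^sup>2) summable_on UNIV"
  shows "(\<lambda>x. (cmod (f x + g x))\<^sup>2) summable_on UNIV"
proof (rule summable_on_comparison_test)
  show "(\<lambda>x. 2 * (cmod (f x))\<^sup>2 + 2 * (cmod (g x))\<^sup>2) summable_on UNIV"
    by (intro summable_on_add summable_on_cmult_right assms)
  fix x
  have "(cmod (f x + g x))\<^sup>2 \<le> (cmod (f x) + cmod (g x))\<^sup>2"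
    by (intro power_mono norm_triangle_ineq norm_ge_zero)
  also have "\<dots> \<le> 2 * (cmod (f x))\<^sup>2 + 2 * (cmod (g x))\<^sup>2"
    using sum_squares_bound[of "cmod (f x)" "cmod (g x)"] by (simp add: power2_sum)
  finally show "(cmod (f x + g x))\<^sup>2 \<le> 2 * (cmod (f x))\<^sup>2 + 2 * (cmod (g x))\<^sup>2" .
qed auto

lemma square_summable_scale:
  fixes f :: "'g \<Rightarrow> complex"
  assumes "(\<lambda>x. (cmod (f x))\<^sup>2) summable_on UNIV"
  shows "(\<lambda>x. (cmod (c * f x))\<^sup>2) summable_on UNIV"
  using summable_on_cmult_right[OF assms, of "(cmod c)\<^sup>2"]
  by (simp add: norm_mult power_mult_distrib)

lemma summable_coord_inner: "(\<lambda>x. coord \<xi> x \<bullet> coord \<eta> x) summable_on UNIV"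
proof -
  have "(\<lambda>x. (1/2) * ((cmod (coord \<xi> x + coord \<eta> x))\<^sup>2 + (- 1) * (cmod (coord \<xi> x))\<^sup>2
          + (- 1) * (cmod (coord \<eta> x))\<^sup>2)) summable_on UNIV"
    by (intro summable_on_cmult_right summable_on_add square_summable_add summable_coord_sq)
  moreover have "(\<lambda>x. (1/2) * ((cmod (coord \<xi> x + coord \<eta> x))\<^sup>2 + (- 1) * (cmod (coord \<xi> x))\<^sup>2
          + (- 1) * (cmod (coord \<eta> x))\<^sup>2)) = (\<lambda>x. coord \<xi> x \<bullet> coord \<eta> x)"
    by (rule ext) (simp add: power2_norm_eq_inner inner_add_left inner_add_right inner_commute)
  ultimately show ?thesis by simp
qed

text \<open>The underlying real inner product, whose norm is the Hilbert space norm.\<close>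

instantiation ell2 :: (type) real_inner
begin

lift_definition zero_ell2 :: "'a ell2" is "\<lambda>_. 0" by simp
lift_definition plus_ell2 :: "'a ell2 \<Rightarrow> 'a ell2 \<Rightarrow> 'a ell2" is "\<lambda>\<xi> \<eta> x. \<xi> x + \<eta> x"
  by (rule square_summable_add)
lift_definition uminus_ell2 :: "'a ell2 \<Rightarrow> 'a ell2" is "\<lambda>\<xi> x. - \<xi> x" by simp
lift_definition minus_ell2 :: "'a ell2 \<Rightarrow> 'a ell2 \<Rightarrow> 'a ell2" is "\<lambda>\<xi> \<eta> x. \<xi> x - \<eta> x"
proof -
  fix f g :: "'a \<Rightarrow> complex"
  assume "(\<lambda>x. (cmod (f x))\<^sup>2) summable_on UNIV" "(\<lambda>x. (cmod (g x))\<^sup>2) summable_on UNIV"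
  then show "(\<lambda>x. (cmod (f x - g x))\<^sup>2) summable_on UNIV"
    using square_summable_add[of f "\<lambda>x. - g x"] by simp
qed
lift_definition scaleR_ell2 :: "real \<Rightarrow> 'a ell2 \<Rightarrow> 'a ell2" is "\<lambda>t \<xi> x. t *\<^sub>R \<xi> x"
  unfolding scaleR_conv_of_real by (rule square_summable_scale)
definition inner_ell2 :: "'a ell2 \<Rightarrow> 'a ell2 \<Rightarrow> real" where
  "inner_ell2 \<xi> \<eta> = (\<Sum>\<^sub>\<infinity>x. coord \<xi> x \<bullet> coord \<eta> x)"
definition norm_ell2 :: "'a ell2 \<Rightarrow> real" where "norm_ell2 \<xi> = sqrt (\<xi> \<bullet> \<xi>)"
definition dist_ell2 :: "'a ell2 \<Rightarrow> 'a ell2 \<Rightarrow> real" where "dist_ell2 \<xi> \<eta> = norm (\<xi> - \<eta>)"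
definition sgn_ell2 :: "'a ell2 \<Rightarrow> 'a ell2" where "sgn_ell2 \<xi> = inverse (norm \<xi>) *\<^sub>R \<xi>"
definition uniformity_ell2 :: "('a ell2 \<times> 'a ell2) filter" where
  "uniformity_ell2 = (INF e\<in>{0<..}. principal {(\<xi>, \<eta>). dist \<xi> \<eta> < e})"
definition open_ell2 :: "'a ell2 set \<Rightarrow> bool" where
  "open_ell2 U \<longleftrightarrow> (\<forall>\<xi>\<in>U. \<forall>\<^sub>F (\<xi>', \<eta>) in uniformity. \<xi>' = \<xi> \<longrightarrow> \<eta> \<in> U)"

instance
proof
  fix \<xi> \<eta> \<zeta> :: "'a ell2" and s t :: real
  show "\<xi> + \<eta> + \<zeta> = \<xi> + (\<eta> + \<zeta>)" by transfer (simp add: add.assoc)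
  show "\<xi> + \<eta> = \<eta> + \<xi>" by transfer (simp add: add.commute)
  show "0 + \<xi> = \<xi>" by transfer simp
  show "- \<xi> + \<xi> = 0" by transfer simp
  show "\<xi> - \<eta> = \<xi> + - \<eta>" by transfer simp
  show "t *\<^sub>R (\<xi> + \<eta>) = t *\<^sub>R \<xi> + t *\<^sub>R \<eta>" by transfer (simp add: scaleR_add_right)
  show "(s + t) *\<^sub>R \<xi> = s *\<^sub>R \<xi> + t *\<^sub>R \<xi>" by transfer (simp add: scaleR_add_left)
  show "s *\<^sub>R t *\<^sub>R \<xi> = (s * t) *\<^sub>R \<xi>" by transfer simp
  show "1 *\<^sub>R \<xi> = \<xi>" by transfer simp
  show "dist \<xi> \<eta> = norm (\<xi> - \<eta>)" by (rule dist_ell2_def)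
  show "sgn \<xi> = inverse (norm \<xi>) *\<^sub>R \<xi>" by (rule sgn_ell2_def)
  show "(uniformity :: ('a ell2 \<times> 'a ell2) filter)
      = (INF e\<in>{0<..}. principal {(\<xi>, \<eta>). dist \<xi> \<eta> < e})"
    by (rule uniformity_ell2_def)
  show "open U \<longleftrightarrow> (\<forall>\<xi>\<in>U. \<forall>\<^sub>F (\<xi>', \<eta>) in uniformity. \<xi>' = \<xi> \<longrightarrow> \<eta> \<in> U)"
    for U :: "'a ell2 set" by (rule open_ell2_def)
  show "\<xi> \<bullet> \<eta> = \<eta> \<bullet> \<xi>" by (simp add: inner_ell2_def inner_commute)
  show "(\<xi> + \<eta>) \<bullet> \<zeta> = \<xi> \<bullet> \<zeta> + \<eta> \<bullet> \<zeta>"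
    by (simp add: inner_ell2_def plus_ell2.rep_eq inner_add_left infsum_add summable_coord_inner)
  show "(t *\<^sub>R \<xi>) \<bullet> \<eta> = t * (\<xi> \<bullet> \<eta>)"
    by (simp add: inner_ell2_def scaleR_ell2.rep_eq infsum_cmult_right')
  show "0 \<le> \<xi> \<bullet> \<xi>" by (simp add: inner_ell2_def infsum_nonneg)
  show "\<xi> \<bullet> \<xi> = 0 \<longleftrightarrow> \<xi> = 0"
  proof
    assume *: "\<xi> \<bullet> \<xi> = 0"
    have "coord \<xi> x \<bullet> coord \<xi> x = 0" for x
      using * summable_coord_inner[of \<xi> \<xi>] unfolding inner_ell2_def
      by (intro nonneg_infsum_le_0D[where A = UNIV]) auto
    then show "\<xi> = 0" by (auto simp: coord_inject[symmetric] zero_ell2.rep_eq)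
  qed (simp add: inner_ell2_def zero_ell2.rep_eq)
  show "norm \<xi> = sqrt (\<xi> \<bullet> \<xi>)" by (rule norm_ell2_def)
qed

end

definition cinner :: "'g ell2 \<Rightarrow> 'g ell2 \<Rightarrow> complex" where
  "cinner \<xi> \<eta> = (\<Sum>\<^sub>\<infinity>x. coord \<xi> x * cnj (coord \<eta> x))"

lift_definition scaleC :: "complex \<Rightarrow> 'g ell2 \<Rightarrow> 'g ell2" is "\<lambda>c \<xi> x. c * \<xi> x"
  by (rule square_summable_scale)

lemma norm_scaleC: "norm (scaleC c \<xi>) = cmod c * norm \<xi>"
proof -
  have "scaleC c \<xi> \<bullet> scaleC c \<xi> = (cmod c)\<^sup>2 * (\<xi> \<bullet> \<xi>)"
    by (simp add: inner_ell2_def scaleC.rep_eq power2_norm_eq_inner[symmetric] norm_mult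
        power_mult_distrib infsum_cmult_right')
  then show ?thesis
    by (simp add: norm_ell2_def real_sqrt_mult)
qed

text \<open>Operators are real bounded linear maps, and the operator norm is that of
  \<^typ>\<open>'g ell2 \<Rightarrow>\<^sub>L 'g ell2\<close>. The operator algebras below consist of complex linear operators:
  those in \<open>reg_ops\<close> are complex linear, and complex linearity passes to norm limits.\<close>

type_synonym 'g operator = "'g ell2 \<Rightarrow>\<^sub>L 'g ell2"

lift_definition scalar_op :: "complex \<Rightarrow> 'g operator" is scaleC
proof (rule bounded_linear_intro)
  fix c :: complex and \<xi> \<eta> :: "'g ell2" and t :: real
  show "scaleC c (\<xi> + \<eta>) = scaleC c \<xi> + scaleC c \<eta>" by transfer (simp add: distrib_left)
  show "scaleC c (t *\<^sub>R \<xi>) = t *\<^sub>R scaleC c \<xi>" by transfer simp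
  show "norm (scaleC c \<xi>) \<le> norm \<xi> * cmod c" by (simp add: norm_scaleC)
qed

definition scale_op :: "complex \<Rightarrow> 'g operator \<Rightarrow> 'g operator" where
  "scale_op c a = scalar_op c o\<^sub>L a"

definition is_adjoint :: "'g operator \<Rightarrow> 'g operator \<Rightarrow> bool" where
  "is_adjoint a b \<longleftrightarrow> (\<forall>\<xi> \<eta>. cinner (a \<xi>) \<eta> = cinner \<xi> (b \<eta>))"


section \<open>The reduced groupoid C*-algebra\<close>

text \<open>Functions on arrows or on units are extended by zero to the whole type.\<close>

definition Cc :: "'g groupoid \<Rightarrow> ('g \<Rightarrow> complex) set" where
  "Cc G = {f. continuous_map (gtop G) euclidean f \<and>
              compactin (gtop G) (gtop G closure_of {\<alpha> \<in> arrows G. f \<alpha> \<noteq> 0}) \<and>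
              (\<forall>\<alpha>. \<alpha> \<notin> arrows G \<longrightarrow> f \<alpha> = 0)}"

definition C0_units :: "'g groupoid \<Rightarrow> ('g \<Rightarrow> complex) set" where
  "C0_units G = {f. continuous_map (unit_top G) euclidean f \<and>
                    (\<forall>\<epsilon>>0. compactin (unit_top G) {x \<in> units G. \<epsilon> \<le> cmod (f x)}) \<and>
                    (\<forall>\<alpha>. \<alpha> \<notin> units G \<longrightarrow> f \<alpha> = 0)}"

text \<open>The left regular representation: \<open>f\<close> acts on a square-summable \<open>\<xi>\<close> by convolution,
  \<open>(f \<xi>)(\<gamma>) = \<Sum> f \<alpha> * \<xi> (\<alpha>\<^sup>-\<^sup>1 \<gamma>)\<close> over all arrows \<open>\<alpha>\<close> with the same range as \<open>\<gamma>\<close>.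
  On the arrows this is the direct sum over all units \<open>x\<close> of the regular representations on
  the square-summable functions on \<open>{\<gamma>. dom \<gamma> = x}\<close>, so its operator norm is the
  reduced norm; on the part of the type outside the arrows every operator is zero.
  For an etale groupoid and \<open>f\<close> in \<open>Cc\<close> the sums are finite and the operator is bounded.\<close>

definition implements :: "'g groupoid \<Rightarrow> ('g \<Rightarrow> complex) \<Rightarrow> 'g operator \<Rightarrow> bool" where
  "implements G f a \<longleftrightarrow>
     (\<forall>\<xi> \<gamma>. coord (a \<xi>) \<gamma> =
        (if \<gamma> \<in> arrows G
         then \<Sum>\<^sub>\<infinity>\<alpha>\<in>{\<alpha> \<in> arrows G. rng G \<alpha> = rng G \<gamma>}. f \<alpha> * coord \<xi> (mul G (ginv G \<alpha>) \<gamma>)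
         else 0))"

definition reg_ops :: "'g groupoid \<Rightarrow> ('g \<Rightarrow> complex) set \<Rightarrow> 'g operator set" where
  "reg_ops G S = {a. \<exists>f\<in>S. implements G f a}"

definition reduced_algebra :: "'g groupoid \<Rightarrow> 'g operator set" where
  "reduced_algebra G = closure (reg_ops G (Cc G))"

text \<open>A function in \<open>C0_units\<close> acts as multiplication by \<open>f (rng \<gamma>)\<close>.\<close>

definition diagonal_algebra :: "'g groupoid \<Rightarrow> 'g operator set" where
  "diagonal_algebra G = reg_ops G (C0_units G)"


section \<open>Automorphism groups and the Weyl group\<close>

text \<open>Automorphisms are *-automorphisms, represented as elements of \<^term>\<open>Bij A\<close>, i.e. bijections
  of \<open>A\<close> that are \<open>undefined\<close> outside \<open>A\<close>, so that equality is equality on \<open>A\<close>.\<close>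

definition Aut :: "'g operator set \<Rightarrow> ('g operator \<Rightarrow> 'g operator) set" where
  "Aut A = {\<phi> \<in> Bij A.
     (\<forall>a\<in>A. \<forall>b\<in>A. \<phi> (a + b) = \<phi> a + \<phi> b) \<and>
     (\<forall>c. \<forall>a\<in>A. \<phi> (scale_op c a) = scale_op c (\<phi> a)) \<and>
     (\<forall>a\<in>A. \<forall>b\<in>A. \<phi> (a o\<^sub>L b) = \<phi> a o\<^sub>L \<phi> b) \<and>
     (\<forall>a\<in>A. \<forall>b\<in>A. is_adjoint a b \<longrightarrow> is_adjoint (\<phi> a) (\<phi> b))}"

definition Aut_pair ::
  "'g operator set \<Rightarrow> 'g operator set \<Rightarrow> ('g operator \<Rightarrow> 'g operator) set" where
  "Aut_pair A B = {\<phi> \<in> Aut A. \<phi> ` B = B}"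

definition Aut_fix ::
  "'g operator set \<Rightarrow> 'g operator set \<Rightarrow> ('g operator \<Rightarrow> 'g operator) set" where
  "Aut_fix A B = {\<phi> \<in> Aut A. \<forall>b\<in>B. \<phi> b = b}"

definition Aut_pair_group ::
  "'g operator set \<Rightarrow> 'g operator set \<Rightarrow> ('g operator \<Rightarrow> 'g operator) monoid" where
  "Aut_pair_group A B = (BijGroup A)\<lparr>carrier := Aut_pair A B\<rparr>"

definition point_norm_topology ::
  "'g operator set \<Rightarrow> ('g operator \<Rightarrow> 'g operator) topology" where
  "point_norm_topology A =
     topology_generated_by {{\<phi> \<in> Aut A. \<phi> a \<in> U} | a U. a \<in> A \<and> open U}"

definition quotient_topology :: "'a topology \<Rightarrow> ('a \<Rightarrow> 'b) \<Rightarrow> 'b topology" where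
  "quotient_topology X q =
     topology (\<lambda>V. V \<subseteq> q ` topspace X \<and> openin X {x \<in> topspace X. q x \<in> V})"

lemma openin_quotient_topology:
  "openin (quotient_topology X q) V \<longleftrightarrow>
     V \<subseteq> q ` topspace X \<and> openin X {x \<in> topspace X. q x \<in> V}"
proof -
  have "istopology (\<lambda>V. V \<subseteq> q ` topspace X \<and> openin X {x \<in> topspace X. q x \<in> V})"
    unfolding istopology_def
  proof (intro conjI allI impI)
    fix S T
    assume "S \<subseteq> q ` topspace X \<and> openin X {x \<in> topspace X. q x \<in> S}"
      and "T \<subseteq> q ` topspace X \<and> openin X {x \<in> topspace X. q x \<in> T}"
    moreover have "{x \<in> topspace X. q x \<in> S \<inter> T} =
        {x \<in> topspace X. q x \<in> S} \<inter> {x \<in> topspace X. q x \<in> T}" by auto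
    ultimately show "S \<inter> T \<subseteq> q ` topspace X" "openin X {x \<in> topspace X. q x \<in> S \<inter> T}"
      by (auto intro: openin_Int)
  next
    fix \<K>
    assume *: "\<forall>K\<in>\<K>. K \<subseteq> q ` topspace X \<and> openin X {x \<in> topspace X. q x \<in> K}"
    moreover have "{x \<in> topspace X. q x \<in> \<Union>\<K>} = (\<Union>K\<in>\<K>. {x \<in> topspace X. q x \<in> K})" by auto
    ultimately show "\<Union>\<K> \<subseteq> q ` topspace X" "openin X {x \<in> topspace X. q x \<in> \<Union>\<K>}"
      by auto
  qed
  then show ?thesis by (simp add: quotient_topology_def topology_inverse')
qed

lemma quotient_map_quotient_topology: "quotient_map X (quotient_topology X q) q"
proof -
  have "openin (quotient_topology X q) (q ` topspace X)"
    by (auto simp: openin_quotient_topology conj_commute intro: openin_subopen[THEN iffD2])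
  then have "topspace (quotient_topology X q) = q ` topspace X"
    by (meson openin_quotient_topology openin_subset openin_topspace subset_antisym)
  then show ?thesis by (auto simp: quotient_map_def openin_quotient_topology)
qed

definition Weyl_group :: "'g groupoid \<Rightarrow> ('g operator \<Rightarrow> 'g operator) set monoid" where
  "Weyl_group G =
     (let A = reduced_algebra G; B = diagonal_algebra G
      in Aut_pair_group A B Mod Aut_fix A B)"

definition Weyl_topology :: "'g groupoid \<Rightarrow> ('g operator \<Rightarrow> 'g operator) set topology" where
  "Weyl_topology G =
     (let A = reduced_algebra G; B = diagonal_algebra G
      in quotient_topology (subtopology (point_norm_topology A) (Aut_pair A B))
           (\<lambda>\<phi>. Aut_fix A B #>\<^bsub>Aut_pair_group A B\<^esub> \<phi>))"

end

theory Submission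
  imports Defs
begin

text \<open>Let \<open>F\<close> be a finite generating set of compact open bisections, and write \<open>n\<^sub>U\<close> for the partial
  isometry in the reduced algebra given by the indicator function of \<open>U\<close>. Conjugation by
  \<open>\<phi>(n\<^sub>U)\<close> permutes idempotents of the diagonal, and two idempotents of the diagonal at distance
  less than 1 are equal. So if \<open>\<phi>\<close> and \<open>\<psi>\<close> preserve the diagonal and are close on \<open>n\<^sub>U\<close> for
  \<open>U \<in> F \<union> F\<^sup>*\<close>, then \<open>\<phi>(n\<^sub>U)\<close> and \<open>\<psi>(n\<^sub>U)\<close> act identically on the idempotents, for these \<open>U\<close> and then
  for all \<open>U\<close> in the generated inverse semigroup. As the latter is a basis, \<open>\<phi>\<close> and \<open>\<psi>\<close> agree on the
  idempotents of the diagonal, hence on the diagonal. Thus the cosets of the automorphisms fixing the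
  diagonal are open, and since the reduced algebra is separable, there are only countably many.\<close>

section \<open>Square-summable functions\<close>

text \<open>Norm estimates on \<open>F\<close> would degrade along words, whose length is unbounded.
  They are therefore turned into equalities before any product is formed; equality of two
  conjugation actions passes to products without loss. Conjugation stays within the idempotents of
  the diagonal for two reasons: \<phi> maps the diagonal onto itself, so each idempotent is the
  image of the operator of a compact open set K of units, and U K U^-1 again consists of units. The
  diagonal need not be unital, so the range projection of the image of U is recorded separately;
  when U consists of units, this projection is the image itself. The passage from idempotents to the
  whole diagonal is algebraic and uses no continuity of automorphisms. Nor are automorphisms known
  to be isometric here: the neighbourhood of \<phi> depends on a bound M for \<phi> on the finitely
  many test operators, and the radius 1 / (2 M + 2) keeps the error \<delta> (2 M + 1) of a
  conjugation below 1.\<close>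

lemma norm_ell2_power2: "(norm \<xi>)\<^sup>2 = (\<Sum>\<^sub>\<infinity>x. (cmod (coord \<xi> x))\<^sup>2)"
  unfolding power2_norm_eq_inner by (simp add: inner_ell2_def power2_norm_eq_inner)

lemma coord_simps [simp]:
  "coord (\<xi> + \<eta>) x = coord \<xi> x + coord \<eta> x"
  "coord (\<xi> - \<eta>) x = coord \<xi> x - coord \<eta> x"
  "coord (t *\<^sub>R \<xi>) x = t *\<^sub>R coord \<xi> x"
  "coord (scaleC c \<xi>) x = c * coord \<xi> x"
  "coord 0 x = 0"
  by (transfer; simp)+

lemma ell2_eqI: "(\<And>x. coord \<xi> x = coord \<eta> x) \<Longrightarrow> \<xi> = \<eta>"
  by (auto simp: coord_inject[symmetric])

lemma sum_coord_le: "finite F \<Longrightarrow> (\<Sum>x\<in>F. (cmod (coord \<xi> x))\<^sup>2) \<le> (norm \<xi>)\<^sup>2"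
  unfolding norm_ell2_power2 by (intro finite_sum_le_infsum summable_coord_sq) auto

lemma norm_coord_le: "cmod (coord \<xi> x) \<le> norm \<xi>"
  using sum_coord_le[of "{x}" \<xi>] by (auto simp: power2_le_iff_abs_le)

text \<open>The limit is taken coordinatewise. Bounds on finite partial sums survive this limit,
  which gives both square-summability of the limit and convergence in norm. Completeness of the
  space of operators follows, and with it the limits of adjoints in
  \<open>closure_has_adjoint\<close>.\<close>

instance ell2 :: (type) complete_space
proof
  fix X :: "nat \<Rightarrow> 'a ell2"
  assume X: "Cauchy X"
  have "Cauchy (\<lambda>n. coord (X n) x)" for x
  proof (rule metric_CauchyI)
    fix e :: real assume "0 < e"
    then obtain N where N: "\<And>m n. m \<ge> N \<Longrightarrow> n \<ge> N \<Longrightarrow> dist (X m) (X n) < e"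
      using X by (meson metric_CauchyD)
    have "dist (coord (X m) x) (coord (X n) x) < e" if "m \<ge> N" "n \<ge> N" for m n
      using norm_coord_le[of "X m - X n" x] N[OF that] by (simp add: dist_norm)
    then show "\<exists>M. \<forall>m\<ge>M. \<forall>n\<ge>M. dist (coord (X m) x) (coord (X n) x) < e" by blast
  qed
  then obtain l where l: "\<And>x. (\<lambda>n. coord (X n) x) \<longlonglongrightarrow> l x"
    unfolding Cauchy_convergent_iff convergent_def by meson
  obtain K where K: "\<And>n. norm (X n) \<le> K"
    using cauchy_imp_bounded[OF X] by (auto simp: bounded_iff)
  have "(\<lambda>x. (cmod (l x))\<^sup>2) summable_on UNIV"
  proof (rule nonneg_bdd_above_summable_on)
    have "(\<Sum>x\<in>F. (cmod (l x))\<^sup>2) \<le> K\<^sup>2" if "finite F" for F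
    proof (rule LIMSEQ_le_const2)
      show "(\<lambda>n. \<Sum>x\<in>F. (cmod (coord (X n) x))\<^sup>2) \<longlonglongrightarrow> (\<Sum>x\<in>F. (cmod (l x))\<^sup>2)"
        by (intro tendsto_intros l)
      show "\<exists>N. \<forall>n\<ge>N. (\<Sum>x\<in>F. (cmod (coord (X n) x))\<^sup>2) \<le> K\<^sup>2"
        by (intro exI allI impI order_trans[OF sum_coord_le[OF that]] power_mono K norm_ge_zero)
    qed
    then show "bdd_above (sum (\<lambda>x. (cmod (l x))\<^sup>2) ` {F. F \<subseteq> UNIV \<and> finite F})"
      by (auto intro!: bdd_aboveI)
  qed auto
  then obtain L where L: "\<And>x. coord L x = l x"
    using Abs_ell2_inverse[of l] by (metis mem_Collect_eq)
  have "X \<longlonglongrightarrow> L"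
  proof (rule metric_LIMSEQ_I)
    fix e :: real assume e: "0 < e"
    then obtain N where N: "\<And>m n. m \<ge> N \<Longrightarrow> n \<ge> N \<Longrightarrow> dist (X m) (X n) < e / 2"
      using X by (meson half_gt_zero metric_CauchyD)
    have "dist (X n) L < e" if n: "n \<ge> N" for n
    proof -
      have "(\<Sum>x\<in>F. (cmod (coord (X n - L) x))\<^sup>2) \<le> (e / 2)\<^sup>2" if F: "finite F" for F
      proof (rule LIMSEQ_le_const2)
        show "(\<lambda>m. \<Sum>x\<in>F. (cmod (coord (X n - X m) x))\<^sup>2)
            \<longlonglongrightarrow> (\<Sum>x\<in>F. (cmod (coord (X n - L) x))\<^sup>2)"
          unfolding coord_simps L by (intro tendsto_intros l)
        show "\<exists>M. \<forall>m\<ge>M. (\<Sum>x\<in>F. (cmod (coord (X n - X m) x))\<^sup>2) \<le> (e / 2)\<^sup>2"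
          using N[OF n] by (intro exI[of _ N] allI impI order_trans[OF sum_coord_le[OF F]]
              power_mono norm_ge_zero) (simp add: dist_norm less_imp_le)
      qed
      then have "(norm (X n - L))\<^sup>2 \<le> (e / 2)\<^sup>2"
        unfolding norm_ell2_power2 by (intro infsum_le_finite_sums summable_coord_sq) auto
      then have "norm (X n - L) \<le> e / 2"
        using e by (simp add: power_mono_iff)
      then show ?thesis using e by (simp add: dist_norm)
    qed
    then show "\<exists>N. \<forall>n\<ge>N. dist (X n) L < e" by blast
  qed
  then show "convergent X" by (rule convergentI)
qed

instance ell2 :: (type) banach ..

text \<open>The imaginary part of a product with a conjugate is the real part after multiplying the
  second factor by \<i>. Additivity and bounds for \<open>cinner\<close> can thus be read off from
  the real inner product.\<close>

lemma cinner_eq: "cinner \<xi> \<eta> = of_real (\<xi> \<bullet> \<eta>) + \<i> * of_real (\<xi> \<bullet> scaleC \<i> \<eta>)"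
proof -
  have *: "coord \<xi> x * cnj (coord \<eta> x) = of_real (coord \<xi> x \<bullet> coord \<eta> x)
      + \<i> * of_real (coord \<xi> x \<bullet> coord (scaleC \<i> \<eta>) x)" for x
    by (auto simp: complex_eq_iff inner_complex_def algebra_simps)
  have s: "(\<lambda>x. complex_of_real (coord \<xi> x \<bullet> coord \<eta> x)) summable_on UNIV" for \<xi> \<eta> :: "'a ell2"
    by (rule summable_on_of_real[OF summable_coord_inner])
  show "cinner \<xi> \<eta> = of_real (\<xi> \<bullet> \<eta>) + \<i> * of_real (\<xi> \<bullet> scaleC \<i> \<eta>)"
    unfolding cinner_def * inner_ell2_def
    by (simp add: infsum_add summable_on_cmult_right s infsum_cmult_right'
        infsum_bounded_linear_strong[OF _ bounded_linear_of_real] summable_coord_inner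
        del: coord_simps)
qed

lemma Re_cinner: "Re (cinner \<xi> \<eta>) = \<xi> \<bullet> \<eta>"
  by (simp add: cinner_eq)

lemma bounded_linear_scaleC: "bounded_linear (scaleC c)"
  using blinfun.bounded_linear_right[of "scalar_op c"] by (simp add: scalar_op.rep_eq)

lemma bounded_bilinear_cinner: "bounded_bilinear cinner"
  unfolding cinner_eq
proof -
  interpret s: bounded_linear "scaleC \<i> :: 'a ell2 \<Rightarrow> 'a ell2" by (rule bounded_linear_scaleC)
  show "bounded_bilinear (\<lambda>\<xi> \<eta> :: 'a ell2. complex_of_real (\<xi> \<bullet> \<eta>) + \<i> * complex_of_real (\<xi> \<bullet> scaleC \<i> \<eta>))"
  proof
    show "\<exists>K. \<forall>a b :: 'a ell2. cmod (complex_of_real (a \<bullet> b) + \<i> * complex_of_real (a \<bullet> scaleC \<i> b))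
        \<le> norm a * norm b * K"
    \<comment> \<open>Cauchy-Schwarz is applied to the real and the imaginary part separately, hence
      the crude constant 2.\<close>
    proof (intro exI[of _ 2] allI)
      fix a b :: "'a ell2"
      have "cmod (complex_of_real (a \<bullet> b) + \<i> * complex_of_real (a \<bullet> scaleC \<i> b))
          \<le> \<bar>a \<bullet> b\<bar> + \<bar>a \<bullet> scaleC \<i> b\<bar>"
        by (rule order_trans[OF norm_triangle_ineq]) (simp add: norm_mult)
      also have "\<dots> \<le> norm a * norm b + norm a * norm (scaleC \<i> b)"
        by (intro add_mono Cauchy_Schwarz_ineq2)
      finally show "cmod (complex_of_real (a \<bullet> b) + \<i> * complex_of_real (a \<bullet> scaleC \<i> b))
          \<le> norm a * norm b * 2" by (simp add: norm_scaleC)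
    qed
  qed (simp_all add: inner_add_left inner_add_right s.add s.scaleR algebra_simps scaleR_conv_of_real)
qed

interpretation cinner: bounded_bilinear cinner
  by (rule bounded_bilinear_cinner)

lemma cinner_scaleC:
  "cinner (scaleC c \<xi>) \<eta> = c * cinner \<xi> \<eta>"
  "cinner \<xi> (scaleC c \<eta>) = cnj c * cinner \<xi> \<eta>"
  by (simp_all add: cinner_def infsum_cmult_right'[symmetric] mult_ac)

section \<open>Operators\<close>

lemma scale_op_apply [simp]: "scale_op c a \<xi> = scaleC c (a \<xi>)"
  by (simp add: scale_op_def scalar_op.rep_eq)

lemma is_adjointD: "is_adjoint a b \<Longrightarrow> a \<xi> \<bullet> \<eta> = \<xi> \<bullet> b \<eta>"
  by (metis Re_cinner is_adjoint_def)

lemma is_adjoint_unique: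
  assumes "is_adjoint a b" "is_adjoint a b'"
  shows "b = b'"
proof (rule blinfun_eqI)
  fix \<eta>
  have "\<xi> \<bullet> (b \<eta> - b' \<eta>) = 0" for \<xi>
    using is_adjointD[OF assms(1), of \<xi> \<eta>] is_adjointD[OF assms(2), of \<xi> \<eta>]
    by (simp add: inner_diff_right)
  then show "b \<eta> = b' \<eta>" by (metis inner_eq_zero_iff right_minus_eq)
qed

lemma is_adjoint_0: "is_adjoint 0 0"
  by (simp add: is_adjoint_def cinner.zero_left cinner.zero_right)

lemma is_adjoint_add: "is_adjoint a b \<Longrightarrow> is_adjoint a' b' \<Longrightarrow> is_adjoint (a + a') (b + b')"
  by (simp add: is_adjoint_def blinfun.add_left cinner.add_left cinner.add_right)

lemma is_adjoint_diff: "is_adjoint a b \<Longrightarrow> is_adjoint a' b' \<Longrightarrow> is_adjoint (a - a') (b - b')"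
  by (simp add: is_adjoint_def blinfun.diff_left cinner.diff_left cinner.diff_right)

lemma is_adjoint_scaleR: "is_adjoint a b \<Longrightarrow> is_adjoint (t *\<^sub>R a) (t *\<^sub>R b)"
  by (simp add: is_adjoint_def blinfun.scaleR_left cinner.scaleR_left cinner.scaleR_right)

lemma norm_adjoint_le:
  assumes "is_adjoint a b"
  shows "norm b \<le> norm a"
proof (rule norm_blinfun_bound)
  fix \<eta>
  have "norm (b \<eta>) * norm (b \<eta>) = a (b \<eta>) \<bullet> \<eta>"
    by (simp add: is_adjointD[OF assms] power2_norm_eq_inner[symmetric] power2_eq_square)
  also have "\<dots> \<le> norm (a (b \<eta>)) * norm \<eta>" by (rule norm_cauchy_schwarz)
  also have "\<dots> \<le> norm (b \<eta>) * (norm a * norm \<eta>)"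
    using mult_right_mono[OF norm_blinfun[of a "b \<eta>"], of "norm \<eta>"] by (simp add: mult_ac)
  finally show "norm (b \<eta>) \<le> norm a * norm \<eta>"
    by (cases "b \<eta> = 0") (simp_all add: mult_le_cancel_left_pos)
qed simp

text \<open>By \<open>norm_adjoint_le\<close> for differences, the adjoints of a convergent sequence
  form a Cauchy sequence. Their limit is the adjoint since \<open>cinner\<close> is
  continuous.\<close>

lemma closure_has_adjoint:
  assumes E: "subspace E" and adj: "\<And>a. a \<in> E \<Longrightarrow> \<exists>b\<in>E. is_adjoint a b" and a: "a \<in> closure E"
  shows "\<exists>b\<in>closure E. is_adjoint a b"
proof -
  obtain X where X: "\<And>n. X n \<in> E" "X \<longlonglongrightarrow> a"
    using a unfolding closure_sequential by blast
  obtain Y where Y: "\<And>n. Y n \<in> E" "\<And>n. is_adjoint (X n) (Y n)"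
    using adj[OF X(1)] by metis
  have "Cauchy Y"
  proof (rule metric_CauchyI)
    fix e :: real assume "0 < e"
    then obtain N where N: "\<And>m n. m \<ge> N \<Longrightarrow> n \<ge> N \<Longrightarrow> dist (X m) (X n) < e"
      using LIMSEQ_imp_Cauchy[OF X(2)] by (meson metric_CauchyD)
    have "dist (Y m) (Y n) \<le> dist (X m) (X n)" for m n
      unfolding dist_norm by (intro norm_adjoint_le is_adjoint_diff Y)
    then show "\<exists>M. \<forall>m\<ge>M. \<forall>n\<ge>M. dist (Y m) (Y n) < e"
      using N by (meson le_less_trans)
  qed
  then obtain b where b: "Y \<longlonglongrightarrow> b" by (auto simp: Cauchy_convergent_iff convergent_def)
  have "cinner (a \<xi>) \<eta> = cinner \<xi> (b \<eta>)" for \<xi> \<eta>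
  proof (rule LIMSEQ_unique)
    show "(\<lambda>n. cinner (X n \<xi>) \<eta>) \<longlonglongrightarrow> cinner (a \<xi>) \<eta>"
      by (intro cinner.tendsto tendsto_const blinfun.tendsto X)
    have "(\<lambda>n. cinner \<xi> (Y n \<eta>)) \<longlonglongrightarrow> cinner \<xi> (b \<eta>)"
      by (intro cinner.tendsto tendsto_const blinfun.tendsto b)
    then show "(\<lambda>n. cinner (X n \<xi>) \<eta>) \<longlonglongrightarrow> cinner \<xi> (b \<eta>)"
      using Y(2) by (simp add: is_adjoint_def)
  qed
  then have "is_adjoint a b" by (simp add: is_adjoint_def)
  moreover have "b \<in> closure E" using b Y(1) unfolding closure_sequential by meson
  ultimately show ?thesis by meson
qed

lemma subspace_closure:
  fixes E :: "'a::real_normed_vector set"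
  assumes "subspace E"
  shows "subspace (closure E)"
proof (rule subspaceI)
  show "0 \<in> closure E" using assms closure_subset subspace_0 by blast
  fix x y t assume "x \<in> closure E"
  then obtain X where X: "\<And>n. X n \<in> E" "X \<longlonglongrightarrow> x" unfolding closure_sequential by blast
  show "t *\<^sub>R x \<in> closure E"
    using X assms unfolding closure_sequential
    by (intro exI[of _ "\<lambda>n. t *\<^sub>R X n"]) (auto intro: tendsto_intros subspace_scale)
  assume "y \<in> closure E"
  then obtain Y where Y: "\<And>n. Y n \<in> E" "Y \<longlonglongrightarrow> y" unfolding closure_sequential by blast
  show "x + y \<in> closure E"
    using X Y assms unfolding closure_sequential
    by (intro exI[of _ "\<lambda>n. X n + Y n"]) (auto intro: tendsto_intros subspace_add)
qed

lemma closure_compose: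
  assumes "\<And>a b. a \<in> E \<Longrightarrow> b \<in> E \<Longrightarrow> a o\<^sub>L b \<in> E" "a \<in> closure E" "b \<in> closure E"
  shows "a o\<^sub>L b \<in> closure (E :: ('a::real_normed_vector \<Rightarrow>\<^sub>L 'a) set)"
proof -
  obtain X Y where "\<And>n. X n \<in> E" "X \<longlonglongrightarrow> a" "\<And>n. Y n \<in> E" "Y \<longlonglongrightarrow> b"
    using assms unfolding closure_sequential by blast
  then show ?thesis
    unfolding closure_sequential using assms(1)
    by (intro exI[of _ "\<lambda>n. X n o\<^sub>L Y n"])
      (auto intro: bounded_bilinear.tendsto[OF bounded_bilinear_blinfun_compose])
qed

lemma closure_scale_op:
  assumes "\<And>a. a \<in> E \<Longrightarrow> scale_op c a \<in> E" "a \<in> closure E"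
  shows "scale_op c a \<in> closure E"
proof -
  obtain X where "\<And>n. X n \<in> E" "X \<longlonglongrightarrow> a"
    using assms unfolding closure_sequential by blast
  then show ?thesis
    unfolding closure_sequential using assms(1)
    by (intro exI[of _ "\<lambda>n. scale_op c (X n)"])
      (auto simp: scale_op_def intro!: bounded_bilinear.tendsto[OF bounded_bilinear_blinfun_compose])
qed

text \<open>A weighted composition operator. All operators of bisections have this form, so
  boundedness and adjoints are settled once here. The value is meaningful when \<tau> is injective
  on \<open>D\<close> and \<open>w\<close> is bounded there.\<close>

definition wcomp :: "'g set \<Rightarrow> ('g \<Rightarrow> 'g) \<Rightarrow> ('g \<Rightarrow> complex) \<Rightarrow> 'g operator" where
  "wcomp D \<tau> w = Blinfun (\<lambda>\<xi>. Abs_ell2 (\<lambda>\<gamma>. if \<gamma> \<in> D then w \<gamma> * coord \<xi> (\<tau> \<gamma>) else 0))"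

text \<open>Reindexing along the injective \<tau> turns the sum over \<open>D\<close> into a sum
  over its image, which is at most the full sum.\<close>

lemma
  fixes w :: "'g \<Rightarrow> complex"
  assumes inj: "inj_on \<tau> D" and w: "\<And>\<gamma>. \<gamma> \<in> D \<Longrightarrow> cmod (w \<gamma>) \<le> M" and M: "0 \<le> M"
  shows coord_wcomp: "coord (wcomp D \<tau> w \<xi>) \<gamma> = (if \<gamma> \<in> D then w \<gamma> * coord \<xi> (\<tau> \<gamma>) else 0)"
    and norm_wcomp_le: "norm (wcomp D \<tau> w) \<le> M"
proof -
  let ?f = "\<lambda>\<xi> :: 'g ell2. \<lambda>\<gamma>. if \<gamma> \<in> D then w \<gamma> * coord \<xi> (\<tau> \<gamma>) else 0"
  have s0: "(\<lambda>\<gamma>. (cmod (coord \<xi> \<gamma>))\<^sup>2) summable_on (\<tau> ` D)" for \<xi> :: "'g ell2"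
    by (rule summable_on_subset_banach[OF summable_coord_sq]) simp
  have s1: "(\<lambda>\<gamma>. (cmod (coord \<xi> (\<tau> \<gamma>)))\<^sup>2) summable_on D" for \<xi> :: "'g ell2"
    using s0[of \<xi>] by (simp add: summable_on_reindex[OF inj] o_def)
  have le: "(cmod (?f \<xi> \<gamma>))\<^sup>2 \<le> M\<^sup>2 * (cmod (coord \<xi> (\<tau> \<gamma>)))\<^sup>2" if "\<gamma> \<in> D" for \<xi> \<gamma>
    using that w[OF that] by (simp add: norm_mult power_mult_distrib mult_right_mono power_mono)
  have s2: "(\<lambda>\<gamma>. (cmod (?f \<xi> \<gamma>))\<^sup>2) summable_on D" for \<xi>
    by (rule summable_on_comparison_test[OF summable_on_cmult_right[OF s1[of \<xi>], of "M\<^sup>2"]])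
      (use le in auto)
  have s3: "(\<lambda>\<gamma>. (cmod (?f \<xi> \<gamma>))\<^sup>2) summable_on UNIV" for \<xi>
    using s2[of \<xi>] by (rule summable_on_cong_neutral[THEN iffD1, rotated 3]) auto
  have f: "coord (Abs_ell2 (?f \<xi>)) = ?f \<xi>" for \<xi>
    by (rule Abs_ell2_inverse) (use s3[of \<xi>] in simp)
  have n: "norm (Abs_ell2 (?f \<xi>)) \<le> norm \<xi> * M" for \<xi>
  proof (rule power2_le_imp_le)
    have "(norm (Abs_ell2 (?f \<xi>)))\<^sup>2 = (\<Sum>\<^sub>\<infinity>\<gamma>\<in>D. (cmod (?f \<xi> \<gamma>))\<^sup>2)"
      unfolding norm_ell2_power2 f by (rule infsum_cong_neutral) auto
    also have "\<dots> \<le> (\<Sum>\<^sub>\<infinity>\<gamma>\<in>D. M\<^sup>2 * (cmod (coord \<xi> (\<tau> \<gamma>)))\<^sup>2)"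
      by (intro infsum_mono s2 summable_on_cmult_right s1 le)
    also have "\<dots> = M\<^sup>2 * (\<Sum>\<^sub>\<infinity>\<gamma>\<in>\<tau> ` D. (cmod (coord \<xi> \<gamma>))\<^sup>2)"
      by (simp add: infsum_cmult_right' infsum_reindex[OF inj] o_def)
    also have "\<dots> \<le> M\<^sup>2 * (norm \<xi>)\<^sup>2"
      unfolding norm_ell2_power2 by (intro mult_left_mono infsum_mono2 summable_coord_sq s0) auto
    finally show "(norm (Abs_ell2 (?f \<xi>)))\<^sup>2 \<le> (norm \<xi> * M)\<^sup>2"
      by (simp add: power_mult_distrib mult.commute)
  qed (use M in simp)
  have "bounded_linear (\<lambda>\<xi>. Abs_ell2 (?f \<xi>))"
    by (rule bounded_linear_intro[OF _ _ n]; rule ell2_eqI)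
      (auto simp: f algebra_simps scaleR_conv_of_real)
  then have ap: "wcomp D \<tau> w \<xi> = Abs_ell2 (?f \<xi>)" for \<xi>
    by (simp add: wcomp_def bounded_linear_Blinfun_apply)
  show "coord (wcomp D \<tau> w \<xi>) \<gamma> = ?f \<xi> \<gamma>" by (simp add: ap f)
  show "norm (wcomp D \<tau> w) \<le> M"
    by (rule norm_blinfun_bound[OF M]) (use n ap in \<open>simp add: mult.commute\<close>)
qed

text \<open>A change of variables: \<sigma> inverts \<tau>, and \<open>v\<close> is the conjugated
  weight carried along \<tau>.\<close>

lemma is_adjoint_wcomp:
  fixes w :: "'g \<Rightarrow> complex"
  assumes inj: "inj_on \<tau> D" and w: "\<And>\<gamma>. \<gamma> \<in> D \<Longrightarrow> cmod (w \<gamma>) \<le> M" and M: "0 \<le> M"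
    and E: "\<tau> ` D = E" and \<sigma>: "\<And>\<gamma>. \<gamma> \<in> D \<Longrightarrow> \<sigma> (\<tau> \<gamma>) = \<gamma>"
    and v: "\<And>\<gamma>. \<gamma> \<in> D \<Longrightarrow> v (\<tau> \<gamma>) = cnj (w \<gamma>)"
  shows "is_adjoint (wcomp D \<tau> w) (wcomp E \<sigma> v)"
  unfolding is_adjoint_def
proof (intro allI)
  fix \<xi> \<eta> :: "'g ell2"
  have injE: "inj_on \<sigma> E" using E \<sigma> by (auto simp: inj_on_def)
  have vE: "cmod (v \<gamma>) \<le> M" if "\<gamma> \<in> E" for \<gamma> using that E v w by auto
  have "cinner (wcomp D \<tau> w \<xi>) \<eta> = (\<Sum>\<^sub>\<infinity>\<gamma>\<in>D. w \<gamma> * coord \<xi> (\<tau> \<gamma>) * cnj (coord \<eta> \<gamma>))"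
    unfolding cinner_def by (rule infsum_cong_neutral) (simp_all add: coord_wcomp[OF inj w M])
  also have "\<dots> = (\<Sum>\<^sub>\<infinity>\<gamma>\<in>E. coord \<xi> \<gamma> * cnj (v \<gamma> * coord \<eta> (\<sigma> \<gamma>)))"
    unfolding E[symmetric] infsum_reindex[OF inj] by (rule infsum_cong) (simp add: \<sigma> v mult_ac)
  also have "\<dots> = cinner \<xi> (wcomp E \<sigma> v \<eta>)"
    unfolding cinner_def by (rule infsum_cong_neutral) (simp_all add: coord_wcomp[OF injE vE M])
  finally show "cinner (wcomp D \<tau> w \<xi>) \<eta> = cinner \<xi> (wcomp E \<sigma> v \<eta>)" .
qed

section \<open>Etale groupoids\<close>

lemma composable_iff:
  "(\<alpha>, \<beta>) \<in> composable G \<longleftrightarrow> \<alpha> \<in> arrows G \<and> \<beta> \<in> arrows G \<and> dom G \<alpha> = rng G \<beta>"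
  by (simp add: composable_def)

section \<open>Algebra of arrows and bisections\<close>

context groupoid
begin

lemma dom_unit: "\<alpha> \<in> arrows G \<Longrightarrow> dom G \<alpha> \<in> units G"
  by (simp add: units_def)

lemma unit_arrow: "x \<in> units G \<Longrightarrow> x \<in> arrows G"
  using dom_arrow by (auto simp: units_def)

lemma units_subset: "units G \<subseteq> arrows G"
  using unit_arrow by blast

lemma rng_arrow: "\<alpha> \<in> arrows G \<Longrightarrow> rng G \<alpha> \<in> arrows G"
  by (simp add: rng_unit unit_arrow)

lemma mul_arrow': "\<lbrakk>\<alpha> \<in> arrows G; \<beta> \<in> arrows G; dom G \<alpha> = rng G \<beta>\<rbrakk> \<Longrightarrow> mul G \<alpha> \<beta> \<in> arrows G"
  and dom_mul': "\<lbrakk>\<alpha> \<in> arrows G; \<beta> \<in> arrows G; dom G \<alpha> = rng G \<beta>\<rbrakk> \<Longrightarrow> dom G (mul G \<alpha> \<beta>) = dom G \<beta>"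
  and rng_mul': "\<lbrakk>\<alpha> \<in> arrows G; \<beta> \<in> arrows G; dom G \<alpha> = rng G \<beta>\<rbrakk> \<Longrightarrow> rng G (mul G \<alpha> \<beta>) = rng G \<alpha>"
  and mul_assoc': "\<lbrakk>\<alpha> \<in> arrows G; \<beta> \<in> arrows G; dom G \<alpha> = rng G \<beta>; \<gamma> \<in> arrows G; dom G \<beta> = rng G \<gamma>\<rbrakk>
    \<Longrightarrow> mul G (mul G \<alpha> \<beta>) \<gamma> = mul G \<alpha> (mul G \<beta> \<gamma>)"
  by (simp_all add: composable_iff mul_arrow dom_mul rng_mul mul_assoc)

lemmas arrow_simps = mul_arrow' dom_mul' rng_mul' ginv_arrow dom_ginv rng_ginv dom_arrow rng_arrow
  ginv_mul mul_ginv mul_dom rng_mul_self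

lemma rng_rng: "\<alpha> \<in> arrows G \<Longrightarrow> rng G (rng G \<alpha>) = rng G \<alpha>"
  by (simp add: rng_of_unit rng_unit)

lemma ginv_mul_cancel: "\<lbrakk>\<alpha> \<in> arrows G; \<gamma> \<in> arrows G; dom G \<alpha> = rng G \<gamma>\<rbrakk> \<Longrightarrow> mul G (ginv G \<alpha>) (mul G \<alpha> \<gamma>) = \<gamma>"
  by (simp add: mul_assoc'[symmetric] arrow_simps)

lemma mul_ginv_cancel: "\<lbrakk>\<alpha> \<in> arrows G; \<gamma> \<in> arrows G; rng G \<alpha> = rng G \<gamma>\<rbrakk> \<Longrightarrow> mul G \<alpha> (mul G (ginv G \<alpha>) \<gamma>) = \<gamma>"
  by (simp add: mul_assoc'[symmetric] arrow_simps)

lemma mul_cancel_ginv: "\<lbrakk>\<alpha> \<in> arrows G; \<beta> \<in> arrows G; dom G \<alpha> = rng G \<beta>\<rbrakk> \<Longrightarrow> mul G (mul G \<alpha> \<beta>) (ginv G \<beta>) = \<alpha>"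
  by (metis arrow_simps(4,6,10,11) mul_assoc')

lemma mul_cancel_right: "\<lbrakk>\<alpha> \<in> arrows G; \<beta> \<in> arrows G; dom G \<alpha> = dom G \<beta>\<rbrakk> \<Longrightarrow> mul G (mul G \<alpha> (ginv G \<beta>)) \<beta> = \<alpha>"
  by (simp add: mul_assoc' arrow_simps) (metis mul_dom)

lemma ginv_ginv: "\<alpha> \<in> arrows G \<Longrightarrow> ginv G (ginv G \<alpha>) = \<alpha>"
  using ginv_mul_cancel[of "ginv G \<alpha>" \<alpha>] mul_dom[of "ginv G (ginv G \<alpha>)"]
  by (simp add: arrow_simps)

lemma ginv_unit: "x \<in> units G \<Longrightarrow> ginv G x = x"
  by (metis dom_ginv dom_of_unit ginv_arrow ginv_mul mul_dom rng_of_unit unit_arrow)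

lemma ginv_of_mul:
  assumes "\<alpha> \<in> arrows G" "\<beta> \<in> arrows G" "dom G \<alpha> = rng G \<beta>"
  shows "ginv G (mul G \<alpha> \<beta>) = mul G (ginv G \<beta>) (ginv G \<alpha>)"
proof -
  \<comment> \<open>The product of \<open>mul G \<alpha> \<beta>\<close> with its inverse is a unit;
    it is inserted on the right so that \<alpha> and \<beta> cancel.\<close>
  have "mul G (ginv G \<beta>) (ginv G \<alpha>) = mul G (ginv G \<beta>) (mul G (ginv G \<alpha>) (mul G (mul G \<alpha> \<beta>) (ginv G (mul G \<alpha> \<beta>))))"
    using assms mul_dom[of "ginv G \<alpha>"] by (simp add: mul_ginv arrow_simps)
  also have "\<dots> = ginv G (mul G \<alpha> \<beta>)"
    using assms by (simp add: mul_assoc' ginv_mul_cancel arrow_simps del: mul_ginv)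
  finally show ?thesis by simp
qed

lemma bisection_ginv: "bisection G U \<Longrightarrow> bisection G (ginv G ` U)"
  unfolding bisection_def by (auto simp: inj_on_def arrow_simps subset_iff)

lemma rng_image_ginv: "U \<subseteq> arrows G \<Longrightarrow> rng G ` ginv G ` U = dom G ` U"
  by (auto simp: image_iff arrow_simps subset_iff)

lemma ginv_image_ginv: "U \<subseteq> arrows G \<Longrightarrow> ginv G ` ginv G ` U = U"
  by (force simp: image_iff ginv_ginv subset_iff)

lemma set_mul_subset: "U \<subseteq> arrows G \<Longrightarrow> V \<subseteq> arrows G \<Longrightarrow> set_mul G U V \<subseteq> arrows G"
  by (auto simp: set_mul_def arrow_simps subset_iff)

text \<open>The domain of a product determines its right factor, whose range is the domain of the
  left factor and so determines that one too. For ranges the argument is the mirror image.\<close>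

lemma bisection_set_mul:
  assumes U: "bisection G U" and V: "bisection G V"
  shows "bisection G (set_mul G U V)"
proof -
  note sub = U[unfolded bisection_def, THEN conjunct1] V[unfolded bisection_def, THEN conjunct1]
  have "inj_on (dom G) (set_mul G U V)"
  proof (rule inj_onI)
    fix \<gamma> \<gamma>' assume "\<gamma> \<in> set_mul G U V" "\<gamma>' \<in> set_mul G U V" and eq: "dom G \<gamma> = dom G \<gamma>'"
    then obtain \<alpha> \<beta> \<alpha>' \<beta>' where *: "\<alpha> \<in> U" "\<beta> \<in> V" "dom G \<alpha> = rng G \<beta>" "\<gamma> = mul G \<alpha> \<beta>"
      "\<alpha>' \<in> U" "\<beta>' \<in> V" "dom G \<alpha>' = rng G \<beta>'" "\<gamma>' = mul G \<alpha>' \<beta>'"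
      unfolding set_mul_def by blast
    then have "dom G \<beta> = dom G \<beta>'" using eq sub by (metis dom_mul' subsetD)
    then have "\<beta> = \<beta>'" using V * by (auto simp: bisection_def inj_on_def)
    then show "\<gamma> = \<gamma>'" using U * by (auto simp: bisection_def inj_on_def)
  qed
  moreover have "inj_on (rng G) (set_mul G U V)"
  proof (rule inj_onI)
    fix \<gamma> \<gamma>' assume "\<gamma> \<in> set_mul G U V" "\<gamma>' \<in> set_mul G U V" and eq: "rng G \<gamma> = rng G \<gamma>'"
    then obtain \<alpha> \<beta> \<alpha>' \<beta>' where *: "\<alpha> \<in> U" "\<beta> \<in> V" "dom G \<alpha> = rng G \<beta>" "\<gamma> = mul G \<alpha> \<beta>"
      "\<alpha>' \<in> U" "\<beta>' \<in> V" "dom G \<alpha>' = rng G \<beta>'" "\<gamma>' = mul G \<alpha>' \<beta>'"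
      unfolding set_mul_def by blast
    then have "rng G \<alpha> = rng G \<alpha>'" using eq sub by (metis rng_mul' subsetD)
    then have "\<alpha> = \<alpha>'" using U * by (auto simp: bisection_def inj_on_def)
    then show "\<gamma> = \<gamma>'" using V * by (auto simp: bisection_def inj_on_def)
  qed
  ultimately show ?thesis using set_mul_subset sub by (simp add: bisection_def)
qed

lemma bisection_units: "K \<subseteq> units G \<Longrightarrow> bisection G K"
  using units_subset by (auto simp: bisection_def inj_on_def dom_of_unit rng_of_unit subset_iff)

end

section \<open>Open sets and continuity of the structure maps\<close>

context etale_groupoid
begin

lemma openin_arrows: "openin (gtop G) U \<Longrightarrow> U \<subseteq> arrows G"
  by (simp add: arrows_def openin_subset)

lemma dom_local:
  assumes "\<alpha> \<in> arrows G"
  obtains U where "openin (gtop G) U" "\<alpha> \<in> U" "openin (unit_top G) (dom G ` U)"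
    "homeomorphic_map (subtopology (gtop G) U) (subtopology (unit_top G) (dom G ` U)) (dom G)"
  using assms dom_local_homeomorphism unfolding local_homeomorphism_def arrows_def by meson

lemma continuous_dom_unit_top: "continuous_map (gtop G) (unit_top G) (dom G)"
  unfolding continuous_map_def
proof (intro conjI allI impI)
  show "dom G \<in> topspace (gtop G) \<rightarrow> topspace (unit_top G)"
    using dom_unit dom_arrow by (auto simp: unit_top_def arrows_def)
  fix V assume V: "openin (unit_top G) V"
  show "openin (gtop G) {\<alpha> \<in> topspace (gtop G). dom G \<alpha> \<in> V}"
  proof (subst openin_subopen, clarify)
    fix \<alpha> assume \<alpha>: "\<alpha> \<in> topspace (gtop G)" "dom G \<alpha> \<in> V"
    then obtain U where U: "openin (gtop G) U" "\<alpha> \<in> U"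
      "homeomorphic_map (subtopology (gtop G) U) (subtopology (unit_top G) (dom G ` U)) (dom G)"
      using dom_local[of \<alpha>] by (auto simp: arrows_def)
    then have "continuous_map (subtopology (gtop G) U) (unit_top G) (dom G)"
      using homeomorphic_imp_continuous_map continuous_map_into_fulltopology by blast
    then have "openin (subtopology (gtop G) U) {\<beta> \<in> topspace (subtopology (gtop G) U). dom G \<beta> \<in> V}"
      using V by (rule openin_continuous_map_preimage)
    then have "openin (gtop G) {\<beta> \<in> topspace (subtopology (gtop G) U). dom G \<beta> \<in> V}"
      using U(1) openin_trans_full by blast
    then show "\<exists>T. openin (gtop G) T \<and> \<alpha> \<in> T \<and> T \<subseteq> {\<alpha> \<in> topspace (gtop G). dom G \<alpha> \<in> V}"
      using U \<alpha> by (intro exI[of _ "{\<beta> \<in> topspace (subtopology (gtop G) U). dom G \<beta> \<in> V}"]) auto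
  qed
qed

text \<open>Near a unit take an open set on which \<open>dom G\<close> is injective. If both
  \<alpha> and its domain lie in it, they have the same domain and hence are equal, so \<alpha> is a
  unit.\<close>

lemma units_open: "openin (gtop G) (units G)"
proof (subst openin_subopen, clarify)
  fix x assume x: "x \<in> units G"
  then obtain U where U: "openin (gtop G) U" "x \<in> U"
      "homeomorphic_map (subtopology (gtop G) U) (subtopology (unit_top G) (dom G ` U)) (dom G)"
    using dom_local[OF unit_arrow[OF x]] by blast
  have inj: "inj_on (dom G) U"
    using homeomorphic_imp_injective_map[OF U(3)] openin_subset[OF U(1)]
    by (simp add: inf_absorb2)
  let ?V = "U \<inter> {\<alpha> \<in> topspace (gtop G). dom G \<alpha> \<in> U \<inter> units G}"
  have "openin (gtop G) ?V"
    using openin_continuous_map_preimage[OF continuous_dom_unit_top, of "U \<inter> units G"] U(1)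
    by (intro openin_Int) (auto simp: unit_top_def openin_subtopology_Int)
  moreover have "\<alpha> \<in> units G" if "\<alpha> \<in> ?V" for \<alpha>
  proof -
    have "dom G \<alpha> = \<alpha>"
      by (rule inj_onD[OF inj]) (use that in \<open>auto simp: dom_of_unit\<close>)
    then show ?thesis using that by auto
  qed
  moreover have "x \<in> ?V"
    using x U(2) openin_subset[OF U(1)] by (simp add: dom_of_unit subset_iff)
  ultimately show "\<exists>T. openin (gtop G) T \<and> x \<in> T \<and> T \<subseteq> units G"
    by (intro exI[of _ ?V] conjI subsetI)
qed

lemma openin_unit_top: "openin (unit_top G) K \<longleftrightarrow> openin (gtop G) K \<and> K \<subseteq> units G"
  by (simp add: unit_top_def openin_open_subtopology units_open)

lemma topspace_unit_top: "topspace (unit_top G) = units G"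
  using units_subset by (auto simp: unit_top_def arrows_def)

lemma compactin_unit_top: "compactin (unit_top G) K \<longleftrightarrow> compactin (gtop G) K \<and> K \<subseteq> units G"
  by (simp add: unit_top_def compactin_subtopology conj_commute)

lemma continuous_dom: "continuous_map (gtop G) (gtop G) (dom G)"
  using continuous_dom_unit_top by (simp add: unit_top_def continuous_map_in_subtopology)

lemma dom_open:
  assumes W: "openin (gtop G) W"
  shows "openin (gtop G) (dom G ` W)"
proof (subst openin_subopen, clarify)
  fix \<alpha> assume \<alpha>: "\<alpha> \<in> W"
  then obtain U where U: "openin (gtop G) U" "\<alpha> \<in> U" "openin (unit_top G) (dom G ` U)"
      "homeomorphic_map (subtopology (gtop G) U) (subtopology (unit_top G) (dom G ` U)) (dom G)"
    using dom_local[of \<alpha>] openin_arrows[OF W] by blast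
  have "openin (subtopology (unit_top G) (dom G ` U)) (dom G ` (W \<inter> U))"
    using homeomorphic_imp_open_map[OF U(4)] openin_subtopology_Int[OF W] 
    unfolding open_map_def by blast
  then have "openin (gtop G) (dom G ` (W \<inter> U))"
    using U(3) openin_trans_full openin_unit_top by blast
  then show "\<exists>T. openin (gtop G) T \<and> dom G \<alpha> \<in> T \<and> T \<subseteq> dom G ` W"
    using \<alpha> U(2) by blast
qed

lemma rng_eq: "\<alpha> \<in> arrows G \<Longrightarrow> rng G \<alpha> = dom G (ginv G \<alpha>)"
  by (simp add: arrow_simps)

lemma continuous_rng: "continuous_map (gtop G) (gtop G) (rng G)"
  using continuous_map_compose[OF continuous_ginv continuous_dom]
  by (rule continuous_map_eq) (simp add: rng_eq arrows_def)

lemma ginv_open: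
  assumes W: "openin (gtop G) W"
  shows "openin (gtop G) (ginv G ` W)"
proof -
  have "ginv G ` W = {\<alpha> \<in> topspace (gtop G). ginv G \<alpha> \<in> W}"
    using openin_arrows[OF W] by (force simp: ginv_ginv ginv_arrow arrows_def[symmetric] image_iff)
  then show ?thesis using openin_continuous_map_preimage[OF continuous_ginv W] by simp
qed

text \<open>As \<open>dom G\<close> is injective on \<open>V\<close>, it has a section s over its
  image. An arrow \<gamma> lies in the product iff its domain is in the image of \<open>V\<close>
  and \<gamma> times the inverse of s at that domain is in \<open>U\<close>. So the product is the
  preimage of \<open>U\<close> under a continuous map with open domain.\<close>

lemma set_mul_open:
  assumes U: "openin (gtop G) U" and V: "openin (gtop G) V" and inj: "inj_on (dom G) V"
  shows "openin (gtop G) (set_mul G U V)"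
proof -
  note sub = openin_arrows[OF U] openin_arrows[OF V]
  let ?s = "inv_into V (dom G)"
  let ?W = "{\<gamma> \<in> topspace (gtop G). dom G \<gamma> \<in> dom G ` V}"
  have s: "?s x \<in> V" "dom G (?s x) = x" if "x \<in> dom G ` V" for x
    using that by (simp_all add: inv_into_into f_inv_into_f)
  have sV: "?s (dom G \<beta>) = \<beta>" if "\<beta> \<in> V" for \<beta> using that inj by simp
  have conts: "continuous_map (subtopology (gtop G) (dom G ` V)) (gtop G) ?s"
    unfolding continuous_map_def
  proof (intro conjI allI impI)
    show "?s \<in> topspace (subtopology (gtop G) (dom G ` V)) \<rightarrow> topspace (gtop G)"
      using s openin_subset[OF V] by auto
    fix T assume T: "openin (gtop G) T"
    \<comment> \<open>The section is continuous because \<open>dom G\<close> is open: the preimage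
      of \<open>T\<close> is the image of an open set.\<close>
    have "{x \<in> topspace (subtopology (gtop G) (dom G ` V)). ?s x \<in> T} = dom G ` (V \<inter> T)"
      using s sV openin_subset[OF dom_open[OF V]] by (force simp: image_iff)
    then show "openin (subtopology (gtop G) (dom G ` V))
        {x \<in> topspace (subtopology (gtop G) (dom G ` V)). ?s x \<in> T}"
      using dom_open[OF openin_Int[OF V T]] openin_open_subtopology[OF dom_open[OF V]] by auto
  qed
  have W: "openin (gtop G) ?W"
    by (rule openin_continuous_map_preimage[OF continuous_dom dom_open[OF V]])
  have "continuous_map (subtopology (gtop G) ?W) (subtopology (gtop G) (dom G ` V)) (dom G)"
    by (intro continuous_map_into_subtopology continuous_map_from_subtopology continuous_dom) auto
  then have c1: "continuous_map (subtopology (gtop G) ?W) (gtop G) (\<lambda>\<gamma>. ginv G (?s (dom G \<gamma>)))"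
    using continuous_map_compose[OF continuous_map_compose[OF _ conts] continuous_ginv]
    by (simp add: o_def)
  have "continuous_map (subtopology (gtop G) ?W) (subtopology (prod_topology (gtop G) (gtop G)) (composable G))
      (\<lambda>\<gamma>. (\<gamma>, ginv G (?s (dom G \<gamma>))))"
  proof (rule continuous_map_into_subtopology)
    show "continuous_map (subtopology (gtop G) ?W) (prod_topology (gtop G) (gtop G))
      (\<lambda>\<gamma>. (\<gamma>, ginv G (?s (dom G \<gamma>))))"
      using c1 by (intro continuous_map_pairedI) (auto intro: continuous_map_from_subtopology)
    show "(\<lambda>\<gamma>. (\<gamma>, ginv G (?s (dom G \<gamma>)))) \<in> topspace (subtopology (gtop G) ?W) \<rightarrow> composable G"
      using s sub by (auto simp: composable_iff arrows_def[symmetric] arrow_simps subset_iff sV)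
  qed
  then have c2: "continuous_map (subtopology (gtop G) ?W) (gtop G) (\<lambda>\<gamma>. mul G \<gamma> (ginv G (?s (dom G \<gamma>))))"
    using continuous_map_compose[OF _ continuous_mul] by (fastforce simp: o_def)
  have "set_mul G U V = {\<gamma> \<in> topspace (subtopology (gtop G) ?W). mul G \<gamma> (ginv G (?s (dom G \<gamma>))) \<in> U}"
  proof (intro subset_antisym subsetI)
    fix \<gamma> assume "\<gamma> \<in> set_mul G U V"
    then obtain \<alpha> \<beta> where *: "\<gamma> = mul G \<alpha> \<beta>" "\<alpha> \<in> U" "\<beta> \<in> V" "dom G \<alpha> = rng G \<beta>"
      by (auto simp: set_mul_def)
    then have "\<alpha> \<in> arrows G" "\<beta> \<in> arrows G" using sub by auto
    then show "\<gamma> \<in> {\<gamma> \<in> topspace (subtopology (gtop G) ?W). mul G \<gamma> (ginv G (?s (dom G \<gamma>))) \<in> U}"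
      using * by (auto simp: dom_mul' sV mul_cancel_ginv mul_arrow' arrows_def[symmetric])
  next
    fix \<gamma> assume "\<gamma> \<in> {\<gamma> \<in> topspace (subtopology (gtop G) ?W). mul G \<gamma> (ginv G (?s (dom G \<gamma>))) \<in> U}"
    then obtain \<beta> where *: "\<gamma> \<in> arrows G" "\<beta> \<in> V" "dom G \<gamma> = dom G \<beta>" "mul G \<gamma> (ginv G \<beta>) \<in> U"
      by (auto simp: sV arrows_def)
    moreover have "\<beta> \<in> arrows G" using sub * by auto
    ultimately show "\<gamma> \<in> set_mul G U V"
      unfolding set_mul_def using mul_cancel_right[of \<gamma> \<beta>]
      by (intro CollectI exI[of _ "mul G \<gamma> (ginv G \<beta>)"] exI[of _ \<beta>]) (simp add: arrow_simps)
  qed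
  then show ?thesis
    using openin_continuous_map_preimage[OF c2 U] openin_trans_full[OF _ W] by simp
qed

end

section \<open>The inverse semigroup of compact open bisections\<close>

context ample_groupoid
begin

lemma compact_open_bisections_ginv:
  assumes "U \<in> compact_open_bisections G"
  shows "ginv G ` U \<in> compact_open_bisections G"
  using assms bisection_ginv ginv_open image_compactin[OF _ continuous_ginv]
  by (simp add: compact_open_bisections_def)

text \<open>For compactness: the Hausdorff property makes the composable pairs in
  \<open>U \<times> V\<close> a closed subset of a compact set, and the product is their continuous
  image.\<close>

lemma compact_open_bisections_mul:
  assumes "U \<in> compact_open_bisections G" "V \<in> compact_open_bisections G"
  shows "set_mul G U V \<in> compact_open_bisections G"
proof -
  let ?P = "prod_topology (gtop G) (gtop G)"
  have "closedin ?P {p \<in> topspace ?P. dom G (fst p) = rng G (snd p)}"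
    using continuous_map_compose[OF continuous_map_fst continuous_dom]
      continuous_map_compose[OF continuous_map_snd continuous_rng]
    by (intro closedin_continuous_maps_eq[OF Hausdorff]) (simp_all add: o_def)
  moreover have "compactin ?P (U \<times> V)"
    using assms by (auto simp: compact_open_bisections_def compactin_Times)
  ultimately have "compactin ?P ({p \<in> topspace ?P. dom G (fst p) = rng G (snd p)} \<inter> (U \<times> V))"
    by (rule closed_Int_compactin)
  moreover have "{p \<in> topspace ?P. dom G (fst p) = rng G (snd p)} \<inter> (U \<times> V) \<subseteq> composable G"
    by (auto simp: composable_iff arrows_def)
  ultimately have "compactin (gtop G) ((\<lambda>(\<alpha>, \<beta>). mul G \<alpha> \<beta>) `
      ({p \<in> topspace ?P. dom G (fst p) = rng G (snd p)} \<inter> (U \<times> V)))"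
    by (intro image_compactin[OF _ continuous_mul]) (simp add: compactin_subtopology)
  moreover have "(\<lambda>(\<alpha>, \<beta>). mul G \<alpha> \<beta>) ` ({p \<in> topspace ?P. dom G (fst p) = rng G (snd p)} \<inter> (U \<times> V))
      = set_mul G U V"
  proof -
    have "U \<subseteq> topspace (gtop G)" "V \<subseteq> topspace (gtop G)"
      using assms by (auto simp: compact_open_bisections_def bisection_def arrows_def)
    then have "{p \<in> topspace ?P. dom G (fst p) = rng G (snd p)} \<inter> (U \<times> V)
        = {p \<in> U \<times> V. dom G (fst p) = rng G (snd p)}" by auto
    then show ?thesis by (force simp: set_mul_def image_iff)
  qed
  ultimately show ?thesis
    using assms bisection_set_mul set_mul_open
    by (auto simp: compact_open_bisections_def bisection_def)
qed

lemma compact_open_bisections_subset: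
  assumes "U \<in> compact_open_bisections G" "V \<subseteq> U" "compactin (gtop G) V" "openin (gtop G) V"
  shows "V \<in> compact_open_bisections G"
  using assms inj_on_subset[OF _ assms(2)] by (auto simp: compact_open_bisections_def bisection_def)

lemma compact_open_bisections_Int:
  assumes "U \<in> compact_open_bisections G" "V \<in> compact_open_bisections G"
  shows "U \<inter> V \<in> compact_open_bisections G"
  by (rule compact_open_bisections_subset[OF assms(1)])
    (use assms in \<open>auto simp: compact_open_bisections_def
      intro: closed_Int_compactin compactin_imp_closedin[OF Hausdorff]\<close>)

lemma compact_open_bisections_Diff:
  assumes "U \<in> compact_open_bisections G" "V \<in> compact_open_bisections G"
  shows "U - V \<in> compact_open_bisections G"
proof (rule compact_open_bisections_subset[OF assms(1)])
  have V: "closedin (gtop G) V" "openin (gtop G) V"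
    using assms(2) by (auto simp: compact_open_bisections_def compactin_imp_closedin[OF Hausdorff])
  then show "openin (gtop G) (U - V)"
    using assms(1) by (auto simp: compact_open_bisections_def)
  have "U - V = (topspace (gtop G) - V) \<inter> U"
    using assms(1) by (auto simp: compact_open_bisections_def bisection_def arrows_def)
  then show "compactin (gtop G) (U - V)"
    using assms(1) closed_Int_compactin[OF closedin_diff[OF closedin_topspace V(2)], of U]
    by (simp add: compact_open_bisections_def)
qed auto

end

text \<open>Every element has a finite derivation, so it appears after finitely many rounds of
  \<open>step\<close>, each of which keeps the family countable.\<close>

lemma countable_generated_inverse_semigroup:
  assumes "countable F"
  shows "countable (generated_inverse_semigroup G F)"
proof -
  define step where "step = (\<lambda>S. S \<union> (\<lambda>(U, V). set_mul G U V) ` (S \<times> S) \<union> (\<lambda>U. ginv G ` U) ` S)"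
  have c: "countable ((step ^^ n) F)" for n
    by (induction n) (auto simp: assms step_def)
  have mono: "(step ^^ m) F \<subseteq> (step ^^ n) F" if "m \<le> n" for m n
    by (rule lift_Suc_mono_le[OF _ that]) (auto simp: step_def)
  have "U \<in> (\<Union>n. (step ^^ n) F)" if "U \<in> generated_inverse_semigroup G F" for U
    using that
  proof induction
    case (generator U)
    then show ?case by (auto intro!: exI[of _ 0])
  next
    case (product U V)
    then obtain m n where "U \<in> (step ^^ m) F" "V \<in> (step ^^ n) F" by auto
    then have "U \<in> (step ^^ max m n) F" "V \<in> (step ^^ max m n) F"
      using mono[of m "max m n"] mono[of n "max m n"] by auto
    then have "set_mul G U V \<in> (step ^^ Suc (max m n)) F" by (auto simp: step_def)
    then show ?case by blast
  next
    case (inverse U)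
    then obtain n where "U \<in> (step ^^ n) F" by auto
    then have "ginv G ` U \<in> (step ^^ Suc n) F" by (auto simp: step_def)
    then show ?case by blast
  qed
  then show ?thesis using c by (meson countable_UN countable_subset subsetI countableI_type)
qed

section \<open>Consequences of a finite generating set\<close>

locale generated_groupoid = ample_groupoid +
  fixes F
  assumes finite_generators: "finite F"
    and generators: "F \<subseteq> compact_open_bisections G"
    and generated_basis: "open_basis (gtop G) (generated_inverse_semigroup G F)"
begin

abbreviation "S \<equiv> generated_inverse_semigroup G F"

lemma generated_bisections: "U \<in> S \<Longrightarrow> U \<in> compact_open_bisections G"
proof (induction rule: generated_inverse_semigroup.induct)
  case (generator U)
  then show ?case using generators by blast
qed (simp_all add: compact_open_bisections_mul compact_open_bisections_ginv)

lemma basis_at: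
  assumes "openin (gtop G) V" "\<alpha> \<in> V"
  obtains U where "U \<in> S" "\<alpha> \<in> U" "U \<subseteq> V"
  using assms generated_basis unfolding open_basis_def by blast

text \<open>The covering sets remember a prescribed neighbourhood. Later \<open>W\<close> is a set
  on which a function varies little, or the unit space.\<close>

lemma compact_cover:
  assumes "compactin (gtop G) K" "\<And>\<alpha>. \<alpha> \<in> K \<Longrightarrow> \<alpha> \<in> W \<alpha> \<and> openin (gtop G) (W \<alpha>)"
  obtains T where "finite T" "T \<subseteq> S" "K \<subseteq> \<Union>T" "\<forall>U\<in>T. \<exists>\<alpha>\<in>K. U \<subseteq> W \<alpha>"
proof -
  have "\<exists>U\<in>S. \<alpha> \<in> U \<and> U \<subseteq> W \<alpha>" if "\<alpha> \<in> K" for \<alpha>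
    using assms(2)[OF that] by (meson basis_at)
  then obtain u where u: "\<And>\<alpha>. \<alpha> \<in> K \<Longrightarrow> u \<alpha> \<in> S \<and> \<alpha> \<in> u \<alpha> \<and> u \<alpha> \<subseteq> W \<alpha>" by metis
  have "openin (gtop G) U" if "U \<in> u ` K" for U
    using that u generated_bisections by (auto simp: compact_open_bisections_def)
  then obtain T where T: "finite T" "T \<subseteq> u ` K" "K \<subseteq> \<Union>T"
    using compactinD[OF assms(1), of "u ` K"] u by blast
  moreover have "\<exists>\<alpha>\<in>K. U \<subseteq> W \<alpha>" if U: "U \<in> T" for U
  proof -
    obtain \<alpha> where "\<alpha> \<in> K" "U = u \<alpha>" using T(2) U by blast
    then show ?thesis using u by auto
  qed
  moreover have "T \<subseteq> S" using T(2) u by auto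
  ultimately show thesis using that[of T] by auto
qed

lemma compact_open_eq_Union:
  assumes "compactin (gtop G) K" "openin (gtop G) K"
  obtains T where "finite T" "T \<subseteq> S" "K = \<Union>T"
proof -
  obtain T where "finite T" "T \<subseteq> S" "K \<subseteq> \<Union>T" "\<forall>U\<in>T. \<exists>\<alpha>\<in>K. U \<subseteq> K"
    by (rule compact_cover[OF assms(1), of "\<lambda>_. K"]) (use assms(2) in auto)
  then show thesis using that[of T] by (metis Sup_least subset_antisym)
qed

text \<open>By compactness each one is a finite union of members of the countable basis. This is the
  source of separability.\<close>

lemma countable_bisections: "countable (compact_open_bisections G)"
proof -
  have "countable {T. finite T \<and> T \<subseteq> S}"
    using countable_generated_inverse_semigroup[OF countable_finite[OF finite_generators]]
    by (rule countable_Collect_finite_subset)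
  moreover have "compact_open_bisections G \<subseteq> Union ` {T. finite T \<and> T \<subseteq> S}"
    by (force simp: compact_open_bisections_def elim: compact_open_eq_Union)
  ultimately show ?thesis by (meson countable_image countable_subset)
qed

end

section \<open>Operators of bisections\<close>

definition delta :: "'g \<Rightarrow> 'g ell2" where
  "delta x = Abs_ell2 (\<lambda>y. if y = x then 1 else 0)"

lemma coord_delta: "coord (delta x) y = (if y = x then 1 else 0)"
  and norm_delta: "norm (delta x) = 1"
proof -
  have "(\<lambda>y. (cmod (if y = x then 1 else 0))\<^sup>2) summable_on UNIV"
    by (rule summable_on_cong_neutral[where S = "{x}" and f = "\<lambda>_. 1", THEN iffD1]) auto
  then show c: "coord (delta x) y = (if y = x then 1 else 0)" for y
    unfolding delta_def by (subst Abs_ell2_inverse) auto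
  have "(norm (delta x))\<^sup>2 = infsum (\<lambda>_. 1) {x}"
    unfolding norm_ell2_power2 by (rule infsum_cong_neutral) (auto simp: c)
  then have "(norm (delta x))\<^sup>2 = 1\<^sup>2" by simp
  then show "norm (delta x) = 1" by (rule power2_eq_imp_eq) auto
qed

text \<open>Convolution by the function \<open>g\<close> on the bisection \<open>U\<close>, extended by zero: an arrow \<open>\<gamma>\<close> is
  sent to \<open>\<alpha>\<^sup>-\<^sup>1 \<gamma>\<close> for the unique \<open>\<alpha> \<in> U\<close> with the range of \<open>\<gamma>\<close>.\<close>

definition bop :: "'g groupoid \<Rightarrow> 'g set \<Rightarrow> ('g \<Rightarrow> complex) \<Rightarrow> 'g operator" where
  "bop G U g = wcomp {\<gamma> \<in> arrows G. rng G \<gamma> \<in> rng G ` U}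
     (\<lambda>\<gamma>. mul G (ginv G (inv_into U (rng G) (rng G \<gamma>))) \<gamma>)
     (\<lambda>\<gamma>. g (inv_into U (rng G) (rng G \<gamma>)))"

abbreviation nop :: "'g groupoid \<Rightarrow> 'g set \<Rightarrow> 'g operator" where
  "nop G U \<equiv> bop G U (\<lambda>_. 1)"

context groupoid
begin

text \<open>The range of \<alpha>^-1 \<gamma> is the domain of \<alpha>, and \<open>dom G\<close> is
  injective on \<open>U\<close>. So the shifted arrow determines \<alpha>, and then
  \<gamma>.\<close>

lemma bop_inj_on:
  assumes U: "bisection G U"
  shows "inj_on (\<lambda>\<gamma>. mul G (ginv G (inv_into U (rng G) (rng G \<gamma>))) \<gamma>)
     {\<gamma> \<in> arrows G. rng G \<gamma> \<in> rng G ` U}"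
proof (rule inj_onI)
  let ?s = "inv_into U (rng G)"
  fix \<gamma> \<gamma>' assume "\<gamma> \<in> {\<gamma> \<in> arrows G. rng G \<gamma> \<in> rng G ` U}" "\<gamma>' \<in> {\<gamma> \<in> arrows G. rng G \<gamma> \<in> rng G ` U}"
    and eq: "mul G (ginv G (?s (rng G \<gamma>))) \<gamma> = mul G (ginv G (?s (rng G \<gamma>'))) \<gamma>'"
  then have g: "\<gamma> \<in> arrows G" "?s (rng G \<gamma>) \<in> U" "rng G (?s (rng G \<gamma>)) = rng G \<gamma>"
    "\<gamma>' \<in> arrows G" "?s (rng G \<gamma>') \<in> U" "rng G (?s (rng G \<gamma>')) = rng G \<gamma>'"
    by (auto simp: inv_into_into f_inv_into_f)
  then have a: "?s (rng G \<gamma>) \<in> arrows G" "?s (rng G \<gamma>') \<in> arrows G"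
    using U by (auto simp: bisection_def)
  have "dom G (?s (rng G \<gamma>)) = rng G (mul G (ginv G (?s (rng G \<gamma>))) \<gamma>)"
    "dom G (?s (rng G \<gamma>')) = rng G (mul G (ginv G (?s (rng G \<gamma>'))) \<gamma>')"
    using a g by (simp_all add: arrow_simps)
  then have "?s (rng G \<gamma>) = ?s (rng G \<gamma>')"
    using U g eq by (auto simp: bisection_def inj_on_def)
  then show "\<gamma> = \<gamma>'" using eq a g mul_ginv_cancel by metis
qed

lemma bop_section:
  assumes "bisection G U" "\<alpha> \<in> U" "rng G \<alpha> = rng G \<gamma>"
  shows "inv_into U (rng G) (rng G \<gamma>) = \<alpha>"
  using assms by (metis bisection_def inv_into_f_f)

lemma coord_bop:
  assumes U: "bisection G U" and g: "bounded (g ` U)"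
  shows "\<alpha> \<in> U \<Longrightarrow> \<gamma> \<in> arrows G \<Longrightarrow> rng G \<alpha> = rng G \<gamma> \<Longrightarrow>
      coord (bop G U g \<xi>) \<gamma> = g \<alpha> * coord \<xi> (mul G (ginv G \<alpha>) \<gamma>)"
    and "\<gamma> \<notin> arrows G \<or> rng G \<gamma> \<notin> rng G ` U \<Longrightarrow> coord (bop G U g \<xi>) \<gamma> = 0"
proof -
  obtain M where M: "\<And>\<alpha>. \<alpha> \<in> U \<Longrightarrow> cmod (g \<alpha>) \<le> M" "0 \<le> M"
    using g unfolding bounded_pos by force
  have w: "cmod (g (inv_into U (rng G) (rng G \<gamma>))) \<le> M"
    if "\<gamma> \<in> {\<gamma> \<in> arrows G. rng G \<gamma> \<in> rng G ` U}" for \<gamma>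
    by (rule M(1)) (use that in \<open>auto intro: inv_into_into\<close>)
  have c: "coord (bop G U g \<xi>) \<gamma> = (if \<gamma> \<in> {\<gamma> \<in> arrows G. rng G \<gamma> \<in> rng G ` U}
      then g (inv_into U (rng G) (rng G \<gamma>)) * coord \<xi> (mul G (ginv G (inv_into U (rng G) (rng G \<gamma>))) \<gamma>) else 0)"
    unfolding bop_def by (rule coord_wcomp[OF bop_inj_on[OF U] w M(2)])
  show "\<alpha> \<in> U \<Longrightarrow> \<gamma> \<in> arrows G \<Longrightarrow> rng G \<alpha> = rng G \<gamma> \<Longrightarrow>
      coord (bop G U g \<xi>) \<gamma> = g \<alpha> * coord \<xi> (mul G (ginv G \<alpha>) \<gamma>)"
    by (subst c) (auto simp: bop_section[OF U] image_iff)
  show "\<gamma> \<notin> arrows G \<or> rng G \<gamma> \<notin> rng G ` U \<Longrightarrow> coord (bop G U g \<xi>) \<gamma> = 0"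
    by (subst c) auto
qed

lemma norm_bop_le:
  assumes U: "bisection G U" and M: "\<And>\<alpha>. \<alpha> \<in> U \<Longrightarrow> cmod (g \<alpha>) \<le> M" "0 \<le> M"
  shows "norm (bop G U g) \<le> M"
  unfolding bop_def
  by (rule norm_wcomp_le[OF bop_inj_on[OF U] _ M(2)]) (auto intro!: M inv_into_into)

lemma bop_eqI:
  fixes a :: "'g operator"
  assumes U: "bisection G U" and g: "bounded (g ` U)"
    and 1: "\<And>\<xi> \<alpha> \<gamma>. \<alpha> \<in> U \<Longrightarrow> \<alpha> \<in> arrows G \<Longrightarrow> \<gamma> \<in> arrows G \<Longrightarrow> rng G \<alpha> = rng G \<gamma> \<Longrightarrow>
      coord (a \<xi>) \<gamma> = g \<alpha> * coord \<xi> (mul G (ginv G \<alpha>) \<gamma>)"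
    and 2: "\<And>\<xi> \<gamma>. \<gamma> \<notin> arrows G \<or> rng G \<gamma> \<notin> rng G ` U \<Longrightarrow> coord (a \<xi>) \<gamma> = 0"
  shows "bop G U g = a"
proof (intro blinfun_eqI ell2_eqI)
  fix \<xi> \<gamma>
  show "coord (bop G U g \<xi>) \<gamma> = coord (a \<xi>) \<gamma>"
  proof (cases "\<gamma> \<in> arrows G \<and> rng G \<gamma> \<in> rng G ` U")
    case True
    then obtain \<alpha> where "\<alpha> \<in> U" "rng G \<alpha> = rng G \<gamma>" by force
    then show ?thesis
      using coord_bop(1)[OF U g, of \<alpha> \<gamma> \<xi>] 1[of \<alpha> \<gamma> \<xi>] True U by (auto simp: bisection_def)
  qed (use coord_bop(2)[OF U g] 2 in auto)
qed

lemma bounded_const_image: "bounded ((\<lambda>_. c) ` U)"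
  by (rule bounded_subset[of "{c}"]) auto

lemma bounded_image_mult: "bounded (g ` U) \<Longrightarrow> bounded ((\<lambda>\<alpha>. c * g \<alpha> :: complex) ` U)"
  using bounded_scaling[of "g ` U"] bounded_linear_image[OF _ bounded_linear_mult_right[of c], of "g ` U"]
  by (simp add: image_image)

lemma bop_cong:
  assumes "bisection G U" "bounded (g ` U)" "\<And>\<alpha>. \<alpha> \<in> U \<Longrightarrow> g \<alpha> = h \<alpha>"
  shows "bop G U g = bop G U h"
proof -
  have "bounded (h ` U)" using assms by (metis image_cong)
  then show ?thesis using assms by (intro bop_eqI) (simp_all add: coord_bop)
qed

lemma scale_bop:
  assumes "bisection G U" "bounded (g ` U)"
  shows "scale_op c (bop G U g) = bop G U (\<lambda>\<alpha>. c * g \<alpha>)"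
  by (rule bop_eqI[symmetric]) (use assms in \<open>simp_all add: coord_bop bounded_image_mult\<close>)

lemma scale_nop: "bisection G U \<Longrightarrow> scale_op c (nop G U) = bop G U (\<lambda>_. c)"
  by (simp add: scale_bop bounded_const_image)

lemma bop_diff:
  assumes "bisection G U" "bounded (g ` U)" "bounded (h ` U)"
  shows "bop G U g - bop G U h = bop G U (\<lambda>\<alpha>. g \<alpha> - h \<alpha>)"
  by (rule bop_eqI[symmetric])
    (use assms in \<open>simp_all add: coord_bop bounded_minus_comp blinfun.diff_left algebra_simps\<close>)

lemma bop_Un:
  assumes UV: "bisection G (U \<union> V)" "U \<inter> V = {}" and g: "bounded (g ` (U \<union> V))"
  shows "bop G (U \<union> V) g = bop G U g + bop G V g"
proof (rule bop_eqI[OF UV(1) g])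
  have U: "bisection G U" "bounded (g ` U)" and V: "bisection G V" "bounded (g ` V)"
    using UV(1) g bounded_subset[OF g] by (auto simp: bisection_def inj_on_Un image_Un)
  have inj: "\<alpha> = \<beta>" if "\<alpha> \<in> U \<union> V" "\<beta> \<in> U \<union> V" "rng G \<alpha> = rng G \<beta>" for \<alpha> \<beta>
    using that UV(1) by (metis bisection_def inj_onD)
  fix \<xi> \<gamma>
  show "coord ((bop G U g + bop G V g) \<xi>) \<gamma> = 0" if "\<gamma> \<notin> arrows G \<or> rng G \<gamma> \<notin> rng G ` (U \<union> V)"
    using that by (auto simp: blinfun.add_left coord_bop[OF U] coord_bop[OF V] image_Un)
  fix \<alpha> assume *: "\<alpha> \<in> U \<union> V" "\<alpha> \<in> arrows G" "\<gamma> \<in> arrows G" "rng G \<alpha> = rng G \<gamma>"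
  show "coord ((bop G U g + bop G V g) \<xi>) \<gamma> = g \<alpha> * coord \<xi> (mul G (ginv G \<alpha>) \<gamma>)"
  proof (cases "\<alpha> \<in> U")
    case True
    then have "rng G \<gamma> \<notin> rng G ` V" using inj * UV(2) by (metis IntI Un_iff empty_iff imageE)
    then show ?thesis using True * by (simp add: blinfun.add_left coord_bop[OF U] coord_bop[OF V])
  next
    case False
    then have "rng G \<gamma> \<notin> rng G ` U" using inj * UV(2) by (metis Un_iff imageE)
    then show ?thesis using False * by (simp add: blinfun.add_left coord_bop[OF U] coord_bop[OF V])
  qed
qed

lemma bop_empty: "bop G {} g = 0"
  by (rule bop_eqI) (auto simp: bisection_def)

text \<open>Every arrow of the product of two bisections factors in exactly one way, so convolving
  the indicator functions creates no multiplicities. Thus \<open>nop G\<close> represents the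
  inverse semigroup.\<close>

lemma nop_mul:
  assumes U: "bisection G U" and V: "bisection G V"
  shows "nop G U o\<^sub>L nop G V = nop G (set_mul G U V)"
proof (rule bop_eqI[symmetric, OF bisection_set_mul[OF U V] bounded_const_image])
  note cU = coord_bop[OF U bounded_const_image] and cV = coord_bop[OF V bounded_const_image]
  have sub: "U \<subseteq> arrows G" "V \<subseteq> arrows G" using U V by (auto simp: bisection_def)
  fix \<xi> \<gamma>
  show "coord ((nop G U o\<^sub>L nop G V) \<xi>) \<gamma> = 0"
    if 0: "\<gamma> \<notin> arrows G \<or> rng G \<gamma> \<notin> rng G ` set_mul G U V"
  proof (cases "\<gamma> \<notin> arrows G \<or> rng G \<gamma> \<notin> rng G ` U")
    case False
    then obtain \<alpha> where \<alpha>: "\<alpha> \<in> U" "rng G \<alpha> = rng G \<gamma>" "\<gamma> \<in> arrows G" by force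
    \<comment> \<open>Here the shift by \<alpha> is possible, but the shifted arrow leaves the range
      of \<open>V\<close>, so the second operator gives zero.\<close>
    have "dom G \<alpha> \<notin> rng G ` V"
    proof
      assume "dom G \<alpha> \<in> rng G ` V"
      then obtain \<beta> where \<beta>: "\<beta> \<in> V" "dom G \<alpha> = rng G \<beta>" by auto
      then have "mul G \<alpha> \<beta> \<in> set_mul G U V" "rng G (mul G \<alpha> \<beta>) = rng G \<gamma>"
        using \<alpha> sub by (auto simp: set_mul_def arrow_simps subset_iff)
      then show False using 0 \<alpha> by (metis image_eqI)
    qed
    then show ?thesis
      using \<alpha> sub by (simp add: cU cV subset_iff arrow_simps)
  qed (simp add: cU)
  fix \<delta> assume \<delta>: "\<delta> \<in> set_mul G U V" "\<gamma> \<in> arrows G" "rng G \<delta> = rng G \<gamma>"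
  then obtain \<alpha> \<beta> where *: "\<delta> = mul G \<alpha> \<beta>" "\<alpha> \<in> U" "\<beta> \<in> V" "dom G \<alpha> = rng G \<beta>"
    by (auto simp: set_mul_def)
  then have a: "\<alpha> \<in> arrows G" "\<beta> \<in> arrows G" using sub by auto
  then have "rng G \<alpha> = rng G \<gamma>" using \<delta> * by (simp add: arrow_simps)
  then show "coord ((nop G U o\<^sub>L nop G V) \<xi>) \<gamma> = 1 * coord \<xi> (mul G (ginv G \<delta>) \<gamma>)"
    using * a \<delta>(2) cU(1)[of \<alpha> \<gamma>] cV(1)[of \<beta> "mul G (ginv G \<alpha>) \<gamma>"]
    by (simp add: arrow_simps ginv_of_mul mul_assoc')
qed

text \<open>The shift by \<alpha>^-1 is undone by the shift by \<alpha>, which belongs to the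
  inverse bisection; all weights are 1.\<close>

lemma nop_adjoint:
  assumes U: "bisection G U"
  shows "is_adjoint (nop G U) (nop G (ginv G ` U))"
  unfolding bop_def
proof (rule is_adjoint_wcomp[OF bop_inj_on[OF U], of _ 1])
  have sub: "U \<subseteq> arrows G" using U by (auto simp: bisection_def)
  note U' = bisection_ginv[OF U]
  let ?s = "inv_into U (rng G)" and ?s' = "inv_into (ginv G ` U) (rng G)"
  let ?D = "{\<gamma> \<in> arrows G. rng G \<gamma> \<in> rng G ` U}"
  let ?E = "{\<gamma> \<in> arrows G. rng G \<gamma> \<in> rng G ` ginv G ` U}"
  have E: "rng G ` ginv G ` U = dom G ` U" by (rule rng_image_ginv[OF sub])
  have s: "?s (rng G \<gamma>) = \<alpha>" if "\<alpha> \<in> U" "rng G \<alpha> = rng G \<gamma>" for \<alpha> \<gamma>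
    by (rule bop_section[OF U that])
  have s': "?s' (rng G \<gamma>) = ginv G \<alpha>" if "\<alpha> \<in> U" "dom G \<alpha> = rng G \<gamma>" for \<alpha> \<gamma>
    by (rule bop_section[OF U']) (use that sub in \<open>auto simp: arrow_simps subset_iff\<close>)
  have D1: "?s (rng G \<gamma>) \<in> U" "rng G (?s (rng G \<gamma>)) = rng G \<gamma>" "?s (rng G \<gamma>) \<in> arrows G" if "\<gamma> \<in> ?D" for \<gamma>
    using that sub by (auto simp: inv_into_into f_inv_into_f intro: subsetD[OF sub inv_into_into])
  show 3: "mul G (ginv G (?s' (rng G (mul G (ginv G (?s (rng G \<gamma>))) \<gamma>)))) (mul G (ginv G (?s (rng G \<gamma>))) \<gamma>) = \<gamma>"
    if "\<gamma> \<in> ?D" for \<gamma>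
  proof -
    have "?s' (rng G (mul G (ginv G (?s (rng G \<gamma>))) \<gamma>)) = ginv G (?s (rng G \<gamma>))"
      using that D1[OF that] by (intro s') (simp_all add: arrow_simps)
    then show ?thesis using that D1[OF that] by (simp add: ginv_ginv mul_ginv_cancel)
  qed
  show "(\<lambda>\<gamma>. mul G (ginv G (?s (rng G \<gamma>))) \<gamma>) ` ?D = ?E"
  proof (intro subset_antisym subsetI)
    fix \<gamma>' assume "\<gamma>' \<in> (\<lambda>\<gamma>. mul G (ginv G (?s (rng G \<gamma>))) \<gamma>) ` ?D"
    then obtain \<gamma> where \<gamma>: "\<gamma> \<in> ?D" "\<gamma>' = mul G (ginv G (?s (rng G \<gamma>))) \<gamma>" by auto
    then show "\<gamma>' \<in> ?E" unfolding E using D1[OF \<gamma>(1)] by (simp add: arrow_simps)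
  next
    fix \<gamma>' assume "\<gamma>' \<in> ?E"
    then obtain \<alpha> where \<alpha>: "\<alpha> \<in> U" "\<alpha> \<in> arrows G" "dom G \<alpha> = rng G \<gamma>'" "\<gamma>' \<in> arrows G"
      unfolding E using sub by auto
    then have "?s (rng G (mul G \<alpha> \<gamma>')) = \<alpha>" "mul G \<alpha> \<gamma>' \<in> ?D"
      by (auto simp: arrow_simps intro!: s)
    then show "\<gamma>' \<in> (\<lambda>\<gamma>. mul G (ginv G (?s (rng G \<gamma>))) \<gamma>) ` ?D"
      using \<alpha> by (intro image_eqI[of _ _ "mul G \<alpha> \<gamma>'"]) (simp_all add: ginv_mul_cancel)
  qed
qed auto

text \<open>The only element of \<open>K\<close> with the range of \<gamma> is that range itself, so
  the shift is the identity and a multiplication operator remains.\<close>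

lemma coord_bop_units:
  assumes K: "K \<subseteq> units G" and g: "bounded (g ` K)"
  shows "coord (bop G K g \<xi>) \<gamma> = (if \<gamma> \<in> arrows G \<and> rng G \<gamma> \<in> K then g (rng G \<gamma>) * coord \<xi> \<gamma> else 0)"
proof -
  have r: "rng G ` K = K" using K by (force simp: rng_of_unit)
  note c = coord_bop[OF bisection_units[OF K] g, where \<xi> = \<xi> and \<gamma> = \<gamma>]
  show ?thesis
  proof (cases "\<gamma> \<in> arrows G \<and> rng G \<gamma> \<in> K")
    case True
    then show ?thesis
      using c(1)[of "rng G \<gamma>"] by (simp add: rng_rng ginv_unit rng_unit rng_mul_self)
  qed (use c(2) r in auto)
qed

lemma bop_units_eqI:
  fixes a :: "'g operator"
  assumes K: "K \<subseteq> units G" and g: "bounded (g ` K)"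
    and a: "\<And>\<xi> \<gamma>. coord (a \<xi>) \<gamma> = (if \<gamma> \<in> arrows G \<and> rng G \<gamma> \<in> K then g (rng G \<gamma>) * coord \<xi> \<gamma> else 0)"
  shows "bop G K g = a"
  by (intro blinfun_eqI ell2_eqI) (simp add: a coord_bop_units[OF K g])

lemma bop_units_mul:
  assumes K: "K \<subseteq> units G" and g: "bounded (g ` K)" and L: "L \<subseteq> units G" and h: "bounded (h ` L)"
  shows "bop G K g o\<^sub>L bop G L h = bop G (K \<inter> L) (\<lambda>x. g x * h x)"
proof (rule bop_units_eqI[symmetric])
  obtain M N where "\<And>x. x \<in> K \<Longrightarrow> cmod (g x) \<le> M" "\<And>x. x \<in> L \<Longrightarrow> cmod (h x) \<le> N" "0 \<le> M"
    using g h unfolding bounded_pos by force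
  then show "bounded ((\<lambda>x. g x * h x) ` (K \<inter> L))"
    by (auto simp: bounded_iff norm_mult intro!: exI[of _ "M * N"] mult_mono)
qed (use assms in \<open>auto simp: coord_bop_units\<close>)

lemma eval_bop_units:
  assumes f: "bounded (f ` units G)" and x: "x \<in> units G"
  shows "coord (bop G (units G) f (delta x)) x = f x"
  using x by (simp add: coord_bop_units[OF _ f] coord_delta unit_arrow rng_of_unit)

text \<open>Testing on the unit vector at x bounds the operator norm below by the values of f. This
  separates distinct idempotents of the diagonal.\<close>

lemma eval_le_norm_bop_units:
  assumes f: "bounded (f ` units G)" and x: "x \<in> units G"
  shows "cmod (f x) \<le> norm (bop G (units G) f)"
proof -
  have "cmod (f x) \<le> norm (bop G (units G) f (delta x))"
    using norm_coord_le[of "bop G (units G) f (delta x)" x] by (simp add: eval_bop_units[OF f x])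
  also have "\<dots> \<le> norm (bop G (units G) f)"
    using norm_blinfun[of "bop G (units G) f" "delta x"] by (simp add: norm_delta)
  finally show ?thesis .
qed

subsection \<open>Implemented functions\<close>

lemma implements_unique:
  assumes "implements G f a" "implements G f b"
  shows "a = b"
  using assms by (intro blinfun_eqI ell2_eqI) (simp add: implements_def)

lemma implements_bop:
  assumes U: "bisection G U" and g: "bounded (g ` U)"
    and f: "\<And>\<alpha>. \<alpha> \<in> U \<Longrightarrow> f \<alpha> = g \<alpha>" "\<And>\<alpha>. \<alpha> \<in> arrows G \<Longrightarrow> \<alpha> \<notin> U \<Longrightarrow> f \<alpha> = 0"
  shows "implements G f (bop G U g)"
  unfolding implements_def
proof (intro allI)
  fix \<xi> \<gamma>
  show "coord (bop G U g \<xi>) \<gamma> = (if \<gamma> \<in> arrows G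
      then \<Sum>\<^sub>\<infinity>\<alpha>\<in>{\<alpha> \<in> arrows G. rng G \<alpha> = rng G \<gamma>}. f \<alpha> * coord \<xi> (mul G (ginv G \<alpha>) \<gamma>) else 0)"
  proof (cases "\<gamma> \<in> arrows G \<and> rng G \<gamma> \<in> rng G ` U")
    case True
    then obtain \<alpha> where \<alpha>: "\<alpha> \<in> U" "rng G \<alpha> = rng G \<gamma>" by force
    have \<alpha>': "\<alpha> \<in> arrows G" using U \<alpha> by (auto simp: bisection_def)
    have 0: "f \<beta> = 0" if "\<beta> \<in> {\<alpha> \<in> arrows G. rng G \<alpha> = rng G \<gamma>} - {\<alpha>}" for \<beta>
    proof (rule f(2))
      show "\<beta> \<notin> U" using that \<alpha> U by (auto simp: bisection_def inj_on_def)
    qed (use that in simp)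
    have "(\<Sum>\<^sub>\<infinity>\<alpha>\<in>{\<alpha> \<in> arrows G. rng G \<alpha> = rng G \<gamma>}. f \<alpha> * coord \<xi> (mul G (ginv G \<alpha>) \<gamma>))
        = (\<Sum>\<^sub>\<infinity>\<alpha>\<in>{\<alpha>}. f \<alpha> * coord \<xi> (mul G (ginv G \<alpha>) \<gamma>))"
      by (rule infsum_cong_neutral) (use \<alpha> \<alpha>' 0 in \<open>simp_all\<close>)
    then show ?thesis using True \<alpha> by (simp add: coord_bop[OF U g] f)
  next
    case False
    have "f \<alpha> = 0" if "\<alpha> \<in> arrows G" "rng G \<alpha> = rng G \<gamma>" "\<gamma> \<in> arrows G" for \<alpha>
      using that False f(2) by (metis image_eqI)
    then have "(\<Sum>\<^sub>\<infinity>\<alpha>\<in>{\<alpha> \<in> arrows G. rng G \<alpha> = rng G \<gamma>}. f \<alpha> * coord \<xi> (mul G (ginv G \<alpha>) \<gamma>)) = 0"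
      if "\<gamma> \<in> arrows G"
      by (intro infsum_0) (use that in simp)
    then show ?thesis using False by (simp add: coord_bop(2)[OF U g])
  qed
qed

lemma summable_on_finite_support:
  fixes f :: "'a \<Rightarrow> 'b::{comm_monoid_add, topological_space}"
  assumes "finite {x \<in> A. f x \<noteq> 0}"
  shows "f summable_on A"
  by (rule summable_on_cong_neutral[THEN iffD1, OF _ _ _ summable_on_finite[OF assms]]) auto

text \<open>\<open>infsum\<close> is additive only on summable families; finite support on each
  fibre of \<open>rng G\<close> guarantees this.\<close>

lemma implements_add:
  assumes a: "implements G f a" and b: "implements G g b"
    and f: "\<And>x. finite {\<alpha> \<in> arrows G. rng G \<alpha> = x \<and> f \<alpha> \<noteq> 0}"
    and g: "\<And>x. finite {\<alpha> \<in> arrows G. rng G \<alpha> = x \<and> g \<alpha> \<noteq> 0}"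
  shows "implements G (\<lambda>\<alpha>. f \<alpha> + g \<alpha>) (a + b)"
proof -
  have "(\<lambda>\<alpha>. h \<alpha> * coord \<xi> (mul G (ginv G \<alpha>) \<gamma>)) summable_on {\<alpha> \<in> arrows G. rng G \<alpha> = rng G \<gamma>}"
    if "\<And>x. finite {\<alpha> \<in> arrows G. rng G \<alpha> = x \<and> h \<alpha> \<noteq> 0}" for h \<xi> \<gamma>
    by (rule summable_on_finite_support) (rule finite_subset[OF _ that[of "rng G \<gamma>"]], auto)
  then show ?thesis
    using a b f g by (auto simp: implements_def blinfun.add_left distrib_right infsum_add)
qed

end

section \<open>The reduced algebra and its diagonal\<close>

text \<open>The scalars are built in because \<open>span\<close> is the real span; in this way the
  span is closed under complex multiples.\<close>

definition nops :: "'g groupoid \<Rightarrow> 'g operator set" where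
  "nops G = {scale_op c (nop G U) | c U. U \<in> compact_open_bisections G}"

text \<open>The frontier of a clopen set is empty, so the two pieces glue without any matching
  condition.\<close>

lemma continuous_map_clopen_cases:
  assumes "continuous_map (subtopology X U) Y f" "continuous_map (subtopology X (- U)) Y g"
    and "openin X U" "closedin X U"
  shows "continuous_map X Y (\<lambda>x. if x \<in> U then f x else g x)"
proof (rule continuous_map_cases)
  have U: "X closure_of {x. x \<in> U} = U" using assms(4) by (simp add: closure_of_eq)
  have "topspace X \<inter> {x. x \<notin> U} = topspace X - U" by auto
  then have V: "X closure_of {x. x \<notin> U} = topspace X - U"
    using assms(3) by (subst closure_of_restrict) (simp add: closure_of_eq closedin_diff)
  show "continuous_map (subtopology X (X closure_of {x. x \<in> U})) Y f"
    using assms(1) by (simp only: U)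
  have "subtopology X (topspace X - U) = subtopology X (- U)"
    by (metis Diff_eq subtopology_restrict)
  then show "continuous_map (subtopology X (X closure_of {x. x \<notin> U})) Y g"
    using assms(2) by (simp only: V)
  show "f x = g x" if "x \<in> X frontier_of {x. x \<in> U}" for x
  proof -
    have "X closure_of U = U" "X interior_of U = U"
      using assms(3,4) by (simp_all add: closure_of_eq interior_of_eq)
    then show ?thesis using that by (simp add: frontier_of_def)
  qed
qed

lemmas compose_simps = bounded_bilinear.add_left[OF bounded_bilinear_blinfun_compose]
  bounded_bilinear.add_right[OF bounded_bilinear_blinfun_compose]
  bounded_bilinear.diff_left[OF bounded_bilinear_blinfun_compose]
  bounded_bilinear.diff_right[OF bounded_bilinear_blinfun_compose]
  bounded_bilinear.scaleR_left[OF bounded_bilinear_blinfun_compose]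
  bounded_bilinear.scaleR_right[OF bounded_bilinear_blinfun_compose]
  bounded_bilinear.zero_left[OF bounded_bilinear_blinfun_compose]
  bounded_bilinear.zero_right[OF bounded_bilinear_blinfun_compose]

lemma scaleR_scale_op: "t *\<^sub>R scale_op c a = scale_op (complex_of_real t * c) a"
  and scale_scale_op: "scale_op c (scale_op d a) = scale_op (c * d) a"
  and scale_op_add: "scale_op c (a + b) = scale_op c a + scale_op c b"
  and scale_op_zero: "scale_op c 0 = 0"
  and scale_op_scaleR: "scale_op c (t *\<^sub>R a) = t *\<^sub>R scale_op c a"
  by (intro blinfun_eqI ell2_eqI; simp add: blinfun.bilinear_simps scaleR_conv_of_real algebra_simps)+

section \<open>The span of the operators of bisections\<close>

context ample_groupoid
begin

lemma cobD:
  assumes "U \<in> compact_open_bisections G"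
  shows "bisection G U" "compactin (gtop G) U" "openin (gtop G) U" "closedin (gtop G) U" "U \<subseteq> arrows G"
  using assms compactin_imp_closedin[OF Hausdorff]
  by (auto simp: compact_open_bisections_def bisection_def)

lemma cob_unitsI:
  "K \<subseteq> units G \<Longrightarrow> compactin (gtop G) K \<Longrightarrow> openin (gtop G) K \<Longrightarrow> K \<in> compact_open_bisections G"
  by (simp add: compact_open_bisections_def bisection_units)

text \<open>A bisection meets a fibre of \<open>rng G\<close> in at most one arrow. This supplies
  the finiteness asked for in \<open>implements_add\<close>.\<close>

lemma finite_fibre:
  assumes "finite T" "T \<subseteq> compact_open_bisections G" "\<And>\<alpha>. \<alpha> \<in> arrows G \<Longrightarrow> f \<alpha> \<noteq> 0 \<Longrightarrow> \<alpha> \<in> \<Union>T"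
  shows "finite {\<alpha> \<in> arrows G. rng G \<alpha> = x \<and> f \<alpha> \<noteq> 0}"
proof (rule finite_subset)
  show "{\<alpha> \<in> arrows G. rng G \<alpha> = x \<and> f \<alpha> \<noteq> 0} \<subseteq> (\<Union>U\<in>T. rng G -` {x} \<inter> U)"
    using assms(3) by blast
  have "finite (rng G -` {x} \<inter> U)" if "U \<in> T" for U
    using that assms(2) by (intro finite_vimage_IntI) (auto simp: compact_open_bisections_def bisection_def)
  then show "finite (\<Union>U\<in>T. rng G -` {x} \<inter> U)" using assms(1) by blast
qed

lemma CcI:
  assumes "continuous_map (gtop G) euclidean f" "compactin (gtop G) K"
    "\<And>\<alpha>. f \<alpha> \<noteq> 0 \<Longrightarrow> \<alpha> \<in> K"
  shows "f \<in> Cc G"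
proof -
  have K: "closedin (gtop G) K" "K \<subseteq> arrows G"
    using assms(2) compactin_imp_closedin[OF Hausdorff] compactin_subset_topspace[OF assms(2)]
    by (simp_all add: arrows_def)
  have "gtop G closure_of {\<alpha> \<in> arrows G. f \<alpha> \<noteq> 0} \<subseteq> K"
    by (rule closure_of_minimal[OF _ K(1)]) (use assms(3) in blast)
  then have "compactin (gtop G) (gtop G closure_of {\<alpha> \<in> arrows G. f \<alpha> \<noteq> 0})"
    by (intro closed_compactin[OF assms(2)]) simp_all
  moreover have "f \<alpha> = 0" if "\<alpha> \<notin> arrows G" for \<alpha>
    using that K(2) assms(3)[of \<alpha>] by blast
  ultimately show ?thesis using assms(1) by (simp add: Cc_def)
qed

lemma Cc_support:
  assumes "f \<in> Cc G"
  obtains K where "compactin (gtop G) K" "\<And>\<alpha>. f \<alpha> \<noteq> 0 \<Longrightarrow> \<alpha> \<in> K"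
proof
  show "compactin (gtop G) (gtop G closure_of {\<alpha> \<in> arrows G. f \<alpha> \<noteq> 0})"
    using assms by (simp add: Cc_def)
  show "\<alpha> \<in> gtop G closure_of {\<alpha> \<in> arrows G. f \<alpha> \<noteq> 0}" if "f \<alpha> \<noteq> 0" for \<alpha>
    using assms that closure_of_subset[of "{\<alpha> \<in> arrows G. f \<alpha> \<noteq> 0}" "gtop G"]
    by (auto simp: Cc_def arrows_def)
qed

lemma nops_compose:
  assumes "a \<in> nops G" "b \<in> nops G"
  shows "a o\<^sub>L b \<in> nops G"
proof -
  obtain c U d V where *: "a = scale_op c (nop G U)" "U \<in> compact_open_bisections G"
    "b = scale_op d (nop G V)" "V \<in> compact_open_bisections G"
    using assms by (auto simp: nops_def)
  note U = cobD(1)[OF *(2)] and V = cobD(1)[OF *(4)]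
  \<comment> \<open>The type of operators guarantees only real linearity, so moving the scalar
    \<open>d\<close> past \<open>nop G U\<close> is checked on coordinates.\<close>
  have "a o\<^sub>L b = scale_op (c * d) (nop G U o\<^sub>L nop G V)"
  proof (intro blinfun_eqI ell2_eqI)
    fix \<xi> \<gamma>
    note cU = coord_bop[OF U bounded_const_image]
    show "coord ((a o\<^sub>L b) \<xi>) \<gamma> = coord (scale_op (c * d) (nop G U o\<^sub>L nop G V) \<xi>) \<gamma>"
    proof (cases "\<gamma> \<in> arrows G \<and> rng G \<gamma> \<in> rng G ` U")
      case True
      then obtain \<alpha> where "\<alpha> \<in> U" "rng G \<alpha> = rng G \<gamma>" by force
      then show ?thesis using True by (simp add: * cU)
    qed (simp add: * cU)
  qed
  then show ?thesis
    using *(2,4) by (auto simp: nops_def nop_mul[OF U V] intro: compact_open_bisections_mul)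
qed

lemma nops_adjoint:
  assumes "a \<in> nops G"
  shows "\<exists>b\<in>nops G. is_adjoint a b"
proof -
  obtain c U where *: "a = scale_op c (nop G U)" "U \<in> compact_open_bisections G"
    using assms by (auto simp: nops_def)
  note U = cobD(1)[OF *(2)]
  have "is_adjoint a (scale_op (cnj c) (nop G (ginv G ` U)))"
    using nop_adjoint[OF U] unfolding is_adjoint_def * by (simp add: cinner_scaleC)
  then show ?thesis
    using compact_open_bisections_ginv[OF *(2)] unfolding nops_def by blast
qed

lemma span_nops_compose:
  assumes "a \<in> span (nops G)" "b \<in> span (nops G)"
  shows "a o\<^sub>L b \<in> span (nops G)"
  using assms(1)
proof (induction rule: span_induct_alt)
  case (step t a y)
  have "a o\<^sub>L b \<in> span (nops G)"
    using assms(2)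
  proof (induction rule: span_induct_alt)
    case (step t' b y')
    then show ?case
      using nops_compose[OF \<open>a \<in> nops G\<close> step(1)]
      by (simp add: compose_simps span_add span_scale span_base)
  qed (simp add: span_zero)
  then show ?case
    using step(2)
    by (simp add: compose_simps span_add span_scale)
qed (simp add: span_zero)

lemma span_nops_adjoint:
  assumes "a \<in> span (nops G)"
  shows "\<exists>b\<in>span (nops G). is_adjoint a b"
  using assms
proof (induction rule: span_induct_alt)
  case base
  then show ?case using is_adjoint_0 span_zero by blast
next
  case (step t a y)
  then obtain b y' where "b \<in> nops G" "is_adjoint a b" "y' \<in> span (nops G)" "is_adjoint y y'"
    using nops_adjoint by blast
  then show ?case
    by (intro bexI[of _ "t *\<^sub>R b + y'"] is_adjoint_add is_adjoint_scaleR span_add span_scale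
        span_base[of b]) simp_all
qed

lemma span_nops_scale:
  assumes "a \<in> span (nops G)"
  shows "scale_op c a \<in> span (nops G)"
  using assms
proof (induction rule: span_induct_alt)
  case (step t a y)
  then have "scale_op c a \<in> nops G" unfolding nops_def using scale_scale_op by blast
  then show ?case
    using step(2) by (simp add: scale_op_add scale_op_scaleR span_add span_scale span_base)
qed (simp add: scale_op_zero span_zero)

lemma nop_in_nops: "U \<in> compact_open_bisections G \<Longrightarrow> nop G U \<in> nops G"
  unfolding nops_def by (intro CollectI exI[of _ 1] exI[of _ U]) (simp add: scale_nop[OF cobD(1)])

lemma bounded_on_cob:
  assumes "U \<in> compact_open_bisections G" "continuous_map (gtop G) euclidean (f :: _ \<Rightarrow> complex)"
  shows "bounded (f ` U)"
  using image_compactin[OF cobD(2)[OF assms(1)] assms(2)] compact_imp_bounded by simp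

text \<open>The cover is made disjoint along the induction: on \<open>U \<inter> W\<close> the
  constant for \<open>W\<close> is used, and the compact open bisection \<open>U - W\<close> is left
  to the remaining sets. Hence \<open>U\<close> must be arbitrary in the induction.\<close>

lemma locally_constant_approximation:
  assumes "finite T" "T \<subseteq> compact_open_bisections G"
    and "\<And>W. W \<in> T \<Longrightarrow> \<exists>c. \<forall>\<alpha>\<in>W. cmod (c - f \<alpha>) \<le> \<epsilon>"
    and "U \<in> compact_open_bisections G" "U \<subseteq> \<Union>T"
  shows "\<exists>s. bounded (s ` U) \<and> bop G U s \<in> span (nops G) \<and> (\<forall>\<alpha>\<in>U. cmod (s \<alpha> - f \<alpha>) \<le> \<epsilon>)"
  using assms
proof (induction T arbitrary: U)
  case empty
  then show ?case by (auto simp: bop_empty span_zero)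
next
  case (insert W T)
  let ?V = "U - W"
  have W: "W \<in> compact_open_bisections G" using insert.prems by simp
  note UW = compact_open_bisections_Int[OF insert.prems(3) W]
  note V = compact_open_bisections_Diff[OF insert.prems(3) W]
  obtain s where s: "bounded (s ` ?V)" "bop G ?V s \<in> span (nops G)" "\<And>\<alpha>. \<alpha> \<in> ?V \<Longrightarrow> cmod (s \<alpha> - f \<alpha>) \<le> \<epsilon>"
  proof -
    have "T \<subseteq> compact_open_bisections G" "?V \<subseteq> \<Union>T"
      using insert.prems by auto
    then show thesis using insert.IH[OF _ _ V] insert.prems(2) that by (meson insertI2)
  qed
  obtain c where c: "\<And>\<alpha>. \<alpha> \<in> W \<Longrightarrow> cmod (c - f \<alpha>) \<le> \<epsilon>"
    using insert.prems(2)[of W] by auto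
  let ?s = "\<lambda>\<alpha>. if \<alpha> \<in> W then c else s \<alpha>"
  have b1: "bounded (?s ` (U \<inter> W))" by (rule bounded_subset[of "{c}"]) auto
  have b2: "bounded (?s ` ?V)" using s(1) by (rule bounded_subset) auto
  have U: "U = (U \<inter> W) \<union> ?V" by blast
  have b: "bounded (?s ` U)"
    by (subst U, subst image_Un) (use b1 b2 in \<open>simp only: bounded_Un\<close>)
  have e1: "bop G (U \<inter> W) ?s = bop G (U \<inter> W) (\<lambda>_. c)"
    by (rule bop_cong[OF cobD(1)[OF UW] b1]) auto
  have e2: "bop G ?V ?s = bop G ?V s"
    by (rule bop_cong[OF cobD(1)[OF V] b2]) auto
  have "bop G U ?s = bop G (U \<inter> W) ?s + bop G ?V ?s"
    by (subst (1) U, rule bop_Un) (use U b cobD(1)[OF insert.prems(3)] in auto)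
  also have "\<dots> = scale_op c (nop G (U \<inter> W)) + bop G ?V s"
    by (simp add: e1 e2 scale_nop[OF cobD(1)[OF UW]])
  also have "\<dots> \<in> span (nops G)"
    by (intro span_add s span_nops_scale span_base nop_in_nops UW)
  finally show ?case
    using b s(3) c by (intro exI[of _ ?s]) auto
qed

section \<open>Functions on units and idempotents of the diagonal\<close>

lemma bounded_C0_units:
  assumes "f \<in> C0_units G"
  shows "bounded (f ` units G)"
proof -
  have "compactin (unit_top G) {x \<in> units G. 1 \<le> cmod (f x)}" "continuous_map (unit_top G) euclidean f"
    using assms by (auto simp: C0_units_def)
  then have "compactin euclidean (f ` {x \<in> units G. 1 \<le> cmod (f x)})"
    by (rule image_compactin)
  then have "bounded (f ` {x \<in> units G. 1 \<le> cmod (f x)} \<union> cball 0 1)"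
    using compact_imp_bounded by simp
  then show ?thesis by (rule bounded_subset) force
qed

lemma implements_C0_units:
  assumes "f \<in> C0_units G"
  shows "implements G f (bop G (units G) f)"
  by (rule implements_bop) (use assms bounded_C0_units bisection_units in \<open>auto simp: C0_units_def\<close>)

text \<open>The unit space is a bisection, so \<open>bop\<close> applies to it even when it is not
  compact.\<close>

lemma diagonal_iff: "b \<in> diagonal_algebra G \<longleftrightarrow> (\<exists>f\<in>C0_units G. b = bop G (units G) f)"
  unfolding diagonal_algebra_def reg_ops_def
  using implements_C0_units implements_unique by blast

text \<open>This moves the operators of different sets of units to the common bisection
  \<open>units G\<close>, where functions can be subtracted and compared.\<close>

lemma nop_eq_indicator:
  assumes "K \<subseteq> units G"
  shows "nop G K = bop G (units G) (\<lambda>x. if x \<in> K then 1 else 0)"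
proof (rule bop_units_eqI[OF assms bounded_const_image])
  have "bounded ((\<lambda>x. if x \<in> K then 1 else 0 :: complex) ` units G)"
    by (rule bounded_subset[of "{0, 1}"]) auto
  then show "coord (bop G (units G) (\<lambda>x. if x \<in> K then 1 else 0) \<xi>) \<gamma> =
      (if \<gamma> \<in> arrows G \<and> rng G \<gamma> \<in> K then 1 * coord \<xi> \<gamma> else 0)" for \<xi> \<gamma>
    using assms by (auto simp: coord_bop_units)
qed

lemma C0_unitsI:
  assumes f: "continuous_map (unit_top G) euclidean f" and L: "L \<in> compact_open_bisections G" "L \<subseteq> units G"
    and 0: "\<And>x. f x \<noteq> 0 \<Longrightarrow> x \<in> L"
  shows "f \<in> C0_units G"
  unfolding C0_units_def
proof (intro CollectI conjI allI impI f)
  fix \<epsilon> :: real assume "0 < \<epsilon>"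
  have "closedin (unit_top G) {x \<in> topspace (unit_top G). f x \<in> {z. \<epsilon> \<le> cmod z}}"
    by (rule closedin_continuous_map_preimage[OF f]) (auto intro!: closed_Collect_le continuous_intros)
  moreover have "compactin (unit_top G) L"
    using L cobD(2) by (simp add: compactin_unit_top)
  moreover have "{x \<in> topspace (unit_top G). f x \<in> {z. \<epsilon> \<le> cmod z}} \<subseteq> L"
    using 0 \<open>0 < \<epsilon>\<close> by force
  ultimately show "compactin (unit_top G) {x \<in> units G. \<epsilon> \<le> cmod (f x)}"
    using closed_compactin by (fastforce simp: topspace_unit_top)
next
  show "f x = 0" if "x \<notin> units G" for x using that 0 L(2) by blast
qed

lemma clopen_unit_top:
  assumes "L \<in> compact_open_bisections G" "L \<subseteq> units G"
  shows "openin (unit_top G) L" "closedin (unit_top G) L"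
proof -
  show "openin (unit_top G) L" using assms cobD(3) by (simp add: openin_unit_top)
  show "closedin (unit_top G) L"
    using assms cobD(4) by (auto simp: unit_top_def closedin_subtopology)
qed

lemma nop_diagonal:
  assumes "K \<in> compact_open_bisections G" "K \<subseteq> units G"
  shows "nop G K \<in> diagonal_algebra G"
proof -
  have "(\<lambda>x. if x \<in> K then 1 else 0) \<in> C0_units G"
    by (rule C0_unitsI[OF continuous_map_clopen_cases assms])
      (use clopen_unit_top[OF assms] in \<open>auto split: if_splits\<close>)
  then show ?thesis
    unfolding diagonal_iff nop_eq_indicator[OF assms(2)] by blast
qed

text \<open>Evaluation at a unit shows that the function squares to itself, so it takes only the
  values 0 and 1 and is the indicator of its support.\<close>

lemma diagonal_idempotent:
  assumes "b \<in> diagonal_algebra G" "b o\<^sub>L b = b"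
  obtains K where "K \<in> compact_open_bisections G" "K \<subseteq> units G" "b = nop G K"
proof -
  obtain f where f: "f \<in> C0_units G" "b = bop G (units G) f"
    using assms by (auto simp: diagonal_iff)
  note bd = bounded_C0_units[OF f(1)]
  have "f x = 0 \<or> f x = 1" if x: "x \<in> units G" for x
  proof -
    have "coord ((b o\<^sub>L b) (delta x)) x = f x * f x"
      using x by (simp add: f(2) coord_bop_units[OF _ bd] coord_delta unit_arrow rng_of_unit)
    then have "f x * f x = f x"
      unfolding assms(2) unfolding f(2) eval_bop_units[OF bd x] by simp
    then show ?thesis by simp
  qed
  note 01 = this
  let ?K = "{x \<in> units G. f x \<noteq> 0}"
  have c: "continuous_map (unit_top G) euclidean f" using f(1) by (simp add: C0_units_def)
  have "openin (unit_top G) {x \<in> topspace (unit_top G). f x \<in> - {0}}"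
    by (rule openin_continuous_map_preimage[OF c]) auto
  then have o: "openin (gtop G) ?K" by (simp add: topspace_unit_top openin_unit_top)
  \<comment> \<open>Nonvanishing describes \<open>?K\<close> as an open set; with threshold 1 the
    same set is compact by vanishing at infinity.\<close>
  have "?K = {x \<in> units G. 1 \<le> cmod (f x)}" using 01 by force
  then have "compactin (unit_top G) ?K" using f(1) by (simp add: C0_units_def)
  then have "?K \<in> compact_open_bisections G"
    using o by (intro cob_unitsI) (auto simp: compactin_unit_top)
  moreover have "b = nop G ?K"
    unfolding f(2) nop_eq_indicator[of ?K, OF Collect_restrict]
    by (rule bop_cong[OF bisection_units bd]) (use 01 in auto)
  ultimately show thesis using that by blast
qed

end

section \<open>Density, the inclusion of the diagonal, and separability\<close>

context generated_groupoid
begin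

text \<open>On one bisection the operator norm is at most the supremum norm
  (\<open>norm_bop_le\<close>), so a uniform approximation by locally constant functions
  suffices.\<close>

lemma bop_in_closure:
  assumes U: "U \<in> compact_open_bisections G" and f: "continuous_map (gtop G) euclidean f"
  shows "bop G U f \<in> closure (span (nops G))"
  unfolding closure_approachable
proof (intro allI impI)
  fix e :: real assume e: "0 < e"
  define W where "W = (\<lambda>\<alpha>. {\<beta> \<in> topspace (gtop G). f \<beta> \<in> ball (f \<alpha>) (e / 2)})"
  have "\<alpha> \<in> W \<alpha> \<and> openin (gtop G) (W \<alpha>)" if "\<alpha> \<in> U" for \<alpha>
    unfolding W_def using that e cobD(5)[OF U]
    by (intro conjI openin_continuous_map_preimage[OF f]) (auto simp: arrows_def)
  then obtain T where T: "finite T" "T \<subseteq> S" "U \<subseteq> \<Union>T" "\<forall>V\<in>T. \<exists>\<alpha>\<in>U. V \<subseteq> W \<alpha>"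
    by (rule compact_cover[OF cobD(2)[OF U], of W])
  have "\<exists>c. \<forall>\<beta>\<in>V. cmod (c - f \<beta>) \<le> e / 2" if V: "V \<in> T" for V
  proof -
    obtain \<alpha> where "V \<subseteq> W \<alpha>" using T(4) V by blast
    then have "\<forall>\<beta>\<in>V. cmod (f \<alpha> - f \<beta>) \<le> e / 2"
      by (auto simp: W_def dist_norm subset_iff less_imp_le)
    then show ?thesis by blast
  qed
  moreover have "T \<subseteq> compact_open_bisections G" using T(2) generated_bisections by auto
  ultimately have "\<exists>s. bounded (s ` U) \<and> bop G U s \<in> span (nops G) \<and> (\<forall>\<alpha>\<in>U. cmod (s \<alpha> - f \<alpha>) \<le> e / 2)"
    by (intro locally_constant_approximation[OF T(1) _ _ U T(3)])
  then obtain s where s: "bounded (s ` U)" "bop G U s \<in> span (nops G)" "\<And>\<alpha>. \<alpha> \<in> U \<Longrightarrow> cmod (s \<alpha> - f \<alpha>) \<le> e / 2"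
    by blast
  have "norm (bop G U s - bop G U f) \<le> e / 2"
    unfolding bop_diff[OF cobD(1)[OF U] s(1) bounded_on_cob[OF U f]]
    by (rule norm_bop_le[OF cobD(1)[OF U]]) (use s e in auto)
  then show "\<exists>y\<in>span (nops G). dist y (bop G U f) < e"
    using s(2) e by (intro bexI[of _ "bop G U s"]) (auto simp: dist_norm)
qed

text \<open>The function is cut along the clopen set \<open>U\<close>; the part off \<open>U\<close>
  is still continuous and is supported in the remaining bisections. The sum of the resulting
  operators implements the function.\<close>

lemma implements_in_closure:
  assumes "finite T" "T \<subseteq> compact_open_bisections G" "continuous_map (gtop G) euclidean f"
    and "\<And>\<alpha>. \<alpha> \<in> arrows G \<Longrightarrow> f \<alpha> \<noteq> 0 \<Longrightarrow> \<alpha> \<in> \<Union>T"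
  shows "\<exists>a\<in>closure (span (nops G)). implements G f a"
  using assms
proof (induction T arbitrary: f)
  case empty
  then have "implements G f (bop G {} f)"
    by (intro implements_bop) (auto simp: bisection_def)
  then show ?case
    using closure_subset[of "span (nops G)"] span_zero[of "nops G"] by (auto simp: bop_empty)
next
  case (insert U T)
  have U: "U \<in> compact_open_bisections G" using insert.prems by simp
  let ?f = "\<lambda>\<alpha>. if \<alpha> \<in> U then f \<alpha> else 0" and ?g = "\<lambda>\<alpha>. if \<alpha> \<in> U then 0 else f \<alpha>"
  note b = bounded_on_cob[OF U insert.prems(2)]
  have c: "continuous_map (gtop G) euclidean ?g"
    by (rule continuous_map_clopen_cases[OF _ continuous_map_from_subtopology[OF insert.prems(2)]
          cobD(3,4)[OF U]]) simp
  have T: "\<alpha> \<in> \<Union>T" if "\<alpha> \<in> arrows G" "?g \<alpha> \<noteq> 0" for \<alpha>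
    using insert.prems(3)[of \<alpha>] that by (auto split: if_splits)
  then obtain a where a: "a \<in> closure (span (nops G))" "implements G ?g a"
    using insert.IH[OF _ c] insert.prems(1) by auto
  have "implements G ?f (bop G U f)"
    by (rule implements_bop[OF cobD(1)[OF U] b]) auto
  then have "implements G (\<lambda>\<alpha>. ?f \<alpha> + ?g \<alpha>) (bop G U f + a)"
  proof (rule implements_add[OF _ a(2)])
    show "finite {\<alpha> \<in> arrows G. rng G \<alpha> = x \<and> ?f \<alpha> \<noteq> 0}" for x
      by (rule finite_fibre[of "{U}"]) (use U in \<open>auto split: if_splits\<close>)
    show "finite {\<alpha> \<in> arrows G. rng G \<alpha> = x \<and> ?g \<alpha> \<noteq> 0}" for x
      by (rule finite_fibre[OF insert.hyps(1) _ T]) (use insert.prems(1) in simp_all)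
  qed
  moreover have "(\<lambda>\<alpha>. ?f \<alpha> + ?g \<alpha>) = f" by auto
  ultimately show ?case
    using subspace_add[OF subspace_closure[OF subspace_span] bop_in_closure[OF U insert.prems(2)] a(1)]
    by auto
qed

lemma Cc_cover:
  assumes "f \<in> Cc G"
  obtains T where "finite T" "T \<subseteq> compact_open_bisections G" "\<And>\<alpha>. f \<alpha> \<noteq> 0 \<Longrightarrow> \<alpha> \<in> \<Union>T"
proof -
  obtain K where K: "compactin (gtop G) K" "\<And>\<alpha>. f \<alpha> \<noteq> 0 \<Longrightarrow> \<alpha> \<in> K"
    using Cc_support[OF assms] by blast
  have "\<alpha> \<in> topspace (gtop G) \<and> openin (gtop G) (topspace (gtop G))" if "\<alpha> \<in> K" for \<alpha>
    using that compactin_subset_topspace[OF K(1)] by auto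
  then obtain T where T: "finite T" "T \<subseteq> S" "K \<subseteq> \<Union>T"
    by (rule compact_cover[OF K(1), of "\<lambda>_. topspace (gtop G)"])
  show thesis
  proof (rule that[OF T(1)])
    show "T \<subseteq> compact_open_bisections G" using T(2) generated_bisections by auto
    show "\<alpha> \<in> \<Union>T" if "f \<alpha> \<noteq> 0" for \<alpha> using K(2)[OF that] T(3) by (rule subsetD[rotated])
  qed
qed

lemma span_nops_subset: "span (nops G) \<subseteq> reg_ops G (Cc G)"
proof
  fix a assume "a \<in> span (nops G)"
  then show "a \<in> reg_ops G (Cc G)"
  proof (induction rule: span_induct_alt)
    case base
    have "(\<lambda>_. 0) \<in> Cc G" by (rule CcI[of _ "{}"]) auto
    moreover have "implements G (\<lambda>_. 0) 0" by (simp add: implements_def)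
    ultimately show ?case by (auto simp: reg_ops_def)
  next
    case (step t a y)
    then obtain c U where *: "a = scale_op c (nop G U)" and U: "U \<in> compact_open_bisections G"
      by (auto simp: nops_def)
    obtain g where g: "g \<in> Cc G" "implements G g y" using step by (auto simp: reg_ops_def)
    let ?c = "complex_of_real t * c"
    let ?f = "\<lambda>\<alpha>. if \<alpha> \<in> U then ?c else 0"
    have ta: "t *\<^sub>R a = bop G U (\<lambda>_. ?c)"
      unfolding * scaleR_scale_op by (rule scale_nop[OF cobD(1)[OF U]])
    have f: "implements G ?f (t *\<^sub>R a)"
      unfolding ta by (rule implements_bop[OF cobD(1)[OF U] bounded_const_image]) auto
    have cf: "continuous_map (gtop G) euclidean ?f"
      by (rule continuous_map_clopen_cases[OF _ _ cobD(3,4)[OF U]]) auto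
    have cg: "continuous_map (gtop G) euclidean g" using g by (simp add: Cc_def)
    obtain T where T: "finite T" "T \<subseteq> compact_open_bisections G" "\<And>\<alpha>. g \<alpha> \<noteq> 0 \<Longrightarrow> \<alpha> \<in> \<Union>T"
      using Cc_cover[OF g(1)] by blast
    have "implements G (\<lambda>\<alpha>. ?f \<alpha> + g \<alpha>) (t *\<^sub>R a + y)"
    proof (rule implements_add[OF f g(2)])
      show "finite {\<alpha> \<in> arrows G. rng G \<alpha> = x \<and> ?f \<alpha> \<noteq> 0}" for x
        by (rule finite_fibre[of "{U}"]) (use U in \<open>auto split: if_splits\<close>)
      show "finite {\<alpha> \<in> arrows G. rng G \<alpha> = x \<and> g \<alpha> \<noteq> 0}" for x
        by (rule finite_fibre[OF T(1,2)]) (use T(3) in blast)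
    qed
    moreover have "(\<lambda>\<alpha>. ?f \<alpha> + g \<alpha>) \<in> Cc G"
    proof (rule CcI[OF continuous_map_add[OF cf cg]])
      show "compactin (gtop G) (\<Union>(insert U T))"
        using T U cobD(2) by (intro compactin_Union) auto
      show "\<alpha> \<in> \<Union>(insert U T)" if "?f \<alpha> + g \<alpha> \<noteq> 0" for \<alpha>
        using that T(3)[of \<alpha>] by (auto split: if_splits)
    qed
    ultimately show ?case unfolding reg_ops_def by blast
  qed
qed

text \<open>An operator implementing a function of \<open>Cc G\<close> is unique, so it is the one
  constructed in \<open>implements_in_closure\<close>. All later facts on the reduced algebra come
  from this description.\<close>

lemma reduced_algebra_eq: "reduced_algebra G = closure (span (nops G))"
proof -
  have "reg_ops G (Cc G) \<subseteq> closure (span (nops G))"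
  proof
    fix a assume "a \<in> reg_ops G (Cc G)"
    then obtain f where f: "f \<in> Cc G" "implements G f a" by (auto simp: reg_ops_def)
    obtain T where T: "finite T" "T \<subseteq> compact_open_bisections G" "\<And>\<alpha>. f \<alpha> \<noteq> 0 \<Longrightarrow> \<alpha> \<in> \<Union>T"
      using Cc_cover[OF f(1)] by blast
    have "\<exists>b\<in>closure (span (nops G)). implements G f b"
      by (rule implements_in_closure[OF T(1,2)]) (use T(3) f in \<open>auto simp: Cc_def\<close>)
    then show "a \<in> closure (span (nops G))" using f(2) implements_unique by blast
  qed
  then show ?thesis
    unfolding reduced_algebra_def
    by (metis closure_closure closure_mono span_nops_subset subset_antisym)
qed

abbreviation "A \<equiv> reduced_algebra G"
abbreviation "B \<equiv> diagonal_algebra G"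

lemma A_zero: "0 \<in> A"
  and A_add: "a \<in> A \<Longrightarrow> b \<in> A \<Longrightarrow> a + b \<in> A"
  and A_scaleR: "a \<in> A \<Longrightarrow> t *\<^sub>R a \<in> A"
  using subspace_closure[OF subspace_span, of "nops G"]
  by (auto simp: reduced_algebra_eq subspace_def)

lemma A_compose: "a \<in> A \<Longrightarrow> b \<in> A \<Longrightarrow> a o\<^sub>L b \<in> A"
  unfolding reduced_algebra_eq by (rule closure_compose[OF span_nops_compose])

lemma A_scale: "a \<in> A \<Longrightarrow> scale_op c a \<in> A"
  unfolding reduced_algebra_eq by (rule closure_scale_op[OF span_nops_scale])

lemma A_adjoint: "a \<in> A \<Longrightarrow> \<exists>b\<in>A. is_adjoint a b"
  unfolding reduced_algebra_eq by (rule closure_has_adjoint[OF subspace_span span_nops_adjoint])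

lemma nop_A: "U \<in> compact_open_bisections G \<Longrightarrow> nop G U \<in> A"
  unfolding reduced_algebra_eq using nop_in_nops span_base closure_subset by blast

text \<open>The function is truncated to a compact open set \<open>?K\<close> of units containing
  all points where its modulus is at least e / 2. The truncation extends by zero to a continuous
  function on the arrows, since \<open>?K\<close> is clopen.\<close>

lemma diagonal_subset: "B \<subseteq> A"
proof
  fix b assume "b \<in> B"
  then obtain f where f: "f \<in> C0_units G" "b = bop G (units G) f" by (auto simp: diagonal_iff)
  note bd = bounded_C0_units[OF f(1)]
  have cf: "continuous_map (unit_top G) euclidean f" using f by (simp add: C0_units_def)
  \<comment> \<open>The truncations are only known to lie in the closure of the span, whence the
    double closure.\<close>
  have "b \<in> closure (closure (span (nops G)))"
    unfolding closure_approachable[of b]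
  proof (intro allI impI)
    fix e :: real assume e: "0 < e"
    let ?C = "{x \<in> units G. e / 2 \<le> cmod (f x)}"
    have "compactin (unit_top G) ?C"
      using f(1) half_gt_zero[OF e] unfolding C0_units_def by blast
    then have "compactin (gtop G) ?C" by (simp add: compactin_unit_top)
    then obtain T where T: "finite T" "T \<subseteq> S" "?C \<subseteq> \<Union>T" "\<forall>W\<in>T. \<exists>\<alpha>\<in>?C. W \<subseteq> units G"
      by (rule compact_cover[where W = "\<lambda>_. units G"]) (auto simp: units_open)
    let ?K = "\<Union>T"
    have Ku: "?K \<subseteq> units G" using T(4) by blast
    have K: "?K \<in> compact_open_bisections G"
    proof (rule cob_unitsI[OF Ku])
      have *: "W \<in> compact_open_bisections G" if "W \<in> T" for W
        using that T(2) generated_bisections by blast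
      show "compactin (gtop G) ?K" using T(1) * cobD(2) by (blast intro: compactin_Union)
      show "openin (gtop G) ?K" using * cobD(3) by (blast intro: openin_Union)
    qed
    let ?f = "\<lambda>x. if x \<in> ?K then f x else 0"
    have "continuous_map (subtopology (gtop G) ?K) euclidean f"
      using cf continuous_map_from_subtopology_mono Ku unfolding unit_top_def by blast
    then have c: "continuous_map (gtop G) euclidean ?f"
      by (rule continuous_map_clopen_cases[OF _ _ cobD(3,4)[OF K]]) simp
    have bd': "bounded (?f ` units G)" and bdK: "bounded (?f ` ?K)"
    proof -
      have *: "bounded (insert 0 (f ` units G))" using bd by simp
      show "bounded (?f ` units G)" "bounded (?f ` ?K)"
        using Ku by (auto intro!: bounded_subset[OF *])
    qed
    have "bop G ?K ?f = bop G (units G) ?f"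
      by (rule bop_units_eqI[OF Ku bdK]) (use Ku in \<open>auto simp only: coord_bop_units[OF subset_refl bd'] mult_zero_left split: if_splits\<close>)
    then have "bop G ?K ?f - b = bop G (units G) (\<lambda>x. ?f x - f x)"
      by (simp only: f(2) bop_diff[OF bisection_units[OF subset_refl] bd' bd])
    moreover have "norm (bop G (units G) (\<lambda>x. ?f x - f x)) \<le> e / 2"
    proof (rule norm_bop_le[OF bisection_units[OF subset_refl]])
      fix x assume "x \<in> units G"
      have "cmod (f x) < e / 2" if "x \<notin> ?K"
      proof (rule ccontr)
        assume "\<not> cmod (f x) < e / 2"
        then have "x \<in> ?C" using \<open>x \<in> units G\<close> by simp
        from subsetD[OF T(3) this] that show False by contradiction
      qed
      then show "cmod (?f x - f x) \<le> e / 2" using e by (cases "x \<in> ?K") auto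
    qed (use e in simp)
    ultimately show "\<exists>y\<in>closure (span (nops G)). dist y b < e"
      using bop_in_closure[OF K c] e by (intro bexI[of _ "bop G ?K ?f"]) (auto simp: dist_norm)
  qed
  then show "b \<in> A" by (simp add: reduced_algebra_eq)
qed

lemma separable_A:
  obtains D where "countable D" "A \<subseteq> closure D"
proof -
  obtain Q :: "complex set" where Q: "countable Q" "\<And>X. open X \<Longrightarrow> X \<noteq> {} \<Longrightarrow> \<exists>d\<in>Q. d \<in> X"
    using countable_dense_setE by blast
  let ?R = "(\<lambda>(c, U). scale_op c (nop G U)) ` (Q \<times> compact_open_bisections G)"
  \<comment> \<open>Finite lists over a countable set are countable, and concatenating lists adds
    their sums, so \<open>D\<close> is closed under addition.\<close>
  define D where "D = sum_list ` lists ?R"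
  have R: "countable ?R" using Q(1) countable_bisections by (intro countable_image countable_SIGMA)
  then have "countable D" unfolding D_def by (rule countable_image[OF countable_lists])
  have zero: "0 \<in> D" unfolding D_def by (rule image_eqI[of _ _ "[]"]) auto
  have add: "a + b \<in> closure D" if "a \<in> closure D" "b \<in> closure D" for a b
  proof -
    have "x + y \<in> D" if "x \<in> D" "y \<in> D" for x y
    proof -
      obtain xs ys where "xs \<in> lists ?R" "x = sum_list xs" "ys \<in> lists ?R" "y = sum_list ys"
        using \<open>x \<in> D\<close> \<open>y \<in> D\<close> unfolding D_def by blast
      then show ?thesis unfolding D_def by (intro image_eqI[of _ _ "xs @ ys"]) auto
    qed
    moreover obtain X Y where "\<And>n. X n \<in> D" "X \<longlonglongrightarrow> a" "\<And>n. Y n \<in> D" "Y \<longlonglongrightarrow> b"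
      using \<open>a \<in> closure D\<close> \<open>b \<in> closure D\<close> unfolding closure_sequential by blast
    ultimately show ?thesis
      unfolding closure_sequential by (intro exI[of _ "\<lambda>n. X n + Y n"]) (auto intro: tendsto_add)
  qed
  have nop: "scale_op c (nop G U) \<in> closure D" if U: "U \<in> compact_open_bisections G" for c U
    unfolding closure_approachable
  proof (intro allI impI)
    fix e :: real assume e: "0 < e"
    obtain d where d: "d \<in> Q" "d \<in> ball c (e / 2)" using Q(2)[of "ball c (e / 2)"] e by auto
    have "scale_op d (nop G U) \<in> D"
      unfolding D_def using d(1) U by (intro image_eqI[of _ _ "[scale_op d (nop G U)]"]) auto
    moreover have "norm (scale_op d (nop G U) - scale_op c (nop G U)) \<le> e / 2"
      unfolding scale_nop[OF cobD(1)[OF U]] bop_diff[OF cobD(1)[OF U] bounded_const_image bounded_const_image]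
      by (rule norm_bop_le[OF cobD(1)[OF U]]) (use d e in \<open>auto simp: dist_norm norm_minus_commute\<close>)
    ultimately show "\<exists>y\<in>D. dist y (scale_op c (nop G U)) < e"
      using e by (intro bexI[of _ "scale_op d (nop G U)"]) (auto simp: dist_norm)
  qed
  have "a \<in> closure D" if "a \<in> span (nops G)" for a
    using that
  proof (induction rule: span_induct_alt)
    case base
    then show ?case using zero closure_subset by blast
  next
    case (step t a y)
    then show ?case by (intro add) (auto simp: nops_def scaleR_scale_op nop)
  qed
  then have "A \<subseteq> closure D"
    unfolding reduced_algebra_eq by (intro closure_minimal) auto
  with \<open>countable D\<close> show thesis using that by blast
qed

end

section \<open>The Weyl group\<close>

lemma AutD:
  assumes "\<phi> \<in> Aut A"
  shows "\<phi> \<in> Bij A" "inj_on \<phi> A" "\<phi> ` A = A"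
    "a \<in> A \<Longrightarrow> \<phi> a \<in> A"
    "a \<in> A \<Longrightarrow> b \<in> A \<Longrightarrow> \<phi> (a + b) = \<phi> a + \<phi> b"
    "a \<in> A \<Longrightarrow> \<phi> (scale_op c a) = scale_op c (\<phi> a)"
    "a \<in> A \<Longrightarrow> b \<in> A \<Longrightarrow> \<phi> (a o\<^sub>L b) = \<phi> a o\<^sub>L \<phi> b"
    "a \<in> A \<Longrightarrow> b \<in> A \<Longrightarrow> is_adjoint a b \<Longrightarrow> is_adjoint (\<phi> a) (\<phi> b)"
  using assms by (auto simp: Aut_def Bij_def bij_betw_def)

lemma AutI:
  assumes "\<phi> \<in> Bij A"
    "\<And>a b. a \<in> A \<Longrightarrow> b \<in> A \<Longrightarrow> \<phi> (a + b) = \<phi> a + \<phi> b"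
    "\<And>c a. a \<in> A \<Longrightarrow> \<phi> (scale_op c a) = scale_op c (\<phi> a)"
    "\<And>a b. a \<in> A \<Longrightarrow> b \<in> A \<Longrightarrow> \<phi> (a o\<^sub>L b) = \<phi> a o\<^sub>L \<phi> b"
    "\<And>a b. a \<in> A \<Longrightarrow> b \<in> A \<Longrightarrow> is_adjoint a b \<Longrightarrow> is_adjoint (\<phi> a) (\<phi> b)"
  shows "\<phi> \<in> Aut A"
  using assms by (simp add: Aut_def)

text \<open>The group theory sees the algebras only through these closure properties. Adjoints in
  \<open>A\<close> are what makes the inverse of an automorphism compatible with adjoints.\<close>

locale operator_pair =
  fixes A B :: "'g operator set"
  assumes add_closed: "a \<in> A \<Longrightarrow> b \<in> A \<Longrightarrow> a + b \<in> A"
    and scale_closed: "a \<in> A \<Longrightarrow> scale_op c a \<in> A"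
    and compose_closed: "a \<in> A \<Longrightarrow> b \<in> A \<Longrightarrow> a o\<^sub>L b \<in> A"
    and adjoint_closed: "a \<in> A \<Longrightarrow> \<exists>b\<in>A. is_adjoint a b"
    and subalgebra: "B \<subseteq> A"
begin

abbreviation "W \<equiv> Aut_pair_group A B"

lemma compose_Aut:
  assumes "\<phi> \<in> Aut A" "\<psi> \<in> Aut A"
  shows "compose A \<phi> \<psi> \<in> Aut A"
proof (rule AutI)
  show "compose A \<phi> \<psi> \<in> Bij A" using assms by (intro compose_Bij AutD(1))
qed (simp_all add: compose_eq AutD[OF assms(1)] AutD[OF assms(2)] add_closed scale_closed compose_closed)

lemma id_Aut: "(\<lambda>a\<in>A. a) \<in> Aut A"
  by (rule AutI) (simp_all add: id_Bij add_closed scale_closed compose_closed)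

lemma inverse_Aut:
  assumes \<phi>: "\<phi> \<in> Aut A"
  shows "(\<lambda>a\<in>A. inv_into A \<phi> a) \<in> Aut A"
proof (rule AutI)
  let ?\<psi> = "\<lambda>a\<in>A. inv_into A \<phi> a"
  note D = AutD[OF \<phi>]
  show "?\<psi> \<in> Bij A" by (rule restrict_inv_into_Bij[OF D(1)])
  have \<psi>: "?\<psi> a \<in> A" "\<phi> (?\<psi> a) = a" if "a \<in> A" for a
    using that D(3) by (simp_all add: inv_into_into f_inv_into_f)
  have eq: "?\<psi> a = b" if "b \<in> A" "\<phi> b = a" for a b
    using inv_into_f_f[OF D(2) that(1)] D(4)[OF that(1)] that(2) by simp
  fix a b c assume a: "a \<in> A"
  show "?\<psi> (scale_op c a) = scale_op c (?\<psi> a)"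
    by (rule eq) (use \<psi>[OF a] in \<open>simp_all only: scale_closed D(6)\<close>)
  assume b: "b \<in> A"
  show "?\<psi> (a + b) = ?\<psi> a + ?\<psi> b"
    by (rule eq) (use \<psi>[OF a] \<psi>[OF b] in \<open>simp_all only: add_closed D(5)\<close>)
  show "?\<psi> (a o\<^sub>L b) = ?\<psi> a o\<^sub>L ?\<psi> b"
    by (rule eq) (use \<psi>[OF a] \<psi>[OF b] in \<open>simp_all only: compose_closed D(7)\<close>)
  assume ab: "is_adjoint a b"
  \<comment> \<open>Adjoints are assumed to be preserved in the forward direction only. The adjoint
    \<open>c\<close> of the preimage of \<open>a\<close> is mapped to an adjoint of
    \<open>a\<close>, so by uniqueness \<phi> sends \<open>c\<close> to \<open>b\<close>.\<close>
  obtain c where c: "c \<in> A" "is_adjoint (?\<psi> a) c" using adjoint_closed \<psi>(1)[OF a] by blast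
  have "is_adjoint a (\<phi> c)" using D(8)[OF \<psi>(1)[OF a] c] \<psi>(2)[OF a] by simp
  then have "?\<psi> b = c" using is_adjoint_unique[OF ab] c(1) by (intro eq) auto
  then show "is_adjoint (?\<psi> a) (?\<psi> b)" using c(2) by simp
qed

lemma Aut_pair_subgroup: "subgroup (Aut_pair A B) (BijGroup A)"
proof (rule group.subgroupI[OF group_BijGroup])
  show "Aut_pair A B \<subseteq> carrier (BijGroup A)" by (auto simp: Aut_pair_def BijGroup_def AutD(1))
  show "Aut_pair A B \<noteq> {}"
  proof -
    have "(\<lambda>a\<in>A. a) ` B = B" using subalgebra by (force simp: image_iff)
    then have "(\<lambda>a\<in>A. a) \<in> Aut_pair A B" using id_Aut unfolding Aut_pair_def by blast
    then show ?thesis by blast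
  qed
  fix \<phi> assume \<phi>: "\<phi> \<in> Aut_pair A B"
  then have D: "\<phi> \<in> Aut A" "\<phi> ` B = B" by (auto simp: Aut_pair_def)
  have "(\<lambda>a\<in>A. inv_into A \<phi> a) ` B = inv_into A \<phi> ` B"
    using subalgebra by (intro image_cong) auto
  also have "\<dots> = inv_into A \<phi> ` \<phi> ` B" by (simp add: D(2))
  also have "\<dots> = B" by (rule inv_into_image_cancel[OF AutD(2)[OF D(1)] subalgebra])
  finally show "inv\<^bsub>BijGroup A\<^esub> \<phi> \<in> Aut_pair A B"
    using inverse_Aut[OF D(1)] by (simp add: inv_BijGroup AutD(1)[OF D(1)] Aut_pair_def)
  fix \<psi> assume "\<psi> \<in> Aut_pair A B"
  then have E: "\<psi> \<in> Aut A" "\<psi> ` B = B" by (auto simp: Aut_pair_def)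
  have "compose A \<phi> \<psi> ` B = \<phi> ` \<psi> ` B"
    unfolding image_image using subalgebra by (intro image_cong) (auto simp: compose_eq)
  then show "\<phi> \<otimes>\<^bsub>BijGroup A\<^esub> \<psi> \<in> Aut_pair A B"
    using compose_Aut[OF D(1) E(1)] D E AutD(1)[OF D(1)] AutD(1)[OF E(1)]
    by (simp add: BijGroup_def Aut_pair_def)
qed

lemma group_W: "group W"
  unfolding Aut_pair_group_def
  by (rule subgroup.subgroup_is_group[OF Aut_pair_subgroup group_BijGroup])

lemma carrier_W: "carrier W = Aut_pair A B"
  by (simp add: Aut_pair_group_def)

lemma mult_W: "\<phi> \<in> Aut_pair A B \<Longrightarrow> \<psi> \<in> Aut_pair A B \<Longrightarrow> \<phi> \<otimes>\<^bsub>W\<^esub> \<psi> = compose A \<phi> \<psi>"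
  by (simp add: Aut_pair_group_def BijGroup_def Aut_pair_def AutD(1))

lemma inv_W: "\<phi> \<in> Aut_pair A B \<Longrightarrow> inv\<^bsub>W\<^esub> \<phi> = (\<lambda>a\<in>A. inv_into A \<phi> a)"
  unfolding Aut_pair_group_def
  by (subst group.m_inv_consistent[OF group_BijGroup Aut_pair_subgroup])
    (auto simp: inv_BijGroup AutD(1) Aut_pair_def)

lemma inv_W_apply:
  assumes "\<phi> \<in> Aut_pair A B" "b \<in> B"
  shows "(inv\<^bsub>W\<^esub> \<phi>) b \<in> B" "\<phi> ((inv\<^bsub>W\<^esub> \<phi>) b) = b"
proof -
  have "b \<in> \<phi> ` B" using assms by (simp add: Aut_pair_def)
  then obtain b' where b': "b' \<in> B" "\<phi> b' = b" by blast
  have "b \<in> A" "b' \<in> A" using b'(1) assms(2) subalgebra by auto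
  then have "(inv\<^bsub>W\<^esub> \<phi>) b = b'"
    using b'(2) assms(1) AutD(2)[of \<phi> A] by (auto simp: inv_W Aut_pair_def)
  then show "(inv\<^bsub>W\<^esub> \<phi>) b \<in> B" "\<phi> ((inv\<^bsub>W\<^esub> \<phi>) b) = b" using b' by auto
qed

lemma Aut_fix_iff: "\<phi> \<in> Aut_fix A B \<longleftrightarrow> \<phi> \<in> Aut_pair A B \<and> (\<forall>b\<in>B. \<phi> b = b)"
  by (auto simp: Aut_fix_def Aut_pair_def)

lemma W_closed:
  shows "\<phi> \<in> Aut_pair A B \<Longrightarrow> \<psi> \<in> Aut_pair A B \<Longrightarrow> \<phi> \<otimes>\<^bsub>W\<^esub> \<psi> \<in> Aut_pair A B"
    and "\<phi> \<in> Aut_pair A B \<Longrightarrow> inv\<^bsub>W\<^esub> \<phi> \<in> Aut_pair A B"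
  using group.is_monoid[OF group_W, THEN monoid.m_closed] group.inv_closed[OF group_W]
  unfolding carrier_W by blast+

lemma mult_W_apply:
  "\<phi> \<in> Aut_pair A B \<Longrightarrow> \<psi> \<in> Aut_pair A B \<Longrightarrow> b \<in> B \<Longrightarrow> (\<phi> \<otimes>\<^bsub>W\<^esub> \<psi>) b = \<phi> (\<psi> b)"
  using subalgebra by (auto simp: mult_W compose_eq)

text \<open>The inverse of \<phi> maps \<open>B\<close> into \<open>B\<close>, so in a conjugate by
  \<phi> the middle factor acts on \<open>B\<close> trivially and the outer ones cancel.\<close>

lemma Aut_fix_normal: "Aut_fix A B \<lhd> W"
proof -
  have "subgroup (Aut_fix A B) W"
  proof (rule group.subgroupI[OF group_W])
    show "Aut_fix A B \<subseteq> carrier W" by (auto simp: carrier_W Aut_fix_iff)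
    show "Aut_fix A B \<noteq> {}" using id_Aut subalgebra by (force simp: Aut_fix_def)
  next
    fix \<phi> assume "\<phi> \<in> Aut_fix A B"
    then have \<phi>: "\<phi> \<in> Aut_pair A B" "\<And>b. b \<in> B \<Longrightarrow> \<phi> b = b" by (auto simp: Aut_fix_iff)
    have "(inv\<^bsub>W\<^esub> \<phi>) b = b" if "b \<in> B" for b
      using \<phi>(2)[OF inv_W_apply(1)[OF \<phi>(1) that]] inv_W_apply(2)[OF \<phi>(1) that] by simp
    then show "inv\<^bsub>W\<^esub> \<phi> \<in> Aut_fix A B"
      unfolding Aut_fix_iff using W_closed(2)[OF \<phi>(1)] by blast
    fix \<psi> assume "\<psi> \<in> Aut_fix A B"
    then have \<psi>: "\<psi> \<in> Aut_pair A B" "\<And>b. b \<in> B \<Longrightarrow> \<psi> b = b" by (auto simp: Aut_fix_iff)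
    show "\<phi> \<otimes>\<^bsub>W\<^esub> \<psi> \<in> Aut_fix A B"
      unfolding Aut_fix_iff using W_closed(1)[OF \<phi>(1) \<psi>(1)] \<phi> \<psi> by (simp add: mult_W_apply)
  qed
  moreover have "\<phi> \<otimes>\<^bsub>W\<^esub> \<theta> \<otimes>\<^bsub>W\<^esub> (inv\<^bsub>W\<^esub> \<phi>) \<in> Aut_fix A B"
    if \<phi>: "\<phi> \<in> Aut_pair A B" and \<theta>: "\<theta> \<in> Aut_fix A B" for \<phi> \<theta> 
  proof -
    have \<theta>: "\<theta> \<in> Aut_pair A B" "\<And>b. b \<in> B \<Longrightarrow> \<theta> b = b" using \<theta> by (auto simp: Aut_fix_iff)
    have "(\<phi> \<otimes>\<^bsub>W\<^esub> \<theta> \<otimes>\<^bsub>W\<^esub> (inv\<^bsub>W\<^esub> \<phi>)) b = b" if b: "b \<in> B" for b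
      using inv_W_apply[OF \<phi> b] by (simp add: mult_W_apply W_closed \<phi> \<theta> b)
    then show ?thesis unfolding Aut_fix_iff using W_closed \<phi> \<theta>(1) by blast
  qed
  ultimately show ?thesis
    unfolding group.normal_inv_iff[OF group_W] carrier_W by blast
qed

text \<open>If \<phi> and \<psi> agree on \<open>B\<close>, then \<psi> composed with the inverse of
  \<phi> fixes \<open>B\<close> and carries \<phi> to \<psi> within one right coset.\<close>

lemma coset_eqI:
  assumes \<phi>: "\<phi> \<in> Aut_pair A B" and \<psi>: "\<psi> \<in> Aut_pair A B" and eq: "\<And>b. b \<in> B \<Longrightarrow> \<phi> b = \<psi> b"
  shows "Aut_fix A B #>\<^bsub>W\<^esub> \<phi> = Aut_fix A B #>\<^bsub>W\<^esub> \<psi>"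
proof -
  interpret group W by (rule group_W)
  let ?\<theta> = "\<psi> \<otimes>\<^bsub>W\<^esub> inv\<^bsub>W\<^esub> \<phi>"
  have c: "\<phi> \<in> carrier W" "\<psi> \<in> carrier W" using \<phi> \<psi> by (simp_all add: carrier_W)
  have "?\<theta> b = b" if b: "b \<in> B" for b
    using inv_W_apply[OF \<phi> b] eq[OF inv_W_apply(1)[OF \<phi> b]]
    by (simp add: mult_W_apply W_closed \<phi> \<psi> b)
  then have "?\<theta> \<in> Aut_fix A B" unfolding Aut_fix_iff using W_closed \<phi> \<psi> by blast
  moreover have "?\<theta> \<otimes>\<^bsub>W\<^esub> \<phi> = \<psi>" using c by (simp add: m_assoc)
  ultimately have "\<psi> \<in> Aut_fix A B #>\<^bsub>W\<^esub> \<phi>" unfolding r_coset_def by force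
  then show ?thesis
    using repr_independence c(1) normal_imp_subgroup[OF Aut_fix_normal] by blast
qed

text \<open>An element of \<open>A\<close> and \<open>U = UNIV\<close> give a subbasic set equal to
  \<open>Aut A\<close>; with \<open>A\<close> empty there would be no subbasic set at all.\<close>

lemma topspace_point_norm: "A \<noteq> {} \<Longrightarrow> topspace (point_norm_topology A) = Aut A"
  unfolding point_norm_topology_def topology_generated_by_topspace using open_UNIV by blast

lemma openin_point_norm_ball:
  assumes "finite N" "N \<subseteq> A" "A \<noteq> {}"
  shows "openin (point_norm_topology A) {\<psi> \<in> Aut A. \<forall>a\<in>N. \<psi> a \<in> ball (\<phi> a) \<delta>}"
  using assms(1,2)
proof (induction N)
  case empty
  then show ?case using openin_topspace[of "point_norm_topology A"] by (simp add: topspace_point_norm[OF assms(3)])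
next
  case (insert a N)
  have "openin (point_norm_topology A) {\<psi> \<in> Aut A. \<psi> a \<in> ball (\<phi> a) \<delta>}"
    unfolding point_norm_topology_def using insert.prems
    by (intro topology_generated_by_Basis) blast
  then have "openin (point_norm_topology A) ({\<psi> \<in> Aut A. \<psi> a \<in> ball (\<phi> a) \<delta>} \<inter> {\<psi> \<in> Aut A. \<forall>a\<in>N. \<psi> a \<in> ball (\<phi> a) \<delta>})"
    using insert by (intro openin_Int) auto
  moreover have "{\<psi> \<in> Aut A. \<psi> a \<in> ball (\<phi> a) \<delta>} \<inter> {\<psi> \<in> Aut A. \<forall>a\<in>N. \<psi> a \<in> ball (\<phi> a) \<delta>}
     = {\<psi> \<in> Aut A. \<forall>a\<in>insert a N. \<psi> a \<in> ball (\<phi> a) \<delta>}" by auto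
  ultimately show ?case by simp
qed

lemma carrier_quotient: "carrier (W Mod Aut_fix A B) = (\<lambda>\<phi>. Aut_fix A B #>\<^bsub>W\<^esub> \<phi>) ` Aut_pair A B"
  by (auto simp: FactGroup_def RCOSETS_def carrier_W)

end

text \<open>If agreement of two automorphisms on \<open>B\<close> can be detected approximately on a finite set, then
  the cosets of \<open>Aut_fix A B\<close> are open, and separability of \<open>A\<close> leaves room for only
  countably many of them.\<close>

locale rigid_operator_pair = operator_pair +
  fixes N D
  assumes nonempty: "A \<noteq> {}" and finite_N: "finite N" "N \<subseteq> A" and D: "countable D" "A \<subseteq> closure D"
    and rigid: "\<And>\<phi>. \<phi> \<in> Aut_pair A B \<Longrightarrow>
      \<exists>\<delta>>0. \<forall>\<psi>\<in>Aut_pair A B. (\<forall>a\<in>N. \<psi> a \<in> ball (\<phi> a) \<delta>) \<longrightarrow> (\<forall>b\<in>B. \<phi> b = \<psi> b)"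
begin

text \<open>Each \<phi> is coded by a number k fixing an admissible radius and by a map from
  \<open>N\<close> to the dense set \<open>D\<close> that approximates \<phi>. The radius is part of
  the code because it depends on \<phi>. Equal codes force equal cosets, and there are countably
  many codes as \<open>N\<close> is finite.\<close>

lemma countable_quotient: "countable (carrier (W Mod Aut_fix A B))"
proof -
  let ?r = "\<lambda>k. inverse (real (Suc k))"
  \<comment> \<open>Approximation within half the radius lets two automorphisms with the same code
    be compared through the common point of \<open>D\<close>.\<close>
  define good where "good \<phi> k d \<longleftrightarrow> d \<in> N \<rightarrow>\<^sub>E D \<and> (\<forall>a\<in>N. dist (d a) (\<phi> a) < ?r k / 2) \<and>
      (\<forall>\<psi>\<in>Aut_pair A B. (\<forall>a\<in>N. \<psi> a \<in> ball (\<phi> a) (?r k)) \<longrightarrow> (\<forall>b\<in>B. \<phi> b = \<psi> b))" for \<phi> k d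
  have "\<exists>p. good \<phi> (fst p) (snd p)"
    if \<phi>: "\<phi> \<in> Aut_pair A B" for \<phi>
  proof -
    obtain \<delta> where \<delta>: "\<delta> > 0"
      "\<And>\<psi>. \<psi> \<in> Aut_pair A B \<Longrightarrow> \<forall>a\<in>N. \<psi> a \<in> ball (\<phi> a) \<delta> \<Longrightarrow> \<forall>b\<in>B. \<phi> b = \<psi> b"
      using rigid[OF \<phi>] by blast
    obtain k where k: "?r k < \<delta>" using reals_Archimedean[OF \<delta>(1)] by auto
    have "\<exists>x. x \<in> D \<and> dist x (\<phi> a) < ?r k / 2" if "a \<in> N" for a
    proof -
      have "\<phi> a \<in> A" using that finite_N(2) \<phi> AutD(4) by (auto simp: Aut_pair_def)
      then have "\<phi> a \<in> closure D" using D(2) by blast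
      moreover have "0 < ?r k / 2" by simp
      ultimately show ?thesis unfolding closure_approachable by blast
    qed
    then obtain d where d: "\<And>a. a \<in> N \<Longrightarrow> d a \<in> D \<and> dist (d a) (\<phi> a) < ?r k / 2"
      by metis
    have "good \<phi> k (restrict d N)"
      unfolding good_def
    proof (intro conjI ballI impI)
      show "restrict d N \<in> N \<rightarrow>\<^sub>E D" using d by auto
      show "dist (restrict d N a) (\<phi> a) < ?r k / 2" if "a \<in> N" for a
        using d that by simp
      fix \<psi> b assume \<psi>: "\<psi> \<in> Aut_pair A B" "\<forall>a\<in>N. \<psi> a \<in> ball (\<phi> a) (?r k)" and b: "b \<in> B"
      have "\<forall>a\<in>N. \<psi> a \<in> ball (\<phi> a) \<delta>" using \<psi>(2) k by (auto intro: less_trans)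
      then show "\<phi> b = \<psi> b" using \<delta>(2)[OF \<psi>(1)] b by blast
    qed
    then show ?thesis by (intro exI[of _ "(k, restrict d N)"]) simp
  qed
  then obtain p where p: "\<And>\<phi>. \<phi> \<in> Aut_pair A B \<Longrightarrow> good \<phi> (fst (p \<phi>)) (snd (p \<phi>))"
    by metis
  define k d where "k = fst \<circ> p" and "d = snd \<circ> p"
  have kd: "\<And>\<phi>. \<phi> \<in> Aut_pair A B \<Longrightarrow> d \<phi> \<in> N \<rightarrow>\<^sub>E D"
    "\<And>\<phi> a. \<phi> \<in> Aut_pair A B \<Longrightarrow> a \<in> N \<Longrightarrow> dist (d \<phi> a) (\<phi> a) < ?r (k \<phi>) / 2"
    "\<And>\<phi> \<psi>. \<phi> \<in> Aut_pair A B \<Longrightarrow> \<psi> \<in> Aut_pair A B \<Longrightarrow>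
       \<forall>a\<in>N. \<psi> a \<in> ball (\<phi> a) (?r (k \<phi>)) \<Longrightarrow> \<forall>b\<in>B. \<phi> b = \<psi> b"
    using p unfolding good_def k_def d_def o_def by blast+
  let ?q = "\<lambda>\<phi>. Aut_fix A B #>\<^bsub>W\<^esub> \<phi>"
  let ?code = "\<lambda>\<phi>. (k \<phi>, d \<phi>)"
  have eq: "?q \<phi> = ?q \<psi>"
    if \<phi>: "\<phi> \<in> Aut_pair A B" and \<psi>: "\<psi> \<in> Aut_pair A B" and c: "?code \<phi> = ?code \<psi>" for \<phi> \<psi>
  proof -
    have "\<psi> a \<in> ball (\<phi> a) (?r (k \<phi>))" if "a \<in> N" for a
      using kd(2)[OF \<phi> that] kd(2)[OF \<psi> that] c dist_triangle_half_r[of "d \<phi> a" "\<phi> a" _ "\<psi> a"] by auto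
    then show ?thesis using kd(3)[OF \<phi> \<psi>] by (intro coset_eqI[OF \<phi> \<psi>]) blast
  qed
  have "countable ((UNIV :: nat set) \<times> (N \<rightarrow>\<^sub>E D))"
    using finite_N(1) D(1) by (intro countable_SIGMA countable_PiE) auto
  then have "countable (?code ` Aut_pair A B)"
    by (rule countable_subset[rotated]) (use kd(1) in auto)
  \<comment> \<open>Choosing one automorphism for each code gives a map from the codes onto the
    cosets.\<close>
  then have "countable ((\<lambda>c. ?q (SOME \<phi>. \<phi> \<in> Aut_pair A B \<and> ?code \<phi> = c)) ` ?code ` Aut_pair A B)"
    by (rule countable_image)
  moreover have "?q ` Aut_pair A B \<subseteq>
      (\<lambda>c. ?q (SOME \<phi>. \<phi> \<in> Aut_pair A B \<and> ?code \<phi> = c)) ` ?code ` Aut_pair A B"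
  proof
    fix x assume "x \<in> ?q ` Aut_pair A B"
    then obtain \<phi> where \<phi>: "\<phi> \<in> Aut_pair A B" "x = ?q \<phi>" by blast
    let ?\<psi> = "SOME \<psi>. \<psi> \<in> Aut_pair A B \<and> ?code \<psi> = ?code \<phi>"
    have "?\<psi> \<in> Aut_pair A B \<and> ?code ?\<psi> = ?code \<phi>"
      by (rule someI[of _ \<phi>]) (use \<phi> in simp)
    then have "x = ?q ?\<psi>"
      unfolding \<phi>(2) by (intro eq[OF \<phi>(1)]) (elim conjE, (assumption | erule sym))+
    then show "x \<in> (\<lambda>c. ?q (SOME \<phi>. \<phi> \<in> Aut_pair A B \<and> ?code \<phi> = c)) ` ?code ` Aut_pair A B"
      using \<phi>(1) by (intro image_eqI[of _ _ "?code \<phi>"] imageI)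
  qed
  ultimately show ?thesis unfolding carrier_quotient by (rule countable_subset[rotated])
qed

text \<open>By \<open>rigid\<close>, a point-norm neighbourhood of any \<phi> lies in the coset of
  \<phi>. So the preimage of an arbitrary set of cosets is open.\<close>

lemma quotient_discrete:
  "quotient_topology (subtopology (point_norm_topology A) (Aut_pair A B)) (\<lambda>\<phi>. Aut_fix A B #>\<^bsub>W\<^esub> \<phi>)
     = discrete_topology (carrier (W Mod Aut_fix A B))" (is "quotient_topology ?X ?q = _")
proof -
  have X: "topspace ?X = Aut_pair A B"
    by (auto simp: topspace_point_norm[OF nonempty] Aut_pair_def)
  have "openin ?X {\<phi> \<in> topspace ?X. ?q \<phi> \<in> V}" for V
  proof (subst openin_subopen, intro ballI)
    fix \<phi> assume "\<phi> \<in> {\<phi> \<in> topspace ?X. ?q \<phi> \<in> V}"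
    then have \<phi>: "\<phi> \<in> Aut_pair A B" "?q \<phi> \<in> V" unfolding X by auto
    obtain \<delta> where \<delta>: "\<delta> > 0"
      "\<And>\<psi>. \<psi> \<in> Aut_pair A B \<Longrightarrow> \<forall>a\<in>N. \<psi> a \<in> ball (\<phi> a) \<delta> \<Longrightarrow> \<forall>b\<in>B. \<phi> b = \<psi> b"
      using rigid[OF \<phi>(1)] by blast
    let ?T = "{\<psi> \<in> Aut A. \<forall>a\<in>N. \<psi> a \<in> ball (\<phi> a) \<delta>} \<inter> Aut_pair A B"
    have "openin ?X ?T"
      by (intro openin_subtopology_Int openin_point_norm_ball finite_N nonempty)
    moreover have "\<phi> \<in> ?T" using \<phi> \<delta>(1) by (auto simp: Aut_pair_def)
    moreover have "?T \<subseteq> {\<phi> \<in> topspace ?X. ?q \<phi> \<in> V}"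
    proof
      fix \<psi> assume \<psi>: "\<psi> \<in> ?T"
      then have "?q \<phi> = ?q \<psi>" using \<delta>(2)[of \<psi>] by (intro coset_eqI \<phi>) auto
      then show "\<psi> \<in> {\<phi> \<in> topspace ?X. ?q \<phi> \<in> V}" using \<psi> \<phi>(2) unfolding X by auto
    qed
    ultimately show "\<exists>T. openin ?X T \<and> \<phi> \<in> T \<and> T \<subseteq> {\<phi> \<in> topspace ?X. ?q \<phi> \<in> V}" by blast
  qed
  then show ?thesis
    unfolding topology_eq openin_quotient_topology openin_discrete_topology carrier_quotient X by blast
qed

end

section \<open>Conjugation of idempotents of the diagonal\<close>

lemma blinfun_compose_assoc: "(a o\<^sub>L b) o\<^sub>L c = a o\<^sub>L (b o\<^sub>L c)"
  by (rule blinfun_eqI) simp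

text \<open>Exchanging one outer factor at a time costs \<delta> M for the first and (M + 1)
  \<delta> for the second, since the norm of \<open>y\<close> is at most M + 1.\<close>

lemma norm_compose3_diff_le:
  fixes x x' y y' q :: "'b::real_normed_vector \<Rightarrow>\<^sub>L 'b"
  assumes "norm (y - x) \<le> \<delta>" "norm (y' - x') \<le> \<delta>" "norm q \<le> 1" "norm x \<le> M" "norm x' \<le> M" "\<delta> \<le> 1"
  shows "norm ((x o\<^sub>L q o\<^sub>L x') - (y o\<^sub>L q o\<^sub>L y')) \<le> \<delta> * (2 * M + 1)"
proof -
  have n: "norm (a o\<^sub>L q o\<^sub>L b) \<le> norm a * norm b" for a b :: "'b \<Rightarrow>\<^sub>L 'b"
  proof -
    have "norm (a o\<^sub>L q) \<le> norm a"
      using norm_blinfun_compose[of a q] mult_left_le[OF assms(3) norm_ge_zero[of a]] by linarith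
    then show ?thesis
      using norm_blinfun_compose[of "a o\<^sub>L q" b] mult_right_mono[of "norm (a o\<^sub>L q)" "norm a" "norm b"]
      by simp
  qed
  have y: "norm y \<le> M + 1" using norm_triangle_sub[of y x] assms by linarith
  have pos: "0 \<le> \<delta>" "0 \<le> M" using assms norm_ge_zero order_trans by blast+
  have "(x o\<^sub>L q o\<^sub>L x') - (y o\<^sub>L q o\<^sub>L y') = ((x - y) o\<^sub>L q o\<^sub>L x') + (y o\<^sub>L q o\<^sub>L (x' - y'))"
    by (simp add: compose_simps)
  also have "norm \<dots> \<le> norm (x - y) * norm x' + norm y * norm (x' - y')"
    by (rule order_trans[OF norm_triangle_ineq add_mono[OF n n]])
  also have "\<dots> \<le> \<delta> * M + (M + 1) * \<delta>"
    using assms y pos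
    by (intro add_mono mult_mono) (simp_all add: norm_minus_commute)
  finally show ?thesis by (simp add: algebra_simps)
qed

context generated_groupoid
begin

sublocale pair: operator_pair A B
  by unfold_locales (simp_all add: A_add A_scale A_compose A_adjoint diagonal_subset)

lemma nop_units_idempotent:
  assumes "K \<subseteq> units G"
  shows "nop G K o\<^sub>L nop G K = nop G K"
  using bop_units_mul[OF assms bounded_const_image assms bounded_const_image, of 1 1] by simp

text \<open>At a unit lying in exactly one of the two sets the indicators differ by 1, and the norm
  of the difference sees this value.\<close>

lemma diagonal_idempotent_eqI:
  assumes "p \<in> B" "p o\<^sub>L p = p" "q \<in> B" "q o\<^sub>L q = q" "norm (p - q) < 1"
  shows "p = q"
proof -
  obtain K where K: "K \<subseteq> units G" "p = nop G K" using diagonal_idempotent[OF assms(1,2)] by blast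
  obtain L where L: "L \<subseteq> units G" "q = nop G L" using diagonal_idempotent[OF assms(3,4)] by blast
  let ?i = "\<lambda>K x. if x \<in> K then 1 else 0 :: complex"
  have bd: "bounded (?i K ` units G)" for K
    by (rule bounded_subset[of "{0, 1}"]) auto
  have pq: "p - q = bop G (units G) (\<lambda>x. ?i K x - ?i L x)"
    unfolding K(2) L(2) nop_eq_indicator[OF K(1)] nop_eq_indicator[OF L(1)]
    by (rule bop_diff[OF bisection_units[OF subset_refl] bd bd])
  have "x \<in> K \<longleftrightarrow> x \<in> L" if x: "x \<in> units G" for x
  proof -
    have "cmod (?i K x - ?i L x) \<le> norm (p - q)"
      unfolding pq by (rule eval_le_norm_bop_units[OF bounded_minus_comp[OF bd bd] x])
    then show ?thesis using assms(5) by (auto split: if_splits)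
  qed
  then have "K = L" using K L by blast
  then show ?thesis using K L by simp
qed

lemma norm_diagonal_idempotent_le:
  assumes "q \<in> B" "q o\<^sub>L q = q"
  shows "norm q \<le> 1"
proof -
  obtain K where "K \<in> compact_open_bisections G" "q = nop G K"
    using diagonal_idempotent[OF assms] by blast
  then show ?thesis using norm_bop_le[OF cobD(1), of K "\<lambda>_. 1" 1] by simp
qed

lemma Aut_diff:
  assumes \<phi>: "\<phi> \<in> Aut A" and a: "a \<in> A" and b: "b \<in> A"
  shows "\<phi> (a - b) = \<phi> a - \<phi> b"
proof -
  have "a - b \<in> A" using A_add[OF a A_scaleR[OF b, of "-1"]] by simp
  from AutD(5)[OF \<phi> this b] show ?thesis by (simp add: algebra_simps)
qed

lemma Aut_pairD:
  assumes "\<phi> \<in> Aut_pair A B"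
  shows "\<phi> \<in> Aut A" "b \<in> B \<Longrightarrow> \<phi> b \<in> B" "b \<in> B \<Longrightarrow> \<exists>c\<in>B. \<phi> c = b"
proof -
  have \<phi>: "\<phi> \<in> Aut A" "\<phi> ` B = B" using assms by (simp_all add: Aut_pair_def)
  show "\<phi> \<in> Aut A" by fact
  show "b \<in> B \<Longrightarrow> \<phi> b \<in> B" using imageI[of b B \<phi>] \<phi>(2) by simp
  show "\<exists>c\<in>B. \<phi> c = b" if "b \<in> B"
  proof -
    have "b \<in> \<phi> ` B" using that \<phi>(2) by simp
    then show ?thesis by blast
  qed
qed

lemma Aut_pair_idempotent:
  assumes \<phi>: "\<phi> \<in> Aut_pair A B" and K: "K \<in> compact_open_bisections G" "K \<subseteq> units G"
  shows "\<phi> (nop G K) \<in> B" "\<phi> (nop G K) o\<^sub>L \<phi> (nop G K) = \<phi> (nop G K)"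
proof -
  show "\<phi> (nop G K) \<in> B" using Aut_pairD(2)[OF \<phi>] nop_diagonal[OF K] by blast
  show "\<phi> (nop G K) o\<^sub>L \<phi> (nop G K) = \<phi> (nop G K)"
    using AutD(7)[OF Aut_pairD(1)[OF \<phi>] nop_A[OF K(1)] nop_A[OF K(1)]] nop_units_idempotent[OF K(2)]
    by simp
qed

text \<open>Injectivity of \<phi> on \<open>A\<close> pulls idempotency back. Hence computations
  with an idempotent \<open>q\<close> can be carried out inside \<phi>.\<close>

lemma Aut_pair_idempotent_preimage:
  assumes \<phi>: "\<phi> \<in> Aut_pair A B" and q: "q \<in> B" "q o\<^sub>L q = q"
  obtains K where "K \<in> compact_open_bisections G" "K \<subseteq> units G" "\<phi> (nop G K) = q"
proof -
  obtain p where p: "p \<in> B" "\<phi> p = q" using Aut_pairD(3)[OF \<phi> q(1)] by blast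
  note D = AutD[OF Aut_pairD(1)[OF \<phi>]]
  have pA: "p \<in> A" using p(1) diagonal_subset by auto
  have "\<phi> (p o\<^sub>L p) = \<phi> p" using D(7)[OF pA pA] p(2) q(2) by simp
  then have "p o\<^sub>L p = p" by (rule inj_onD[OF D(2) _ A_compose[OF pA pA] pA])
  then obtain K where K: "K \<in> compact_open_bisections G" "K \<subseteq> units G" "p = nop G K"
    by (rule diagonal_idempotent[OF p(1)])
  show thesis by (rule that[OF K(1,2)]) (use K(3) p(2) in simp)
qed

text \<open>Two arrows of \<open>U\<close> with equal domain coincide, so \<alpha> \<beta>^-1 is
  composable only for \<alpha> = \<beta>. Multiplying \<open>U\<close> by units from the right
  merely restricts it.\<close>

lemma set_mul_ginv_subset_units:
  assumes "bisection G U"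
  shows "set_mul G U (ginv G ` U) \<subseteq> units G"
    and "K \<subseteq> units G \<Longrightarrow> set_mul G (set_mul G U K) (ginv G ` U) \<subseteq> units G"
proof -
  have U: "U \<subseteq> arrows G" "inj_on (dom G) U" using assms by (auto simp: bisection_def)
  have UU: "mul G \<alpha> (ginv G \<beta>) \<in> units G" if "\<alpha> \<in> U" "\<beta> \<in> U" "dom G \<alpha> = rng G (ginv G \<beta>)" for \<alpha> \<beta>
  proof -
    have a: "\<alpha> \<in> arrows G" "\<beta> \<in> arrows G" using that U by auto
    have "\<alpha> = \<beta>" by (rule inj_onD[OF U(2)]) (use that a in \<open>simp_all add: rng_ginv\<close>)
    then show ?thesis using a by (simp add: mul_ginv rng_unit)
  qed
  then show "set_mul G U (ginv G ` U) \<subseteq> units G" by (auto simp: set_mul_def)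
  show "set_mul G (set_mul G U K) (ginv G ` U) \<subseteq> units G" if K: "K \<subseteq> units G"
  proof -
    have "\<gamma> \<in> U" if \<gamma>: "\<gamma> \<in> set_mul G U K" for \<gamma>
    proof -
      obtain \<alpha> k where *: "\<gamma> = mul G \<alpha> k" "\<alpha> \<in> U" "k \<in> K" "dom G \<alpha> = rng G k"
        using \<gamma> by (auto simp: set_mul_def)
      then have "k = dom G \<alpha>" using rng_of_unit[of k] K by auto
      moreover have "\<alpha> \<in> arrows G" using *(2) U(1) by auto
      ultimately show ?thesis using * mul_dom[of \<alpha>] by simp
    qed
    then show ?thesis using UU by (auto simp: set_mul_def[of G "set_mul G U K"])
  qed
qed

text \<open>With \<open>q\<close> the image of \<open>nop G K\<close>, the conjugate is the image of
  the operator of U K U^-1, a compact open set of units.\<close>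

lemma Aut_pair_conjugate:
  assumes \<phi>: "\<phi> \<in> Aut_pair A B" and U: "U \<in> compact_open_bisections G" and q: "q \<in> B" "q o\<^sub>L q = q"
  defines "c \<equiv> \<phi> (nop G U) o\<^sub>L q o\<^sub>L \<phi> (nop G (ginv G ` U))"
  shows "c \<in> B" "c o\<^sub>L c = c"
proof -
  obtain K where K: "K \<in> compact_open_bisections G" "K \<subseteq> units G" "\<phi> (nop G K) = q"
    using Aut_pair_idempotent_preimage[OF \<phi> q] by blast
  note U' = compact_open_bisections_ginv[OF U]
  note UK = compact_open_bisections_mul[OF U K(1)]
  note hom = AutD(7)[OF Aut_pairD(1)[OF \<phi>]]
  have "c = \<phi> (nop G (set_mul G (set_mul G U K) (ginv G ` U)))"
    unfolding c_def K(3)[symmetric]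
    by (simp add: hom[symmetric] nop_A U U' UK K(1) nop_mul cobD(1))
  then show "c \<in> B" "c o\<^sub>L c = c"
    using Aut_pair_idempotent[OF \<phi> compact_open_bisections_mul[OF UK U']
        set_mul_ginv_subset_units(2)[OF cobD(1)[OF U] K(2)]] by simp_all
qed

text \<open>This is the conjugate of the identity operator, treated apart because the identity need
  not belong to \<open>B\<close>.\<close>

lemma Aut_pair_range_projection:
  assumes \<phi>: "\<phi> \<in> Aut_pair A B" and U: "U \<in> compact_open_bisections G"
  defines "c \<equiv> \<phi> (nop G U) o\<^sub>L \<phi> (nop G (ginv G ` U))"
  shows "c \<in> B" "c o\<^sub>L c = c"
proof -
  note U' = compact_open_bisections_ginv[OF U]
  have "c = \<phi> (nop G (set_mul G U (ginv G ` U)))"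
    unfolding c_def
    by (simp add: AutD(7)[OF Aut_pairD(1)[OF \<phi>], symmetric] nop_A U U' nop_mul cobD(1))
  then show "c \<in> B" "c o\<^sub>L c = c"
    using Aut_pair_idempotent[OF \<phi> compact_open_bisections_mul[OF U U']
        set_mul_ginv_subset_units(1)[OF cobD(1)[OF U]]] by simp_all
qed

text \<open>Automorphisms are compared through the partial bijections that they induce on idempotents
  of the diagonal; the second clause makes up for the missing unit of the diagonal.\<close>

definition same_action where
  "same_action \<phi> \<psi> U \<longleftrightarrow>
     (\<forall>q\<in>B. q o\<^sub>L q = q \<longrightarrow> \<phi> (nop G U) o\<^sub>L q o\<^sub>L \<phi> (nop G (ginv G ` U))
                          = \<psi> (nop G U) o\<^sub>L q o\<^sub>L \<psi> (nop G (ginv G ` U))) \<and>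
     \<phi> (nop G U) o\<^sub>L \<phi> (nop G (ginv G ` U)) = \<psi> (nop G U) o\<^sub>L \<psi> (nop G (ginv G ` U))"

lemma same_action_if_close:
  assumes \<phi>: "\<phi> \<in> Aut_pair A B" and \<psi>: "\<psi> \<in> Aut_pair A B" and U: "U \<in> compact_open_bisections G"
    and close: "norm (\<psi> (nop G U) - \<phi> (nop G U)) \<le> \<delta>"
      "norm (\<psi> (nop G (ginv G ` U)) - \<phi> (nop G (ginv G ` U))) \<le> \<delta>"
    and M: "norm (\<phi> (nop G U)) \<le> M" "norm (\<phi> (nop G (ginv G ` U))) \<le> M"
    and \<delta>: "\<delta> \<le> 1" "\<delta> * (2 * M + 1) < 1"
  shows "same_action \<phi> \<psi> U"
proof -
  have close': "norm ((\<phi> (nop G U) o\<^sub>L q o\<^sub>L \<phi> (nop G (ginv G ` U))) - (\<psi> (nop G U) o\<^sub>L q o\<^sub>L \<psi> (nop G (ginv G ` U)))) < 1"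
    if "norm q \<le> 1" for q
    using norm_compose3_diff_le[OF close that M \<delta>(1)] \<delta>(2) by linarith
  have 1: "\<phi> (nop G U) o\<^sub>L q o\<^sub>L \<phi> (nop G (ginv G ` U)) = \<psi> (nop G U) o\<^sub>L q o\<^sub>L \<psi> (nop G (ginv G ` U))"
    if q: "q \<in> B" "q o\<^sub>L q = q" for q
    by (rule diagonal_idempotent_eqI[OF Aut_pair_conjugate[OF \<phi> U q] Aut_pair_conjugate[OF \<psi> U q]
          close'[OF norm_diagonal_idempotent_le[OF q]]])
  have id: "a o\<^sub>L id_blinfun = a" for a :: "'a operator"
    by (rule blinfun_eqI) simp
  \<comment> \<open>The norm estimate asks only for a middle factor of norm at most 1, so the
    identity operator may be inserted there.\<close>
  have "\<phi> (nop G U) o\<^sub>L \<phi> (nop G (ginv G ` U)) = \<psi> (nop G U) o\<^sub>L \<psi> (nop G (ginv G ` U))"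
    by (rule diagonal_idempotent_eqI[OF Aut_pair_range_projection[OF \<phi> U] Aut_pair_range_projection[OF \<psi> U]])
      (use close'[OF norm_blinfun_id_le] in \<open>simp only: id\<close>)
  with 1 show ?thesis by (simp add: same_action_def)
qed

lemma ginv_image_set_mul:
  assumes "U \<subseteq> arrows G" "V \<subseteq> arrows G"
  shows "ginv G ` set_mul G U V = set_mul G (ginv G ` V) (ginv G ` U)"
proof (intro subset_antisym subsetI)
  fix \<gamma> assume "\<gamma> \<in> ginv G ` set_mul G U V"
  then obtain \<alpha> \<beta> where *: "\<alpha> \<in> U" "\<beta> \<in> V" "dom G \<alpha> = rng G \<beta>" "\<gamma> = ginv G (mul G \<alpha> \<beta>)"
    by (auto simp: set_mul_def)
  then have a: "\<alpha> \<in> arrows G" "\<beta> \<in> arrows G" using assms by auto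
  show "\<gamma> \<in> set_mul G (ginv G ` V) (ginv G ` U)"
    unfolding set_mul_def
    using * a by (intro CollectI exI[of _ "ginv G \<beta>"] exI[of _ "ginv G \<alpha>"]) (simp add: ginv_of_mul arrow_simps)
next
  fix \<gamma> assume "\<gamma> \<in> set_mul G (ginv G ` V) (ginv G ` U)"
  then obtain \<alpha> \<beta> where *: "\<alpha> \<in> U" "\<beta> \<in> V" "dom G (ginv G \<beta>) = rng G (ginv G \<alpha>)"
    "\<gamma> = mul G (ginv G \<beta>) (ginv G \<alpha>)"
    by (auto simp: set_mul_def)
  then have a: "\<alpha> \<in> arrows G" "\<beta> \<in> arrows G" using assms by auto
  then have d: "dom G \<alpha> = rng G \<beta>" using * by (simp add: arrow_simps)
  then have "\<gamma> = ginv G (mul G \<alpha> \<beta>)" using * a by (simp add: ginv_of_mul)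
  then show "\<gamma> \<in> ginv G ` set_mul G U V" using * d by (auto simp: set_mul_def)
qed

text \<open>Conjugation by a product is an iterated conjugation whose inner result is again an
  idempotent of \<open>B\<close>. For the range projection of the product, this inner idempotent is
  the range projection of \<open>V\<close>.\<close>

lemma same_action_mul:
  assumes \<phi>: "\<phi> \<in> Aut_pair A B" and \<psi>: "\<psi> \<in> Aut_pair A B"
    and U: "U \<in> compact_open_bisections G" and V: "V \<in> compact_open_bisections G"
    and s: "same_action \<phi> \<psi> U" "same_action \<phi> \<psi> V"
  shows "same_action \<phi> \<psi> (set_mul G U V)"
proof -
  note U' = compact_open_bisections_ginv[OF U] and V' = compact_open_bisections_ginv[OF V]
  have m: "\<theta> (nop G (set_mul G U V)) = \<theta> (nop G U) o\<^sub>L \<theta> (nop G V)"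
    "\<theta> (nop G (ginv G ` set_mul G U V)) = \<theta> (nop G (ginv G ` V)) o\<^sub>L \<theta> (nop G (ginv G ` U))"
    if "\<theta> \<in> Aut_pair A B" for \<theta>
    by (simp_all add: AutD(7)[OF Aut_pairD(1)[OF that], symmetric] nop_A U U' V V' nop_mul cobD(1,5)
        ginv_image_set_mul)
  have 1: "\<theta> (nop G (set_mul G U V)) o\<^sub>L q o\<^sub>L \<theta> (nop G (ginv G ` set_mul G U V))
      = \<theta> (nop G U) o\<^sub>L (\<theta> (nop G V) o\<^sub>L q o\<^sub>L \<theta> (nop G (ginv G ` V))) o\<^sub>L \<theta> (nop G (ginv G ` U))"
    and 2: "\<theta> (nop G (set_mul G U V)) o\<^sub>L \<theta> (nop G (ginv G ` set_mul G U V))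
      = \<theta> (nop G U) o\<^sub>L (\<theta> (nop G V) o\<^sub>L \<theta> (nop G (ginv G ` V))) o\<^sub>L \<theta> (nop G (ginv G ` U))"
    if "\<theta> \<in> Aut_pair A B" for \<theta> q
    by (simp_all only: m[OF that] blinfun_compose_assoc)
  have sU: "\<phi> (nop G U) o\<^sub>L q o\<^sub>L \<phi> (nop G (ginv G ` U)) = \<psi> (nop G U) o\<^sub>L q o\<^sub>L \<psi> (nop G (ginv G ` U))"
    if "q \<in> B" "q o\<^sub>L q = q" for q using s(1) that by (simp add: same_action_def)
  have sV: "\<phi> (nop G V) o\<^sub>L q o\<^sub>L \<phi> (nop G (ginv G ` V)) = \<psi> (nop G V) o\<^sub>L q o\<^sub>L \<psi> (nop G (ginv G ` V))"
    if "q \<in> B" "q o\<^sub>L q = q" for q using s(2) that by (simp add: same_action_def)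
  have sV2: "\<phi> (nop G V) o\<^sub>L \<phi> (nop G (ginv G ` V)) = \<psi> (nop G V) o\<^sub>L \<psi> (nop G (ginv G ` V))"
    using s(2) by (simp add: same_action_def)
  show ?thesis
    unfolding same_action_def 1[OF \<phi>] 1[OF \<psi>] 2[OF \<phi>] 2[OF \<psi>]
  proof (intro conjI ballI impI)
    fix q assume q: "q \<in> B" "q o\<^sub>L q = q"
    show "\<phi> (nop G U) o\<^sub>L (\<phi> (nop G V) o\<^sub>L q o\<^sub>L \<phi> (nop G (ginv G ` V))) o\<^sub>L \<phi> (nop G (ginv G ` U))
      = \<psi> (nop G U) o\<^sub>L (\<psi> (nop G V) o\<^sub>L q o\<^sub>L \<psi> (nop G (ginv G ` V))) o\<^sub>L \<psi> (nop G (ginv G ` U))"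
      unfolding sV[OF q, symmetric] by (rule sU[OF Aut_pair_conjugate[OF \<phi> V q]])
  next
    show "\<phi> (nop G U) o\<^sub>L (\<phi> (nop G V) o\<^sub>L \<phi> (nop G (ginv G ` V))) o\<^sub>L \<phi> (nop G (ginv G ` U))
      = \<psi> (nop G U) o\<^sub>L (\<psi> (nop G V) o\<^sub>L \<psi> (nop G (ginv G ` V))) o\<^sub>L \<psi> (nop G (ginv G ` U))"
      unfolding sV2[symmetric] by (rule sU[OF Aut_pair_range_projection[OF \<phi> V]])
  qed
qed

text \<open>Carrying \<open>U\<close> and its inverse together turns the inverse case into a
  swap.\<close>

lemma same_action_generated:
  assumes \<phi>: "\<phi> \<in> Aut_pair A B" and \<psi>: "\<psi> \<in> Aut_pair A B"
    and F: "\<And>U. U \<in> F \<Longrightarrow> same_action \<phi> \<psi> U \<and> same_action \<phi> \<psi> (ginv G ` U)"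
    and U: "U \<in> S"
  shows "same_action \<phi> \<psi> U \<and> same_action \<phi> \<psi> (ginv G ` U)"
  using U
proof induction
  case (generator U)
  then show ?case by (rule F)
next
  case (product U V)
  then show ?case
    using generated_bisections compact_open_bisections_ginv
    by (simp add: same_action_mul[OF \<phi> \<psi>] ginv_image_set_mul cobD(5))
next
  case (inverse U)
  then show ?case using generated_bisections by (simp add: ginv_image_ginv cobD(5))
qed

text \<open>Inclusion-exclusion for indicators. It writes unions in terms of operations that
  automorphisms preserve.\<close>

lemma nop_Un_units:
  assumes "K \<subseteq> units G" "L \<subseteq> units G"
  shows "nop G (K \<union> L) = nop G K + nop G L - (nop G K o\<^sub>L nop G L)"
proof (rule bop_units_eqI[OF Un_least[OF assms] bounded_const_image])
  fix \<xi> \<gamma>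
  show "coord ((nop G K + nop G L - (nop G K o\<^sub>L nop G L)) \<xi>) \<gamma> =
      (if \<gamma> \<in> arrows G \<and> rng G \<gamma> \<in> K \<union> L then 1 * coord \<xi> \<gamma> else 0)"
    by (simp add: coord_bop_units[OF assms(1) bounded_const_image]
        coord_bop_units[OF assms(2) bounded_const_image] blinfun.add_left blinfun.diff_left) blast
qed

text \<open>A set of units is its own inverse and its operator is idempotent, so the second clause
  of \<open>same_action\<close> reads as equality of the two images. A general \<open>K\<close> is a
  finite union of basis sets.\<close>

lemma agree_on_nop_units:
  assumes \<phi>: "\<phi> \<in> Aut_pair A B" and \<psi>: "\<psi> \<in> Aut_pair A B"
    and s: "\<And>U. U \<in> S \<Longrightarrow> same_action \<phi> \<psi> U"
    and K: "K \<in> compact_open_bisections G" "K \<subseteq> units G"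
  shows "\<phi> (nop G K) = \<psi> (nop G K)"
proof -
  have *: "\<phi> (nop G U) = \<psi> (nop G U)" if U: "U \<in> S" "U \<subseteq> units G" for U
  proof -
    have U': "U \<in> compact_open_bisections G" by (rule generated_bisections[OF U(1)])
    have "ginv G ` U = id ` U" by (rule image_cong) (use U(2) ginv_unit in auto)
    then show ?thesis
      using s[OF U(1)] Aut_pair_idempotent(2)[OF \<phi> U' U(2)] Aut_pair_idempotent(2)[OF \<psi> U' U(2)]
      by (simp add: same_action_def)
  qed
  obtain T where T: "finite T" "T \<subseteq> S" "K = \<Union>T"
    by (rule compact_open_eq_Union[OF cobD(2,3)[OF K(1)]])
  have "\<Union>T \<in> compact_open_bisections G \<and> \<phi> (nop G (\<Union>T)) = \<psi> (nop G (\<Union>T))"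
    if "finite T" "T \<subseteq> {U \<in> S. U \<subseteq> units G}" for T
    using that
  proof induction
    case empty
    have "{} \<in> compact_open_bisections G" by (rule cob_unitsI) auto
    moreover have z: "\<theta> 0 = 0" if "\<theta> \<in> Aut_pair A B" for \<theta>
      using AutD(5)[OF Aut_pairD(1)[OF that] A_zero A_zero] by simp
    ultimately show ?case using z[OF \<phi>] z[OF \<psi>] by (simp add: bop_empty)
  next
    case (insert U T)
    then have U: "U \<in> S" "U \<subseteq> units G" "\<Union>T \<subseteq> units G"
      and IH: "\<Union>T \<in> compact_open_bisections G" "\<phi> (nop G (\<Union>T)) = \<psi> (nop G (\<Union>T))"
      by auto
    note U' = generated_bisections[OF U(1)]
    have "U \<union> \<Union>T \<in> compact_open_bisections G"
      by (intro cob_unitsI Un_least U compactin_Un openin_Un cobD(2,3)[OF U'] cobD(2,3)[OF IH(1)])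
    moreover have h: "\<theta> (nop G (U \<union> \<Union>T)) = \<theta> (nop G U) + \<theta> (nop G (\<Union>T)) - (\<theta> (nop G U) o\<^sub>L \<theta> (nop G (\<Union>T)))"
      if "\<theta> \<in> Aut_pair A B" for \<theta>
      unfolding nop_Un_units[OF U(2,3)]
      by (simp add: Aut_diff[OF Aut_pairD(1)[OF that]] AutD(5,7)[OF Aut_pairD(1)[OF that]]
          nop_A A_add A_compose U' IH(1))
    ultimately show ?case using h[OF \<phi>] h[OF \<psi>] *[OF U(1,2)] IH(2) by simp
  qed
  from this[of T] T K(2) show ?thesis by blast
qed

text \<open>If the images f and g of \<open>b\<close> differed at a unit x, one could shift
  \<open>b\<close> so that its image under \<psi> vanishes at x while its image under \<phi> does
  not. Inverting the latter near x makes a product whose \<phi>-image is an idempotent. On it \<phi>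
  and \<psi> agree, although its \<psi>-image vanishes at x.\<close>

lemma agree_on_diagonal:
  assumes \<phi>: "\<phi> \<in> Aut_pair A B" and \<psi>: "\<psi> \<in> Aut_pair A B"
    and nop: "\<And>K. K \<in> compact_open_bisections G \<Longrightarrow> K \<subseteq> units G \<Longrightarrow> \<phi> (nop G K) = \<psi> (nop G K)"
    and b: "b \<in> B"
  shows "\<phi> b = \<psi> b"
proof -
  obtain f where f: "f \<in> C0_units G" "\<phi> b = bop G (units G) f"
    using Aut_pairD(2)[OF \<phi> b] by (auto simp: diagonal_iff)
  obtain g where g: "g \<in> C0_units G" "\<psi> b = bop G (units G) g"
    using Aut_pairD(2)[OF \<psi> b] by (auto simp: diagonal_iff)
  note bf = bounded_C0_units[OF f(1)] and bg = bounded_C0_units[OF g(1)]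
  note bu = bisection_units[OF subset_refl]
  note D\<phi> = Aut_pairD(1)[OF \<phi>] and D\<psi> = Aut_pairD(1)[OF \<psi>]
  have bA: "b \<in> A" using b diagonal_subset by auto
  have "f x = g x" if x: "x \<in> units G" for x
  proof (rule ccontr)
    assume ne: "f x \<noteq> g x"
    obtain K where K: "K \<in> S" "x \<in> K" "K \<subseteq> units G" by (rule basis_at[OF units_open x])
    note K' = generated_bisections[OF K(1)]
    \<comment> \<open>The function to be subtracted must come from an element of \<open>A\<close>.
      As \<phi> and \<psi> agree on \<open>nop G P\<close>, the same element serves for
      both.\<close>
    obtain P where P: "P \<in> compact_open_bisections G" "P \<subseteq> units G" "\<phi> (nop G P) = nop G K"
      by (rule Aut_pair_idempotent_preimage[OF \<phi> nop_diagonal[OF K' K(3)] nop_units_idempotent[OF K(3)]])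
    let ?i = "\<lambda>y. g x * (if y \<in> K then 1 else 0)"
    have bi: "bounded (?i ` units G)" by (rule bounded_subset[of "{0, g x}"]) (auto split: if_splits)
    have ci: "scale_op (g x) (nop G K) = bop G (units G) ?i"
      unfolding nop_eq_indicator[OF K(3)]
      by (rule scale_bop[OF bu]) (rule bounded_subset[of "{0, 1}"], auto)
    let ?b = "b - scale_op (g x) (nop G P)"
    note PA = nop_A[OF P(1)]
    have bA': "?b \<in> A" using A_add[OF bA A_scaleR[OF A_scale[OF PA], of "-1"]] by simp
    have \<phi>b: "\<phi> ?b = bop G (units G) (\<lambda>y. f y - ?i y)"
      unfolding Aut_diff[OF D\<phi> bA A_scale[OF PA]] AutD(6)[OF D\<phi> PA] P(3) ci f(2)
      by (rule bop_diff[OF bu bf bi])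
    have \<psi>b: "\<psi> ?b = bop G (units G) (\<lambda>y. g y - ?i y)"
      unfolding Aut_diff[OF D\<psi> bA A_scale[OF PA]] AutD(6)[OF D\<psi> PA]
        nop[OF P(1,2), symmetric] P(3) ci g(2)
      by (rule bop_diff[OF bu bg bi])
    let ?h = "\<lambda>y. f y - ?i y"
    have "continuous_map (unit_top G) euclidean (\<lambda>y. if y \<in> K then g x else 0)"
      by (rule continuous_map_clopen_cases[OF _ _ clopen_unit_top[OF K' K(3)]]) auto
    then have "continuous_map (unit_top G) euclidean ?i" by (rule continuous_map_eq) simp
    moreover have "continuous_map (unit_top G) euclidean f" using f(1) by (simp add: C0_units_def)
    ultimately have ch: "continuous_map (unit_top G) euclidean ?h"
      by (intro continuous_map_diff)
    have "openin (unit_top G) {y \<in> topspace (unit_top G). ?h y \<in> - {0}}"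
      by (rule openin_continuous_map_preimage[OF ch]) auto
    then have o: "openin (gtop G) {y \<in> units G. ?h y \<noteq> 0}"
      by (simp add: openin_unit_top topspace_unit_top)
    have xh: "x \<in> {y \<in> units G. ?h y \<noteq> 0}" using x K(2) ne by simp
    obtain L where L: "L \<in> S" "x \<in> L" "L \<subseteq> {y \<in> units G. ?h y \<noteq> 0}"
      by (rule basis_at[OF o xh])
    have L': "L \<in> compact_open_bisections G" "L \<subseteq> units G"
      using generated_bisections[OF L(1)] L(3) by auto
    have hL: "?h y \<noteq> 0" if "y \<in> L" for y using subsetD[OF L(3) that] by blast
    \<comment> \<open>\<open>L\<close> is clopen and \<open>?h\<close> does not vanish on it, so the
      inverse cut off outside \<open>L\<close> is continuous with compact support.\<close>
    let ?k = "\<lambda>y. if y \<in> L then inverse (?h y) else 0"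
    have "continuous_map (subtopology (unit_top G) L) (top_of_set (- {0})) ?h"
      by (rule continuous_map_into_subtopology[OF continuous_map_from_subtopology[OF ch]])
        (simp add: Pi_iff hL del: right_minus_eq)
    moreover have "continuous_map (top_of_set (- {0})) euclidean (inverse :: complex \<Rightarrow> complex)"
      unfolding continuous_map_iff_continuous by (intro continuous_on_inverse continuous_on_id) auto
    ultimately have "continuous_map (subtopology (unit_top G) L) euclidean (inverse \<circ> ?h)"
      by (rule continuous_map_compose)
    then have ck: "continuous_map (unit_top G) euclidean ?k"
      unfolding o_def by (rule continuous_map_clopen_cases[OF _ _ clopen_unit_top[OF L']]) simp
    have k: "?k \<in> C0_units G"
      by (rule C0_unitsI[OF ck L']) (meson)
    note bk = bounded_C0_units[OF k]
    have "bop G (units G) ?k \<in> B" unfolding diagonal_iff by (rule bexI[OF refl k])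
    then obtain c where c: "c \<in> B" "\<phi> c = bop G (units G) ?k"
      using Aut_pairD(3)[OF \<phi>] by blast
    have cA: "c \<in> A" using c(1) diagonal_subset by auto
    have bh: "bounded (?h ` units G)" by (rule bounded_minus_comp[OF bf bi])
    have "\<phi> (?b o\<^sub>L c) = bop G (units G \<inter> units G) (\<lambda>y. ?h y * ?k y)"
      unfolding AutD(7)[OF D\<phi> bA' cA] \<phi>b c(2) by (rule bop_units_mul[OF subset_refl bh subset_refl bk])
    also have "\<dots> = nop G L"
      unfolding nop_eq_indicator[OF L'(2)] Int_absorb
    proof (rule bop_cong[OF bu, symmetric])
      show "bounded ((\<lambda>x. if x \<in> L then 1 else 0 :: complex) ` units G)"
        by (rule bounded_subset[of "{0, 1}"]) auto
      show "(if y \<in> L then 1 else 0) = ?h y * ?k y" for y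
        using hL[of y] by (cases "y \<in> L") (simp_all only: if_True if_False right_inverse mult_zero_right simp_thms)
    qed
    finally have \<phi>bc: "\<phi> (?b o\<^sub>L c) = nop G L" .
    \<comment> \<open>Injectivity of \<phi> identifies the product with the operator of a set of
      units, where agreement with \<psi> is known.\<close>
    obtain Q where Q: "Q \<in> compact_open_bisections G" "Q \<subseteq> units G" "\<phi> (nop G Q) = nop G L"
      by (rule Aut_pair_idempotent_preimage[OF \<phi> nop_diagonal[OF L'] nop_units_idempotent[OF L'(2)]])
    have "?b o\<^sub>L c = nop G Q"
      by (rule inj_onD[OF AutD(2)[OF D\<phi>] _ A_compose[OF bA' cA] nop_A[OF Q(1)]])
        (simp only: \<phi>bc Q(3))
    then have \<psi>bc: "\<psi> (?b o\<^sub>L c) = nop G L" using nop[OF Q(1,2)] Q(3) by simp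
    obtain k' where k': "k' \<in> C0_units G" "\<psi> c = bop G (units G) k'"
      using Aut_pairD(2)[OF \<psi> c(1)] by (auto simp: diagonal_iff)
    have bg': "bounded ((\<lambda>y. g y - ?i y) ` units G)" by (rule bounded_minus_comp[OF bg bi])
    \<comment> \<open>Whatever the image of \<open>c\<close> under \<psi>, the first factor vanishes
      at x, whereas \<open>nop G L\<close> has the value 1 there.\<close>
    have "coord (\<psi> (?b o\<^sub>L c) (delta x)) x = (g x - ?i x) * k' x"
      unfolding AutD(7)[OF D\<psi> bA' cA] \<psi>b k'(2) using x
      by (simp add: coord_bop_units[OF subset_refl bg'] coord_bop_units[OF subset_refl bounded_C0_units[OF k'(1)]]
          coord_delta unit_arrow rng_of_unit)
    also have "\<dots> = 0" using K(2) by simp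
    finally have "coord (nop G L (delta x)) x = 0" unfolding \<psi>bc .
    then show False
      using x L(2) by (simp add: coord_bop_units[OF L'(2) bounded_const_image] coord_delta unit_arrow rng_of_unit)
  qed
  then show ?thesis unfolding f(2) g(2) by (rule bop_cong[OF bu bf])
qed

text \<open>Inverses are included since conjugation involves both a bisection and its inverse, and
  since \<open>same_action_generated\<close> starts from both.\<close>

definition detecting where
  "detecting = nop G ` (F \<union> (\<lambda>U. ginv G ` U) ` F)"

lemma finite_detecting: "finite detecting"
  by (simp add: detecting_def finite_generators)

lemma detecting_subset: "detecting \<subseteq> A"
proof -
  have "nop G U \<in> A" "nop G (ginv G ` U) \<in> A" if "U \<in> F" for U
    using subsetD[OF generators that] by (simp_all add: nop_A compact_open_bisections_ginv)
  then show ?thesis by (auto simp: detecting_def)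
qed

text \<open>Finiteness of \<open>detecting\<close> provides the bound M on \<phi>. Close
  automorphisms then have the same action on the generators, hence on the basis and on the
  diagonal.\<close>

lemma rigidity:
  assumes \<phi>: "\<phi> \<in> Aut_pair A B"
  shows "\<exists>\<delta>>0. \<forall>\<psi>\<in>Aut_pair A B. (\<forall>a\<in>detecting. \<psi> a \<in> ball (\<phi> a) \<delta>) \<longrightarrow> (\<forall>b\<in>B. \<phi> b = \<psi> b)"
proof -
  have "bounded (\<phi> ` detecting)" by (simp add: finite_imp_bounded finite_detecting)
  then obtain M where M: "0 < M" "\<And>a. a \<in> detecting \<Longrightarrow> norm (\<phi> a) \<le> M"
    unfolding bounded_pos by force
  \<comment> \<open>Chosen so that \<delta> (2 M + 1) < 1, the gap between distinct idempotents, and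
    \<delta> \<le> 1, as \<open>norm_compose3_diff_le\<close> requires.\<close>
  define \<delta> where "\<delta> = 1 / (2 * M + 2)"
  have \<delta>: "0 < \<delta>" "\<delta> \<le> 1" "\<delta> * (2 * M + 1) < 1" using M(1) by (auto simp: \<delta>_def field_simps)
  have "\<phi> b = \<psi> b"
    if \<psi>: "\<psi> \<in> Aut_pair A B" and close: "\<forall>a\<in>detecting. \<psi> a \<in> ball (\<phi> a) \<delta>" and b: "b \<in> B" for \<psi> b
  proof (rule agree_on_diagonal[OF \<phi> \<psi> agree_on_nop_units[OF \<phi> \<psi>] b])
    have close': "norm (\<psi> a - \<phi> a) \<le> \<delta>" if "a \<in> detecting" for a
      using close that by (auto simp: dist_norm norm_minus_commute less_imp_le)
    have "same_action \<phi> \<psi> U \<and> same_action \<phi> \<psi> (ginv G ` U)" if U: "U \<in> F" for U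
    proof -
      have U': "U \<in> compact_open_bisections G" using U generators by auto
      have d: "nop G U \<in> detecting" "nop G (ginv G ` U) \<in> detecting" using U by (auto simp: detecting_def)
      note c = close'[OF d(1)] close'[OF d(2)] and m = M(2)[OF d(1)] M(2)[OF d(2)]
      have UU: "ginv G ` ginv G ` U = U" by (rule ginv_image_ginv[OF cobD(5)[OF U']])
      show ?thesis
        using same_action_if_close[OF \<phi> \<psi> U' c m \<delta>(2,3)]
          same_action_if_close[OF \<phi> \<psi> compact_open_bisections_ginv[OF U'], unfolded UU, OF c(2,1) m(2,1) \<delta>(2,3)]
        by simp
    qed
    then show "same_action \<phi> \<psi> U" if "U \<in> S" for U
      using same_action_generated[OF \<phi> \<psi> _ that] by blast
  qed
  then show ?thesis using \<delta>(1) by blast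
qed

theorem Weyl_group_countable_discrete:
  "group (Weyl_group G) \<and> countable (carrier (Weyl_group G)) \<and>
   Weyl_topology G = discrete_topology (carrier (Weyl_group G))"
proof -
  obtain D where D: "countable D" "A \<subseteq> closure D" by (rule separable_A)
  interpret rigid: rigid_operator_pair A B detecting D
    by unfold_locales (use A_zero finite_detecting detecting_subset D rigidity in auto)
  show ?thesis
    unfolding Weyl_group_def Weyl_topology_def Let_def
    using normal.factorgroup_is_group[OF pair.Aut_fix_normal] rigid.countable_quotient rigid.quotient_discrete by blast
qed

end

theorem theorem3p1p14:
  fixes G :: "'g groupoid"
  assumes "ample_groupoid G" and "effective G" and "expansive G"
  shows "group (Weyl_group G) \<and> countable (carrier (Weyl_group G)) \<and>
         Weyl_topology G = discrete_topology (carrier (Weyl_group G))"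
proof -
  obtain F where "finite F" "F \<subseteq> compact_open_bisections G"
    "open_basis (gtop G) (generated_inverse_semigroup G F)"
    using assms(3) by (auto simp: expansive_def)
  then have "generated_groupoid G F"
    using assms(1) by (simp add: generated_groupoid_def generated_groupoid_axioms_def)
  then show ?thesis by (rule generated_groupoid.Weyl_group_countable_discrete)
qed

end
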